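(* Let $q\in\mathbb C$ with $0<|q|<1$ and fix a square root $q^{1/2}$ of $q$. Let $a_1,a_2,a_3,b_1,b_2,b_3$ be generic nonzero complex numbers (see context) and let $M_1,M_2,M_3,N_1,N_2,N_3$ be integers satisfying $$a_1a_2a_3=b_1b_2b_3=q^{1/2}\qquad\text{and}\qquad M_1+M_2+M_3=N_1+N_2+N_3=0.$$ Then $$\sum_{m=-\infty}^\infty\oint \prod_{j=1}^3\frac{(q^{1+m/2}/(a_jz);q)_\infty\,(q^{1-m/2}z/b_j;q)_\infty}{(q^{M_j+m/2}a_jz;q)_\infty\,(q^{N_j-m/2}b_j/z;q)_\infty}\;\frac{(-1)^m}{z^{3m}}\;\frac{dz}{2\pi \mathrm i z} =\frac{1}{\prod_{j=1}^3q^{\binom{M_j}{2}+\binom{N_j}{2}}a_j^{M_j}b_j^{N_j}}\prod_{j,k=1}^3\frac{(q/(a_jb_k);q)_\infty}{(a_jb_kq^{M_j+N_k};q)_\infty}.$$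
   Context: Notation: $(a;q)_\infty=\prod_{i=0}^\infty(1-aq^i)$; $\binom{N}{2}=N(N-1)/2$ for every integer $N$ (possibly negative). For $m\in\mathbb Z$, $q^{m/2}=(q^{1/2})^m$, with the same fixed square root $q^{1/2}$ as in the condition $a_1a_2a_3=b_1b_2b_3=q^{1/2}$. Genericity: the parameters are such that, for each $m$, the zeros of the denominator of the integrand split into geometric sequences tending to $0$, namely $z=q^{N_j-m/2+k}b_j$ ($1\le j\le 3$, $k\ge 0$), and geometric sequences tending to $\infty$, namely $z=q^{-M_j-m/2-k}/a_j$ ($1\le j\le 3$, $k\geq 0$), with no point in common; that is, $a_ib_jq^{M_i+N_j}\notin\{q^{-n}:n=0,1,2,\dots\}$ for all $1\le i,j\le 3$. Contour: for each $m$, the integral is over a positively oriented closed contour in $\mathbb C\setminus\{0\}$ separating these two types of points: it has winding number $1$ around $0$ and around every point of the sequences tending to $0$, and winding number $0$ around every point of the sequences tending to $\infty$. *)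

theory Defs
  imports "HOL-Complex_Analysis.Complex_Analysis"
begin

text \<open>The infinite \<open>q\<close>-shifted factorial; \<^const>\<open>prodinf\<close> is $0$ when
  some factor vanishes.\<close>

definition qfac :: "complex \<Rightarrow> complex \<Rightarrow> complex" where
  "qfac a q = (\<Prod>i. 1 - a * q ^ i)"

text \<open>$N(N-1)/2$ for every integer $N$; the division is exact.\<close>

definition binom2 :: "int \<Rightarrow> int" where
  "binom2 N = N * (N - 1) div 2"

text \<open>Throughout, \<open>s\<close> is the fixed square root of \<open>q\<close>, so that
  $q^{m/2}$ is \<open>s powi m\<close>. The families \<open>a\<close>, \<open>b\<close>, \<open>M\<close>, \<open>N\<close> are used only at
  the indices 1, 2, 3. The factor $1/(2\pi\mathrm{i}z)$ is part of the integrand.\<close>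

definition integrand ::
  "complex \<Rightarrow> complex \<Rightarrow> (nat \<Rightarrow> complex) \<Rightarrow> (nat \<Rightarrow> complex) \<Rightarrow> (nat \<Rightarrow> int) \<Rightarrow> (nat \<Rightarrow> int) \<Rightarrow>
     int \<Rightarrow> complex \<Rightarrow> complex" where
  "integrand q s a b M N m z =
     (\<Prod>j=1..3.
        (qfac (q * s powi m / (a j * z)) q * qfac (q * s powi (-m) * z / b j) q) /
        (qfac (q powi (M j) * s powi m * a j * z) q * qfac (q powi (N j) * s powi (-m) * b j / z) q))
     * ((-1) powi m / z powi (3 * m)) * (1 / (2 * of_real pi * \<i> * z))"

definition poles_to_zero ::
  "complex \<Rightarrow> complex \<Rightarrow> (nat \<Rightarrow> complex) \<Rightarrow> (nat \<Rightarrow> int) \<Rightarrow> int \<Rightarrow> complex set" where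
  "poles_to_zero q s b N m =
     {q powi (N j + int k) * s powi (-m) * b j | j k. j \<in> {1..3}}"

definition poles_to_infinity ::
  "complex \<Rightarrow> complex \<Rightarrow> (nat \<Rightarrow> complex) \<Rightarrow> (nat \<Rightarrow> int) \<Rightarrow> int \<Rightarrow> complex set" where
  "poles_to_infinity q s a M m =
     {q powi (- M j - int k) * s powi (-m) / a j | j k. j \<in> {1..3}}"

definition generic ::
  "complex \<Rightarrow> (nat \<Rightarrow> complex) \<Rightarrow> (nat \<Rightarrow> complex) \<Rightarrow> (nat \<Rightarrow> int) \<Rightarrow> (nat \<Rightarrow> int) \<Rightarrow> bool" where
  "generic q a b M N \<longleftrightarrow>
     (\<forall>i\<in>{1..3}. \<forall>j\<in>{1..3}. \<forall>n::nat. a i * b j * q powi (M i + N j) \<noteq> q powi (- int n))"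

text \<open>A closed contour in the punctured plane separating the sets \<open>A\<close> and \<open>B\<close>. It has to avoid
  these points explicitly, since \<^const>\<open>winding_number\<close> is unspecified on the path itself.\<close>

definition separating_contour :: "complex set \<Rightarrow> complex set \<Rightarrow> (real \<Rightarrow> complex) \<Rightarrow> bool" where
  "separating_contour A B \<gamma> \<longleftrightarrow>
     valid_path \<gamma> \<and> pathfinish \<gamma> = pathstart \<gamma> \<and>
     path_image \<gamma> \<inter> (insert 0 A \<union> B) = {} \<and>
     (\<forall>w \<in> insert 0 A. winding_number \<gamma> w = 1) \<and>
     (\<forall>w \<in> B. winding_number \<gamma> w = 0)"

end

theory Submission
  imports Defs
begin

text \<open>With $x = q^{m/2} z$ and $y = q^{-m} x$ the integrand factors as $F(x)\,G(y)$ times a Gaussian weight in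
  \<open>m\<close>, and the poles in \<open>x\<close> no longer depend on \<open>m\<close>. So the left-hand side is one contour integral of
  $F(x)\,H(x)\,dx/(2\pi\mathrm{i}x)$, where \<open>H\<close>, the sum over \<open>m\<close>, is a theta function of degree three:
  $H(qx) = -H(x)/(s^3x^3)$.

  On such theta functions the functional $\varphi \mapsto \oint F \varphi\,dx/x$ annihilates
  $x \prod_j \theta(b_j/x)$, since the integrand is then holomorphic inside the contour. Hence one may assume
  $\varphi(1/a_2) = 0$, and then the integral is the nonterminating Saalschuetz one: it obeys a first order recurrence under
  $(a_1, a_2) \mapsto (a_1 q, a_2/q)$, and its limit is a single residue at $1/a_3$. What remains is
  \<open>H\<close> at $1/a_2$ and $1/a_3$. There the sum over \<open>m\<close> is unilateral, and modulo $x \prod_j \theta(b_j/x)$ it obeys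
  a first order recurrence under $(a_1, a_2) \mapsto (a_1/q, a_2 q)$, whose limit is a single term.\<close>

subsection \<open>Homologous contours\<close>

text \<open>Theta functions with the multiplier of \<open>H\<close> form a three-dimensional space.
  Write T for x theta(b1/x) theta(b2/x) theta(b3/x). Besides T, the functional also kills (1/x)
  theta(a1 x) theta(a2 x) theta(a3 x), for which the integrand is holomorphic outside the contour
  and O(x^-2) at infinity. For generic parameters this leaves one functional up to scale,
  \<phi>(1/a3) T(1/a2) - \<phi>(1/a2) T(1/a3), which explains why two point values suffice and why T
  is eliminated through this determinant. The integers add a twist: \<open>H\<close> is built from
  a_j and b_j, but the poles belong to a_j q^(M_j) and b_j q^(N_j). As the shifts add up to 0, the
  multiplier is the same, and passing between the two sets costs only elementary factors; these make
  up the prefactor on the right-hand side. The argument divides by theta(a2/a3) and T(1/a2), either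
  of which may vanish. So the formula is first proved where they are nonzero and then extended by
  continuity.\<close>

lemma contour_integral_diff_loops:
  assumes S: "open S" "connected S" "finite pts"
    and f: "f holomorphic_on S - pts"
    and g1: "valid_path g1" "pathfinish g1 = pathstart g1" "path_image g1 \<subseteq> S - pts"
    and g2: "valid_path g2" "pathfinish g2 = pathstart g2" "path_image g2 \<subseteq> S - pts"
    and w: "\<And>z. z \<notin> S \<Longrightarrow> winding_number g1 z = winding_number g2 z"
  shows "contour_integral g1 f - contour_integral g2 f =
    2 * of_real pi * \<i> * (\<Sum>p\<in>pts. (winding_number g1 p - winding_number g2 p) * residue f p)"
proof -
  have op: "open (S - pts)" using S by (simp add: finite_imp_closed open_Diff)
  have con: "connected (S - pts)" using S by (simp add: connected_open_delete_finite)
  have "pathstart g1 \<in> S - pts" "pathstart g2 \<in> S - pts"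
    using g1 g2 pathstart_in_path_image by blast+
  then obtain p where p0: "polynomial_function p" "path_image p \<subseteq> S - pts"
      "pathstart p = pathstart g1" "pathfinish p = pathstart g2"
    using connected_open_polynomial_connected[OF op con] by metis
  have p: "valid_path p" using p0 by (simp add: valid_path_polynomial_function)
  \<comment> \<open>In the applications both loops wind around 0, which lies outside
    \<open>S\<close>, so the residue theorem does not apply to either one alone. The loop that runs
    along \<open>g1\<close>, crosses to \<open>g2\<close>, returns along \<open>g2\<close> and
    crosses back has the difference as its winding number, and this vanishes outside
    \<open>S\<close>; the two passages of \<open>p\<close> cancel.\<close>
  define l where "l = g1 +++ (p +++ (reversepath g2 +++ reversepath p))"
  have vl: "valid_path l" unfolding l_def
    by (intro valid_path_join valid_path_imp_reverse g1 g2 p) (simp_all add: p0 g1 g2)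
  have img: "path_image l \<subseteq> S - pts" unfolding l_def
    using g1 g2 p0 by (intro subset_path_image_join) simp_all
  have wl: "winding_number l z = winding_number g1 z - winding_number g2 z" if z: "z \<notin> S - pts" for z
  proof -
    have *: "z \<notin> path_image g1" "z \<notin> path_image g2" "z \<notin> path_image p"
      using z g1 g2 p0 by auto
    have pth: "path g1" "path g2" "path p"
      using g1 g2 p by (simp_all add: valid_path_imp_path)
    have "z \<notin> path_image (reversepath g2 +++ reversepath p)"
      "z \<notin> path_image (p +++ (reversepath g2 +++ reversepath p))"
      using * p0 g2 by (simp_all add: path_image_join)
    then show ?thesis unfolding l_def
      using * pth p0 g1 g2 by (simp add: winding_number_join winding_number_reversepath)
  qed
  have "contour_integral l f = 2 * of_real pi * \<i> * (\<Sum>p\<in>pts. winding_number l p * residue f p)"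
  proof (rule Residue_theorem[OF S f vl _ img, unfolded of_real_mult of_real_numeral])
    show "pathfinish l = pathstart l" unfolding l_def using p0 g2 by simp
    show "\<forall>z. z \<notin> S \<longrightarrow> winding_number l z = 0" using wl w by simp
  qed
  moreover have "contour_integral l f = contour_integral g1 f - contour_integral g2 f"
  proof -
    have i: "f contour_integrable_on g1" "f contour_integrable_on g2" "f contour_integrable_on p"
      using contour_integrable_holomorphic_simple[OF f op] g1 g2 p p0 by auto
    have r: "valid_path (reversepath g2)" "valid_path (reversepath p)"
      using g2 p by (simp_all add: valid_path_imp_reverse)
    have "f contour_integrable_on (reversepath g2 +++ reversepath p)"
      by (intro contour_integrable_joinI r contour_integrable_reversepath g2 p i)
    moreover have "valid_path (reversepath g2 +++ reversepath p)"
      by (intro valid_path_join r) (simp add: p0 g2)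
    ultimately have "contour_integral l f = contour_integral g1 f + (contour_integral p f +
        (contour_integral (reversepath g2) f + contour_integral (reversepath p) f))"
      unfolding l_def using i g1 g2 p r p0
      by (simp add: contour_integrable_reversepath contour_integrable_joinI valid_path_join)
    then show ?thesis using g2 p by (simp add: contour_integral_reversepath)
  qed
  moreover have "(\<Sum>p\<in>pts. winding_number l p * residue f p) =
      (\<Sum>p\<in>pts. (winding_number g1 p - winding_number g2 p) * residue f p)"
    by (intro sum.cong refl) (simp add: wl)
  ultimately show ?thesis by simp
qed

lemma contour_integral_eq_loops:
  assumes "open S" "connected S" "f holomorphic_on S"
    and "valid_path g1" "pathfinish g1 = pathstart g1" "path_image g1 \<subseteq> S"
    and "valid_path g2" "pathfinish g2 = pathstart g2" "path_image g2 \<subseteq> S"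
    and "\<And>z. z \<notin> S \<Longrightarrow> winding_number g1 z = winding_number g2 z"
  shows "contour_integral g1 f = contour_integral g2 f"
  using contour_integral_diff_loops[of S "{}" f g1 g2] assms by simp

section \<open>Contours under dilation\<close>

lemma valid_path_scale:
  fixes c :: complex
  assumes "valid_path g"
  shows "valid_path (\<lambda>t. c * g t)"
proof -
  have "valid_path ((\<lambda>z. c * z) \<circ> g)"
    using assms by (rule valid_path_compose_analytic[where S = UNIV]) (auto intro!: analytic_intros)
  then show ?thesis by (simp add: o_def)
qed

lemma contour_integral_scale:
  fixes c :: complex
  assumes "valid_path g"
  shows "contour_integral (\<lambda>t. c * g t) f = contour_integral g (\<lambda>z. c * f (c * z))"
  using contour_integral_comp_analyticW[of "\<lambda>z. c * z" UNIV g f] assms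
  by (simp add: o_def analytic_intros)

lemma path_image_scale: "path_image (\<lambda>t. c * g t) = (\<lambda>z. c * z) ` path_image g"
  by (auto simp: path_image_def)

lemma winding_number_scale:
  fixes c :: complex
  assumes g: "valid_path g" and "w \<notin> path_image g" and c: "c \<noteq> 0"
  shows "winding_number (\<lambda>t. c * g t) (c * w) = winding_number g w"
proof -
  have "c * w \<notin> path_image (\<lambda>t. c * g t)"
    using assms by (auto simp: path_image_scale)
  then have "winding_number (\<lambda>t. c * g t) (c * w) =
      1 / (2 * pi * \<i>) * contour_integral (\<lambda>t. c * g t) (\<lambda>z. 1 / (z - c * w))"
    by (intro winding_number_valid_path valid_path_scale g)
  also have "contour_integral (\<lambda>t. c * g t) (\<lambda>z. 1 / (z - c * w)) =
      contour_integral g (\<lambda>z. c * (1 / (c * z - c * w)))"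
    by (rule contour_integral_scale[OF g])
  also have "(\<lambda>z. c * (1 / (c * z - c * w))) = (\<lambda>z. 1 / (z - w))"
    using c by (auto simp: fun_eq_iff right_diff_distrib[symmetric])
  finally show ?thesis
    using winding_number_valid_path[OF g assms(2)] by simp
qed

lemma separating_contour_scale:
  assumes sep: "separating_contour A B g" and c: "c \<noteq> 0"
  shows "separating_contour ((\<lambda>z. c * z) ` A) ((\<lambda>z. c * z) ` B) (\<lambda>t. c * g t)"
proof -
  note d = sep[unfolded separating_contour_def]
  have vp: "valid_path g" using d by blast
  have "0 \<notin> path_image g" using d by blast
  have "path_image (\<lambda>t. c * g t) \<inter> (insert 0 ((\<lambda>z. c * z) ` A) \<union> (\<lambda>z. c * z) ` B) = {}"
    using d c by (auto simp: path_image_scale)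
  moreover have "winding_number (\<lambda>t. c * g t) (c * w) = 1" if w: "w \<in> insert 0 A" for w
  proof -
    have "w \<notin> path_image g" "winding_number g w = 1" using w d by blast+
    then show ?thesis using winding_number_scale[OF vp _ c, of w] by simp
  qed
  moreover have "winding_number (\<lambda>t. c * g t) (c * w) = 0" if w: "w \<in> B" for w
  proof -
    have "w \<notin> path_image g" "winding_number g w = 0" using w d by blast+
    then show ?thesis using winding_number_scale[OF vp _ c, of w] by simp
  qed
  ultimately show ?thesis
    unfolding separating_contour_def using d valid_path_scale[OF vp, of c]
    by (force simp: pathfinish_def pathstart_def)
qed

lemma separating_contour_mono:
  assumes "separating_contour A B g" "A' \<subseteq> insert 0 A" "B' \<subseteq> B"
  shows "separating_contour A' B' g"
  using assms unfolding separating_contour_def by blast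

text \<open>The pole sets are countable, so their complement is connected even though poles
  accumulate at 0; no homotopy between the contours has to be constructed. This makes the contours
  for different m interchangeable and yields the invariance under x -> q x.\<close>

lemma separating_contour_independent:
  assumes g: "separating_contour A B g1" "separating_contour A B g2"
    and cl: "closed (insert 0 A \<union> B)" and cnt: "countable A" "countable B"
    and f: "f holomorphic_on - (insert 0 A \<union> B)"
  shows "contour_integral g1 f = contour_integral g2 f"
proof (rule contour_integral_eq_loops)
  show "open (- (insert 0 A \<union> B))" using cl by (simp add: open_closed)
  show "connected (- (insert 0 A \<union> B))"
    using cnt by (intro path_connected_imp_connected path_connected_complement_countable) auto
  show "f holomorphic_on - (insert 0 A \<union> B)" by (rule f)
  fix z assume "z \<notin> - (insert 0 A \<union> B)"
  then show "winding_number g1 z = winding_number g2 z"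
    using g unfolding separating_contour_def by auto
qed (use g in \<open>auto simp: separating_contour_def\<close>)

section \<open>Limits under the contour integral\<close>

lemma compact_neighbourhood:
  fixes K :: "'a :: euclidean_space set"
  assumes K: "compact K" and U: "open U" "K \<subseteq> U"
  obtains V where "open V" "K \<subseteq> V" "compact (closure V)" "closure V \<subseteq> U"
proof -
  obtain e where e: "e > 0" "(\<Union>x\<in>K. cball x e) \<subseteq> U"
    using compact_subset_open_imp_cball_epsilon_subset[OF K U] by blast
  define V where "V = (\<Union>x\<in>K. ball x e)"
  have "(\<Union>x\<in>K. cball x e) = {x + y |x y. x \<in> K \<and> y \<in> cball 0 e}"
  proof safe
    fix x y assume "x \<in> K" "y \<in> cball x e"
    then show "\<exists>x' y'. y = x' + y' \<and> x' \<in> K \<and> y' \<in> cball 0 e"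
      by (intro exI[of _ x] exI[of _ "y - x"]) (auto simp: dist_norm norm_minus_commute)
  next
    fix x y :: 'a assume "x \<in> K" "y \<in> cball 0 e"
    then show "x + y \<in> (\<Union>x\<in>K. cball x e)"
      by (intro UN_I[of x]) (auto simp: dist_norm)
  qed
  then have c: "compact (\<Union>x\<in>K. cball x e)"
    using compact_sums[OF K compact_cball[of 0 e]] by simp
  have "V \<subseteq> (\<Union>x\<in>K. cball x e)" unfolding V_def by force
  then have cV: "closure V \<subseteq> (\<Union>x\<in>K. cball x e)"
    using c by (simp add: closure_minimal compact_imp_closed)
  show thesis
  proof
    show "open V" unfolding V_def by auto
    show "K \<subseteq> V" unfolding V_def using e by auto
    show "compact (closure V)" using c cV
      by (meson bounded_subset closed_closure compact_eq_bounded_closed compact_imp_bounded)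
    show "closure V \<subseteq> U" using cV e by auto
  qed
qed

text \<open>The estimate by a constant times the supremum is for functions holomorphic on an open
  neighbourhood of the path, hence uniform convergence is asked for on \<open>V\<close> and not only
  on the path. The filter is arbitrary because both w -> 0 and finite subsets of an index set
  occur.\<close>

lemma contour_integral_tendsto:
  assumes V: "open V" and g: "valid_path g" "path_image g \<subseteq> V"
    and f: "\<forall>\<^sub>F n in F. f n holomorphic_on V" and l: "l holomorphic_on V"
    and u: "uniform_limit V f l F"
  shows "((\<lambda>n. contour_integral g (f n)) \<longlongrightarrow> contour_integral g l) F"
proof -
  obtain L where L: "L > 0"
    "\<And>f B. f holomorphic_on V \<Longrightarrow> (\<forall>z\<in>V. norm (f z) \<le> B) \<Longrightarrow> norm (contour_integral g f) \<le> L * B"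
    using contour_integral_bound_exists[OF V g] by blast
  show ?thesis
  proof (rule tendstoI)
    fix e :: real assume e: "e > 0"
    have "\<forall>\<^sub>F n in F. \<forall>x\<in>V. dist (f n x) (l x) < e / (2 * L)"
      using uniform_limitD[OF u] e L by simp
    with f show "\<forall>\<^sub>F n in F. dist (contour_integral g (f n)) (contour_integral g l) < e"
    proof eventually_elim
      case (elim n)
      have "norm (contour_integral g (\<lambda>x. f n x - l x)) \<le> L * (e / (2 * L))"
        by (rule L(2)) (use elim l in \<open>auto intro!: holomorphic_intros simp: dist_norm less_imp_le\<close>)
      moreover have "contour_integral g (\<lambda>x. f n x - l x) = contour_integral g (f n) - contour_integral g l"
        by (intro contour_integral_diff contour_integrable_holomorphic_simple[OF _ V g]) (use elim l in auto)
      ultimately show ?case using e L by (simp add: dist_norm)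
    qed
  qed
qed

subsection \<open>Shifted factorials and the theta function\<close>

locale qpoch =
  fixes q :: complex
  assumes q0: "q \<noteq> 0" and q1: "norm q < 1"
begin

abbreviation P :: "complex \<Rightarrow> complex" where "P x \<equiv> qfac x q"

text \<open>The finite factorial (c;q)_n. In the abbreviations below, \<open>d\<close> stands for
  arguments b/x, \<open>m\<close> for b*x, \<open>q\<close> for q/(a*b), and the digit counts the
  factors.\<close>

definition Pn :: "complex \<Rightarrow> nat \<Rightarrow> complex" where
  "Pn c n = (\<Prod>i<n. 1 - c * q ^ i)"

abbreviation "lin3 b1 b2 b3 x \<equiv> (1 - b1 * x) * (1 - b2 * x) * (1 - (b3 :: complex) * x)"
abbreviation "Pd3 b1 b2 b3 x \<equiv> P (b1 / x) * P (b2 / x) * P (b3 / x)"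
abbreviation "Pm3 b1 b2 b3 x \<equiv> P (b1 * x) * P (b2 * x) * P (b3 * x)"
abbreviation "Pq3 a b1 b2 b3 \<equiv> P (q / (a * b1)) * P (q / (a * b2)) * P (q / (a * b3))"
abbreviation "Pnm3 b1 b2 b3 x n \<equiv> Pn (b1 * x) n * Pn (b2 * x) n * Pn (b3 * x) n"
abbreviation "Pnq3 a b1 b2 b3 n \<equiv> Pn (q / (a * b1)) n * Pn (q / (a * b2)) n * Pn (q / (a * b3)) n"
abbreviation "Pm9 a1 a2 a3 b1 b2 b3 \<equiv> Pm3 b1 b2 b3 a1 * Pm3 b1 b2 b3 a2 * Pm3 b1 b2 b3 a3"
abbreviation "Pq9 a1 a2 a3 b1 b2 b3 \<equiv> Pq3 a1 b1 b2 b3 * Pq3 a2 b1 b2 b3 * Pq3 a3 b1 b2 b3"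

definition theta :: "complex \<Rightarrow> complex" where "theta x = P x * P (q / x)"

lemma Pn_0 [simp]: "Pn c 0 = 1" by (simp add: Pn_def)
lemma Pn_Suc: "Pn c (Suc n) = Pn c n * (1 - c * q ^ n)" by (simp add: Pn_def)
lemma Pn_Suc': "Pn c (Suc n) = (1 - c) * Pn (q * c) n"
  unfolding Pn_def by (subst prod.lessThan_Suc_shift) (simp add: mult_ac)

lemma summable_geo: "summable (\<lambda>i. norm (c * q ^ i))"
  using q1 by (simp add: norm_mult norm_power summable_mult summable_geometric)

lemma abs_convergent: "abs_convergent_prod (\<lambda>i. 1 - c * q ^ i)"
proof -
  have "abs_convergent_prod (\<lambda>i. 1 + (- c * q ^ i))"
    using summable_geo[of c] by (intro summable_imp_abs_convergent_prod) (simp add: norm_mult)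
  then show ?thesis by simp
qed

lemma convergent: "convergent_prod (\<lambda>i. 1 - c * q ^ i)"
  by (rule abs_convergent_prod_imp_convergent_prod[OF abs_convergent])

lemma Pn_tendsto: "(\<lambda>n. Pn c n) \<longlonglongrightarrow> P c"
proof -
  have "(\<lambda>n. Pn c (Suc n)) \<longlonglongrightarrow> P c"
    unfolding Pn_def qfac_def lessThan_Suc_atMost by (rule convergent_prod_LIMSEQ[OF convergent])
  then show ?thesis by (simp only: filterlim_sequentially_Suc)
qed

lemma P_rec: "P c = (1 - c) * P (q * c)"
proof -
  have "(\<lambda>n. Pn c (Suc n)) \<longlonglongrightarrow> P c"
    using Pn_tendsto by (simp only: filterlim_sequentially_Suc)
  moreover have "(\<lambda>n. Pn c (Suc n)) \<longlonglongrightarrow> (1 - c) * P (q * c)"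
    unfolding Pn_Suc' by (intro tendsto_intros Pn_tendsto)
  ultimately show ?thesis using LIMSEQ_unique by blast
qed

lemma P_split: "P c = Pn c n * P (q ^ n * c)"
proof (induction n)
  case (Suc n)
  then show ?case using P_rec[of "q ^ n * c"] by (simp add: Pn_Suc mult_ac)
qed simp

lemma P_0 [simp]: "P 0 = 1" by (simp add: qfac_def)
lemma P_1 [simp]: "P 1 = 0" using P_rec[of 1] by simp

lemma P_eq_0_iff: "P c = 0 \<longleftrightarrow> (\<exists>k. c * q ^ k = 1)"
proof
  assume "P c = 0"
  then show "\<exists>k. c * q ^ k = 1"
    unfolding qfac_def using prodinf_nonzero[OF convergent, of c] by force
next
  assume "\<exists>k. c * q ^ k = 1"
  then obtain k where "c * q ^ k = 1" by blast
  then show "P c = 0" using P_split[of c k] P_rec[of "q ^ k * c"] by (simp add: mult.commute)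
qed

text \<open>From |1 - x| \<le> exp |x| and the geometric series: a bound for (c;q)_n with |c| \<le>
  r that does not depend on n. Products of such constants dominate the series below.\<close>

definition bnd :: "real \<Rightarrow> real" where "bnd r = exp (r / (1 - norm q))"

lemma bnd_mono: "r \<le> r' \<Longrightarrow> bnd r \<le> bnd r'"
  unfolding bnd_def using q1 by (simp add: divide_right_mono)
lemma bnd_pos [simp]: "bnd r > 0" by (simp add: bnd_def)
lemma bnd_ge0 [simp]: "bnd r \<ge> 0" by (simp add: bnd_def)

lemma sum_geo_le: "(\<Sum>i\<in>I. norm (c * q ^ i)) \<le> norm c / (1 - norm q)" if "finite I"
proof -
  have "(\<Sum>i\<in>I. norm (c * q ^ i)) \<le> (\<Sum>i. norm (c * q ^ i))"
    by (rule sum_le_suminf[OF summable_geo]) (use that in auto)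
  also have "\<dots> = norm c / (1 - norm q)"
    using q1 by (simp add: norm_mult norm_power suminf_mult suminf_geometric)
  finally show ?thesis .
qed

lemma norm_Pn_le: "norm (Pn c n) \<le> bnd (norm c)"
proof -
  have "norm (Pn c n) \<le> (\<Prod>i<n. exp (norm (c * q ^ i)))"
    unfolding Pn_def prod_norm[symmetric]
  proof (intro prod_mono conjI)
    fix i
    have "norm (1 - c * q ^ i) \<le> 1 + norm (c * q ^ i)"
      by (metis norm_one norm_triangle_ineq4)
    also have "\<dots> \<le> exp (norm (c * q ^ i))" by (rule exp_ge_add_one_self)
    finally show "norm (1 - c * q ^ i) \<le> exp (norm (c * q ^ i))" .
  qed auto
  also have "\<dots> = exp (\<Sum>i<n. norm (c * q ^ i))" by (simp add: exp_sum)
  also have "(\<Sum>i<n. norm (c * q ^ i)) \<le> norm c / (1 - norm q)"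
    by (rule sum_geo_le) simp
  finally show ?thesis by (simp add: bnd_def)
qed

lemma norm_P_le: "norm (P c) \<le> bnd (norm c)"
  by (rule LIMSEQ_le_const2[OF tendsto_norm[OF Pn_tendsto]]) (auto intro: norm_Pn_le)

lemma P_holo: "P holomorphic_on UNIV"
proof (rule holomorphic_uniform_sequence[where f = "\<lambda>n c. Pn c n"])
  show "(\<lambda>c. Pn c n) holomorphic_on UNIV" for n
    unfolding Pn_def by (intro holomorphic_intros)
  fix x :: complex
  have "uniformly_convergent_on (cball x 1) (\<lambda>n c. \<Prod>i<n. 1 + (- c * q ^ i))"
  proof (rule uniformly_convergent_on_prod)
    show "uniformly_convergent_on (cball x 1) (\<lambda>N c. \<Sum>n<N. norm (- c * q ^ n))"
    proof (rule Weierstrass_m_test'_ev[where M = "\<lambda>n. (norm x + 1) * norm q ^ n"])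
      show "summable (\<lambda>n. (norm x + 1) * norm q ^ n)"
        using q1 by (intro summable_mult summable_geometric) auto
      show "\<forall>\<^sub>F n in sequentially. \<forall>c\<in>cball x 1. norm (norm (- c * q ^ n)) \<le> (norm x + 1) * norm q ^ n"
      proof (intro always_eventually allI ballI)
        fix n c assume "c \<in> cball x 1"
        then have "norm c \<le> norm x + 1"
          using norm_triangle_ineq2[of c x] by (simp add: dist_norm norm_minus_commute)
        then show "norm (norm (- c * q ^ n)) \<le> (norm x + 1) * norm q ^ n"
          by (simp add: norm_mult norm_power mult_right_mono)
      qed
    qed
  qed (auto intro!: continuous_intros)
  then have "uniformly_convergent_on (cball x 1) (\<lambda>n c. Pn c n)" by (simp add: Pn_def)
  moreover have "(\<lambda>c. lim (\<lambda>n. Pn c n)) = P"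
    by (intro ext limI Pn_tendsto)
  ultimately have "uniform_limit (cball x 1) (\<lambda>n c. Pn c n) P sequentially"
    by (simp add: uniformly_convergent_uniform_limit_iff)
  then show "\<exists>d>0. cball x d \<subseteq> UNIV \<and> uniform_limit (cball x d) (\<lambda>n c. Pn c n) P sequentially"
    by (intro exI[of _ 1]) auto
qed auto

lemma P_holomorphic [holomorphic_intros]:
  "f holomorphic_on A \<Longrightarrow> (\<lambda>x. P (f x)) holomorphic_on A"
  using holomorphic_on_compose_gen[OF _ P_holo, of f A] by (simp add: o_def)

lemma P_continuous [continuous_intros]:
  "continuous_on A f \<Longrightarrow> continuous_on A (\<lambda>x. P (f x))"
  using continuous_on_compose2[OF holomorphic_on_imp_continuous_on[OF P_holo], of A f] by simp

lemma P_isCont: "isCont P z"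
  using P_continuous[of UNIV "\<lambda>x. x"] by (simp add: continuous_on_eq_continuous_at)

lemma P_tendsto [tendsto_intros]: "(f \<longlongrightarrow> z) F \<Longrightarrow> ((\<lambda>x. P (f x)) \<longlongrightarrow> P z) F"
  by (rule isCont_tendsto_compose[OF P_isCont])

lemma P_q_ne0 [simp]: "P q \<noteq> 0"
proof
  assume "P q = 0"
  then obtain k where "q * q ^ k = 1" by (auto simp: P_eq_0_iff)
  then have "norm q ^ Suc k = 1" by (metis norm_one norm_power power_Suc)
  moreover have "norm q ^ Suc k < 1" using q1 using q1 by (simp add: power_less_one_iff del: power_Suc)
  ultimately show False by simp
qed

section \<open>The theta function and its zeros\<close>

lemma th_1 [simp]: "theta 1 = 0" by (simp add: theta_def)

lemma theta_mult_q: "x \<noteq> 0 \<Longrightarrow> theta (q * x) = - theta x / x"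
proof -
  assume x: "x \<noteq> 0"
  have 1: "P x = (1 - x) * P (q * x)" "P (1 / x) = (1 - 1 / x) * P (q / x)"
    using P_rec[of x] P_rec[of "1 / x"] by simp_all
  have "q / (q * x) = 1 / x" using q0 by simp
  then have "theta (q * x) = P (q * x) * P (1 / x)" unfolding theta_def by simp
  also have "\<dots> = - ((1 - x) * P (q * x) * P (q / x)) / x"
    unfolding 1(2) using x by (simp add: field_simps)
  finally show "theta (q * x) = - theta x / x" unfolding theta_def 1(1)[symmetric] .
qed

lemma theta_eq_0_iff: "x \<noteq> 0 \<Longrightarrow> theta x = 0 \<longleftrightarrow> (\<exists>k::int. x = q powi k)"
proof -
  assume x: "x \<noteq> 0"
  have "P x = 0 \<longleftrightarrow> (\<exists>k::nat. x = q powi (- int k))"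
    unfolding P_eq_0_iff using q0 x by (auto simp: power_int_minus field_simps)
  moreover have "P (q / x) = 0 \<longleftrightarrow> (\<exists>k::nat. x = q powi (1 + int k))"
    unfolding P_eq_0_iff using q0 x by (auto simp: power_int_add field_simps)
  moreover have "(\<exists>k::int. x = q powi k) \<longleftrightarrow> (\<exists>k::nat. x = q powi (- int k)) \<or> (\<exists>k::nat. x = q powi (1 + int k))"
  proof safe
    fix k :: int
    assume *: "\<nexists>ka. q powi k = q powi (1 + int ka)"
    show "\<exists>ka. q powi k = q powi - int ka"
    proof (cases "k \<le> 0")
      case True
      then show ?thesis by (intro exI[of _ "nat (-k)"]) simp
    next
      case False
      then have "k = 1 + int (nat (k - 1))" by simp
      then show ?thesis using * by metis
    qed
  qed auto
  ultimately show ?thesis unfolding theta_def by simp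
qed

end

subsection \<open>The nonterminating Saalschuetz integral\<close>

locale qpoch_sqrt = qpoch +
  fixes s :: complex
  assumes s2: "s ^ 2 = q"
begin

section \<open>The two families of poles in the variable x\<close>

lemma s0: "s \<noteq> 0" using s2 q0 by auto

text \<open>Poles are described as zeros of the factorials rather than as explicit geometric
  sequences. Nonvanishing of the denominators is then membership in \<open>regular\<close>, and P c
  = (1 - c) P(q c) shows at once that multiplying a parameter by q only removes poles.\<close>

definition zeros_in :: "complex set \<Rightarrow> complex set" where
  "zeros_in B = {x. x \<noteq> 0 \<and> (\<exists>b\<in>B. P (b / x) = 0)}"

definition zeros_out :: "complex set \<Rightarrow> complex set" where
  "zeros_out A = {x. \<exists>a\<in>A. P (a * x) = 0}"

abbreviation "regular B A \<equiv> - (insert 0 (zeros_in B) \<union> zeros_out A)"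
abbreviation "separates B A \<equiv> separating_contour (zeros_in B) (zeros_out A)"

lemma countable_zeros_in: "countable B \<Longrightarrow> countable (zeros_in B)"
proof (rule countable_subset)
  show "zeros_in B \<subseteq> (\<Union>b\<in>B. range (\<lambda>k. b * q ^ k))"
    by (fastforce simp: zeros_in_def P_eq_0_iff field_simps)
qed auto

lemma countable_zeros_out: "countable A \<Longrightarrow> countable (zeros_out A)"
proof (rule countable_subset)
  show "zeros_out A \<subseteq> (\<Union>a\<in>A. range (\<lambda>k. 1 / (a * q ^ k)))"
  proof
    fix x assume "x \<in> zeros_out A"
    then obtain a k where *: "a \<in> A" "a * x * q ^ k = 1" by (auto simp: zeros_out_def P_eq_0_iff)
    then have "a \<noteq> 0" by auto
    then have "x = 1 / (a * q ^ k)" using * q0 by (simp add: field_simps)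
    then show "x \<in> (\<Union>a\<in>A. range (\<lambda>k. 1 / (a * q ^ k)))" using * by auto
  qed
qed auto

lemma closed_zeros:
  assumes "finite A" "finite B"
  shows "closed (insert 0 (zeros_in B) \<union> zeros_out A)"
proof -
  have "open (- {0} \<inter> (\<lambda>x. P (b / x)) -` (- {0}))" for b
    by (intro continuous_open_preimage continuous_intros) auto
  moreover have "open ((\<lambda>x. P (a * x)) -` (- {0}))" for a
    by (intro open_vimage continuous_intros open_Compl closed_singleton)
  ultimately have "open (- {0} \<inter> (\<Inter>b\<in>B. - {0} \<inter> (\<lambda>x. P (b / x)) -` (- {0})) \<inter>
      (\<Inter>a\<in>A. (\<lambda>x. P (a * x)) -` (- {0})))"
    using assms by (intro open_Int open_INT) auto
  also have "\<dots> = - (insert 0 (zeros_in B) \<union> zeros_out A)"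
    by (auto simp: zeros_in_def zeros_out_def)
  finally show ?thesis by (simp add: closed_open)
qed

text \<open>A common point would have winding number both 1 and 0. So a separating contour keeps the
  two families of poles apart, and this is how products such as P(b_k a_j) are seen to be
  nonzero.\<close>

lemma zeros_disjoint:
  assumes "separates B A \<gamma>" "x \<in> zeros_out A"
  shows "x \<noteq> 0" "b \<in> B \<Longrightarrow> P (b / x) \<noteq> 0"
proof -
  have "x \<notin> insert 0 (zeros_in B)"
    using assms unfolding separating_contour_def by (metis zero_neq_one)
  then show "x \<noteq> 0" "b \<in> B \<Longrightarrow> P (b / x) \<noteq> 0" by (auto simp: zeros_in_def)
qed

lemma regular_neighbourhood:
  assumes sep: "separates B A \<gamma>" and "finite A" "finite B"
  obtains W where "open W" "path_image \<gamma> \<subseteq> W" "compact (closure W)" "closure W \<subseteq> regular B A"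
proof -
  have "valid_path \<gamma>" "path_image \<gamma> \<subseteq> regular B A" using sep unfolding separating_contour_def by blast+
  moreover have "open (regular B A)" using assms by (intro open_Compl closed_zeros)
  ultimately show thesis using compact_neighbourhood[OF compact_valid_path_image] that by blast
qed

lemma path_zeros:
  assumes "separates B A \<gamma>" "x \<in> path_image \<gamma>"
  shows "x \<noteq> 0" "b \<in> B \<Longrightarrow> P (b / x) \<noteq> 0" "a \<in> A \<Longrightarrow> P (a * x) \<noteq> 0"
  using assms unfolding separating_contour_def zeros_in_def zeros_out_def by auto

section \<open>The recurrence for the moments\<close>

lemma step_algebra:
  fixes U0 U1 a1 c b1 b2 b3 :: complex
  assumes b: "b1 * b2 * b3 = s"
    and R: "U0 * (a1^2 + s * c + a1 * s^3 * c^2 - a1 * c * s * (b1 + b2 + b3)) +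
        U1 * (a1 * c * s * (b1*b2 + b1*b3 + b2*b3) - a1 - c * s^2 * (a1^2 + s * c)) = 0"
  shows "a1 * (U1 - a1 * U0) * ((b1 - s^2*c) * (b2 - s^2*c) * (b3 - s^2*c)) =
     s^2 * c * (U0 - s^2 * c * U1) * lin3 b1 b2 b3 a1"
proof -
  \<comment> \<open>A certificate: the difference of the two sides is an explicit combination of the
    two hypotheses. The coefficients in \<open>R\<close> are sums; they turn into products for the
    combinations U1 - a1 U0 and U0 - q c U1, which are the two integrals of the recurrence.\<close>
  have "a1 * (U1 - a1 * U0) * ((b1 - s^2*c) * (b2 - s^2*c) * (b3 - s^2*c)) -
      s^2 * c * (U0 - s^2 * c * U1) * lin3 b1 b2 b3 a1 =
      (b1 * b2 * b3 - s) * (a1 * (U1 - a1 * U0) + s^2 * c * a1^3 * (U0 - s^2 * c * U1)) -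
      s * (1 - s^2 * c * a1) * (U0 * (a1^2 + s * c + a1 * s^3 * c^2 - a1 * c * s * (b1 + b2 + b3)) +
        U1 * (a1 * c * s * (b1*b2 + b1*b3 + b2*b3) - a1 - c * s^2 * (a1^2 + s * c)))"
    by (simp add: algebra_simps power2_eq_square power3_eq_cube)
  then show ?thesis using assms by simp
qed

abbreviation "kern p c a1 a3 b1 b2 b3 x \<equiv> p * P (c / x) / (P (a1 * x) * P (a3 * x) * Pd3 b1 b2 b3 x)"
abbreviation "moment \<gamma> \<psi> a1 a2 a3 b1 b2 b3 n \<equiv>
  contour_integral \<gamma> (\<lambda>x. kern (\<psi> x / x^n) (q * (q^n / a2)) (q^n * a1) a3 b1 b2 b3 x / x)"

text \<open>Both integrals are moments of one function \<open>E\<close>; they are linked because the integral of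
  $f(x)\,dx/x$ does not change under $x \mapsto qx$, where $f(x) = x E(x) \prod_j (1 - b_j/x)$. The power of
  $x$ is chosen so that both extreme powers cancel, which leaves a relation between two moments only.\<close>

lemma saalschuetz_step:
  assumes sep: "separates {b1,b2,b3} {a1,a3} \<gamma>"
    and \<psi>: "\<psi> holomorphic_on - {0}" and \<psi>q: "\<And>x. x \<noteq> 0 \<Longrightarrow> \<psi> (q * x) = \<psi> x / (c * s^3 * x^2)"
    and a: "a1 * a3 = s * c" and b: "b1 * b2 * b3 = s" and nz: "c \<noteq> 0" "a1 \<noteq> 0" "a3 \<noteq> 0"
  shows "contour_integral \<gamma> (\<lambda>x. kern (\<psi> x / x) (q * (q * c)) (q * a1) a3 b1 b2 b3 x / x) *
          ((1 - q * c / b1) * (1 - q * c / b2) * (1 - q * c / b3)) / a3 =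
         contour_integral \<gamma> (\<lambda>x. kern (\<psi> x) (q * c) a1 a3 b1 b2 b3 x / x) *
          (lin3 b1 b2 b3 a1)"
proof -
  define E where "E = (\<lambda>x. kern (\<psi> x) (q * (q * c)) a1 a3 b1 b2 b3 x)"
  define f where "f = (\<lambda>x. \<psi> x * P (q * (q * c) / x) /
     (P (a1 * x) * P (a3 * x) * (P (q*b1/x) * P (q*b2/x) * P (q*b3/x))))"
  have b_nz: "b1 \<noteq> 0" "b2 \<noteq> 0" "b3 \<noteq> 0" using b s0 by auto
  have vp: "valid_path \<gamma>" using sep by (simp add: separating_contour_def)
  have PR: "P (b / x) = (1 - b / x) * P (q * b / x)" "P (a * x) = (1 - a * x) * P (q * a * x)" for a b x
    using P_rec[of "b/x"] P_rec[of "a * x"] by (simp_all add: mult_ac)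
  have PQ: "P (b / x) \<noteq> 0 \<Longrightarrow> P (q * b / x) = P (b / x) / (1 - b / x)" "P (b / x) \<noteq> 0 \<Longrightarrow> 1 - b / x \<noteq> 0"
    "P (a * x) \<noteq> 0 \<Longrightarrow> P (q * a * x) = P (a * x) / (1 - a * x)" "P (a * x) \<noteq> 0 \<Longrightarrow> 1 - a * x \<noteq> 0" for a b x
    using PR(1)[of b x] PR(2)[of a x] by auto
  have PZ: "P (q * b / x) = 0 \<Longrightarrow> P (b / x) = 0" "P (a * (x / q)) \<noteq> 0 \<Longrightarrow> P (a * x) \<noteq> 0"
     "P (a * (q * x)) = 0 \<Longrightarrow> P (a * x) = 0" for a b x
    using PR(1)[of b x] PR(2)[of a "x / q"] PR(2)[of a x] q0 by (simp_all add: mult_ac)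
  have \<psi>': "(\<lambda>x. \<psi> (q * x)) holomorphic_on - {0}"
  proof -
    have "(\<lambda>x. q * x) ` (- {0}) \<subseteq> - {0}" using q0 by auto
    then show ?thesis
      using holomorphic_on_compose_gen[of "\<lambda>x. q * x" "- {0}" \<psi> "- {0}"] \<psi>
      by (simp add: o_def holomorphic_intros)
  qed
  have f_hol: "f holomorphic_on regular {q*b1,q*b2,q*b3} {a1,a3}"
    unfolding f_def
    by (intro holomorphic_intros holomorphic_on_subset[OF \<psi>]) (auto simp: zeros_in_def zeros_out_def)
  \<comment> \<open>With q b_j in place of b_j, \<open>f\<close> lacks the outermost pole of each
    sequence tending to 0, and both \<gamma> and q \<gamma> separate the poles that remain: dilation
    by q carries the zeros for b_j onto those for q b_j, and the outer zeros onto a larger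
    set.\<close>
  have shift: "contour_integral (\<lambda>t. q * \<gamma> t) f = contour_integral \<gamma> f"
  proof (rule separating_contour_independent)
    show "f holomorphic_on regular {q*b1,q*b2,q*b3} {a1,a3}" by (rule f_hol)
    show "separates {q*b1,q*b2,q*b3} {a1,a3} \<gamma>"
      by (rule separating_contour_mono[OF sep]) (auto simp: zeros_in_def dest: PZ(1))
    show "separates {q*b1,q*b2,q*b3} {a1,a3} (\<lambda>t. q * \<gamma> t)"
    proof (rule separating_contour_mono[OF separating_contour_scale[OF sep q0]]; rule subsetI)
      fix x assume "x \<in> zeros_in {q*b1,q*b2,q*b3}"
      then have "x / q \<in> zeros_in {b1,b2,b3}" using q0 by (auto simp: zeros_in_def mult_ac)
      then show "x \<in> insert 0 ((\<lambda>z. q * z) ` zeros_in {b1,b2,b3})"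
        using q0 by (auto intro!: image_eqI[of _ _ "x / q"])
    next
      fix x assume "x \<in> zeros_out {a1,a3}"
      then have "x / q \<in> zeros_out {a1,a3}" using PZ(2) unfolding zeros_out_def by blast
      then show "x \<in> (\<lambda>z. q * z) ` zeros_out {a1,a3}"
        using q0 by (auto intro!: image_eqI[of _ _ "x / q"])
    qed
  qed (simp_all only: closed_zeros countable_zeros_in countable_zeros_out countable_empty countable_insert finite.intros)
  \<comment> \<open>The coefficients of x^2 and x in the cubic left over from f x - q f(q x) after
    clearing denominators. The x^3 terms cancel by a1 a3 = s c, the constant terms by b1 b2 b3 =
    s.\<close>
  define X where "X = a1^2 + s * c + a1 * s^3 * c^2 - a1 * c * s * (b1 + b2 + b3)"
  define Y where "Y = a1 * c * s * (b1*b2 + b1*b3 + b2*b3) - a1 - c * s^2 * (a1^2 + s * c)"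
  have op: "open (regular {b1,b2,b3} {a1,a3})"
    by (simp only: open_Compl closed_zeros finite.intros)
  have pim: "path_image \<gamma> \<subseteq> regular {b1,b2,b3} {a1,a3}"
    using sep unfolding separating_contour_def by auto
  have E_hol: "E holomorphic_on regular {b1,b2,b3} {a1,a3}"
    unfolding E_def
    by (intro holomorphic_intros holomorphic_on_subset[OF \<psi>]) (auto simp: zeros_in_def zeros_out_def)
  have int: "(\<lambda>x. E x / x) contour_integrable_on \<gamma>" "(\<lambda>x. E x / x^2) contour_integrable_on \<gamma>"
    by (intro contour_integrable_holomorphic_simple[OF _ op vp pim] holomorphic_intros E_hol; auto)+
  define U0 where "U0 = contour_integral \<gamma> (\<lambda>x. E x / x)"
  define U1 where "U1 = contour_integral \<gamma> (\<lambda>x. E x / x^2)"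
  have lin: "contour_integral \<gamma> (\<lambda>x. u * (E x / x) + v * (E x / x^2)) = u * U0 + v * U1" for u v
  proof -
    have "contour_integral \<gamma> (\<lambda>x. u * (E x / x) + v * (E x / x^2)) =
        contour_integral \<gamma> (\<lambda>x. u * (E x / x)) + contour_integral \<gamma> (\<lambda>x. v * (E x / x^2))"
      by (intro contour_integral_add contour_integrable_lmul int)
    then show ?thesis
      by (simp only: contour_integral_lmul[OF int(1)] contour_integral_lmul[OF int(2)] U0_def U1_def)
  qed
  have R: "X * U0 + Y * U1 = 0"
  proof -
    have "contour_integral \<gamma> (\<lambda>x. f x - q * f (q * x)) = 0"
    proof (subst contour_integral_diff)
      show "f contour_integrable_on \<gamma>"
        using pim by (intro contour_integrable_holomorphic_simple[OF f_hol _ vp])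
          (simp_all only: open_Compl closed_zeros finite.intros, auto simp: zeros_in_def zeros_out_def dest: PZ(1))
      have "(\<lambda>x. q * f (q * x)) holomorphic_on regular {b1,b2,b3} {a1,a3}"
        unfolding f_def using q0
        by (intro holomorphic_intros holomorphic_on_subset[OF \<psi>']) (auto simp: zeros_in_def zeros_out_def dest: PZ(3))
      then show "(\<lambda>x. q * f (q * x)) contour_integrable_on \<gamma>"
        by (rule contour_integrable_holomorphic_simple[OF _ op vp pim])
      show "contour_integral \<gamma> f - contour_integral \<gamma> (\<lambda>x. q * f (q * x)) = 0"
        using shift contour_integral_scale[OF vp, of q f] by simp
    qed
    also have "contour_integral \<gamma> (\<lambda>x. f x - q * f (q * x)) =
        contour_integral \<gamma> (\<lambda>x. (X / (a1 * c * s)) * (E x / x) + (Y / (a1 * c * s)) * (E x / x^2))"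
    proof (rule contour_integral_eq)
      fix x assume x: "x \<in> path_image \<gamma>"
      note nzx = path_zeros[OF sep x, simplified]
      define e where "e = \<psi> x * P (q * (q * c) / x)"
      define d where "d = P (a1 * x) * P (a3 * x) * Pd3 b1 b2 b3 x"
      have d: "d \<noteq> 0" using nzx by (simp add: d_def)
      have E: "E x = e / d" by (simp add: E_def e_def d_def)
      have f1: "f x = (1 - b1/x) * (1 - b2/x) * (1 - b3/x) * (e / d)"
      proof -
        have "f x = e / (P (a1 * x) * P (a3 * x) * (P (b1/x) / (1 - b1/x) * (P (b2/x) / (1 - b2/x)) * (P (b3/x) / (1 - b3/x))))"
          using PQ(1)[OF nzx(2), of b1] PQ(1)[OF nzx(2), of b2] PQ(1)[OF nzx(2), of b3]
          by (simp only: f_def e_def insert_iff simp_thms)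
        then show ?thesis by (simp add: d_def mult_ac)
      qed
      have "f (q * x) = \<psi> (q * x) * P (q * c / x) /
         (P (q * a1 * x) * P (q * a3 * x) * Pd3 b1 b2 b3 x)"
        using q0 by (simp add: f_def mult_ac)
      also have "\<dots> = \<psi> x / (c * s^3 * x^2) * ((1 - q * c / x) * P (q * (q * c) / x)) *
         ((1 - a1 * x) * (1 - a3 * x) / (P (a1 * x) * P (a3 * x) * Pd3 b1 b2 b3 x))"
        using PQ(3)[OF nzx(3), of a1] PQ(3)[OF nzx(3), of a3] PR(1)[of "q * c" x] \<psi>q[OF nzx(1)]
        by (simp add: mult_ac)
      also have "\<dots> = (1 - q * c / x) * (1 - a1 * x) * (1 - a3 * x) / (c * s^3 * x^2) * (e / d)"
        by (simp add: e_def d_def)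
      finally have f2: "f (q * x) = (1 - q * c / x) * (1 - a1 * x) * (1 - a3 * x) / (c * s^3 * x^2) * (e / d)" .
      have a3: "a3 = s * c / a1" using a nz by (simp add: field_simps)
      have main: "(1 - b1/x) * (1 - b2/x) * (1 - b3/x) - q * ((1 - q * c / x) * (1 - a1 * x) * (1 - a3 * x) / (c * s^3 * x^2)) =
         X / (a1 * c * s) / x + Y / (a1 * c * s) / x^2"
      proof -
        have "a1 * c * s * ((x-b1)*(x-b2)*(x-b3)) - (x - s^2*c)*(1-a1*x)*(a1 - s*c*x) =
            X*x^2 + Y*x + a1 * c * s * (s - b1 * b2 * b3)"
          unfolding X_def Y_def by (simp add: algebra_simps power2_eq_square power3_eq_cube)
        then have id: "a1 * c * s * ((x-b1)*(x-b2)*(x-b3)) - (x - s^2*c)*(1-a1*x)*(a1 - s*c*x) = X*x^2 + Y*x"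
          using b by simp
        have t1: "(1 - b1/x) * (1 - b2/x) * (1 - b3/x) = a1 * c * s * ((x-b1)*(x-b2)*(x-b3)) / (a1 * c * s * x^3)"
          using nz s0 nzx(1) by (simp add: field_simps power3_eq_cube)
        have t2: "s^2 * ((1 - s^2 * c / x) * (1 - a1 * x) * (1 - s * c / a1 * x) / (c * s^3 * x^2)) =
            (x - s^2*c)*(1-a1*x)*(a1 - s*c*x) / (a1 * c * s * x^3)"
        proof -
          have "1 - s^2 * c / x = (x - s^2*c) / x" "1 - s * c / a1 * x = (a1 - s*c*x) / a1"
            using nz nzx(1) by (simp_all add: field_simps)
          then show ?thesis using nz s0 nzx(1) by (simp add: power2_eq_square power3_eq_cube mult_ac)
        qed
        have t3: "X / (a1 * c * s) / x + Y / (a1 * c * s) / x^2 = (X*x^2 + Y*x) / (a1 * c * s * x^3)"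
          using nz s0 nzx(1) by (simp add: add_divide_distrib power2_eq_square power3_eq_cube mult_ac)
        show ?thesis unfolding a3 s2[symmetric] t1 t2 t3 id[symmetric] by (simp add: diff_divide_distrib)
      qed
      have "f x - q * f (q * x) = ((1 - b1/x) * (1 - b2/x) * (1 - b3/x) -
          q * ((1 - q * c / x) * (1 - a1 * x) * (1 - a3 * x) / (c * s^3 * x^2))) * (e / d)"
        unfolding f1 f2 left_diff_distrib by (simp only: mult.assoc)
      then show "f x - q * f (q * x) = X / (a1 * c * s) * (E x / x) + Y / (a1 * c * s) * (E x / x^2)"
        unfolding main E distrib_right by (simp only: divide_inverse mult_ac)
    qed
    also have "\<dots> = (X * U0 + Y * U1) / (a1 * c * s)"
      unfolding lin by (simp add: add_divide_distrib)
    finally show ?thesis using nz s0 by simp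
  qed
  have I1: "contour_integral \<gamma> (\<lambda>x. kern (\<psi> x / x) (q * (q * c)) (q * a1) a3 b1 b2 b3 x / x) = - a1 * U0 + 1 * U1"
    unfolding lin[symmetric]
  proof (rule contour_integral_eq)
    fix x assume x: "x \<in> path_image \<gamma>"
    note nzx = path_zeros[OF sep x, simplified]
    show "kern (\<psi> x / x) (q * (q * c)) (q * a1) a3 b1 b2 b3 x / x =
       - a1 * (E x / x) + 1 * (E x / x^2)"
      unfolding E_def using PQ(3)[OF nzx(3), of a1] PQ(4)[OF nzx(3), of a1] nzx
      by (simp add: power2_eq_square divide_inverse algebra_simps)
  qed
  have I2: "contour_integral \<gamma> (\<lambda>x. kern (\<psi> x) (q * c) a1 a3 b1 b2 b3 x / x) = 1 * U0 + (- q * c) * U1"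
    unfolding lin[symmetric]
  proof (rule contour_integral_eq)
    fix x assume x: "x \<in> path_image \<gamma>"
    note nzx = path_zeros[OF sep x, simplified]
    show "kern (\<psi> x) (q * c) a1 a3 b1 b2 b3 x / x =
      1 * (E x / x) + - q * c * (E x / x^2)"
      unfolding E_def PR(1)[of "q * c" x] using nzx
      by (simp add: power2_eq_square divide_inverse algebra_simps)
  qed
  have "a1 * (U1 - a1 * U0) * ((b1 - s^2*c) * (b2 - s^2*c) * (b3 - s^2*c)) =
     s^2 * c * (U0 - s^2 * c * U1) * lin3 b1 b2 b3 a1"
    by (rule step_algebra[OF b]) (use R in \<open>simp add: X_def Y_def mult_ac\<close>)
  then have *: "(U1 - a1 * U0) * ((b1 - q*c) * (b2 - q*c) * (b3 - q*c)) / s * a1 / (s * c) =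
      (U0 - q * c * U1) * lin3 b1 b2 b3 a1"
    unfolding s2[symmetric] using nz s0 by (simp add: field_simps power2_eq_square)
  have "(1 - q * c / b1) * (1 - q * c / b2) * (1 - q * c / b3) = (b1 - q*c) * (b2 - q*c) * (b3 - q*c) / s"
    unfolding b[symmetric] using b_nz by (simp add: field_simps)
  moreover have "1 / a3 = a1 / (s * c)" using a nz s0 by (simp add: field_simps)
  ultimately show ?thesis unfolding I1 I2 using * by (simp add: divide_inverse mult_ac)
qed

text \<open>The step applies with q^n a1, q^n/a2 and \<psi>/x^n for a1, c and \<psi>: each division
  by x divides the multiplier by q, which matches c -> q c, and the balancing a1 a3 = s c
  persists.\<close>

lemma saalschuetz_iterate:
  assumes sep: "separates {b1,b2,b3} {a1,a3} \<gamma>"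
    and \<psi>: "\<psi> holomorphic_on - {0}" and \<psi>q: "\<And>x. x \<noteq> 0 \<Longrightarrow> \<psi> (q * x) = a2 * \<psi> x / (s^3 * x^2)"
    and a: "a1 * a2 * a3 = s" and b: "b1 * b2 * b3 = s"
  defines "J \<equiv> \<lambda>n. moment \<gamma> \<psi> a1 a2 a3 b1 b2 b3 n"
  shows "J 0 * Pnm3 b1 b2 b3 a1 n =
    J n / a3^n * Pnq3 a2 b1 b2 b3 n"
proof (induction n)
  case 0
  then show ?case by simp
next
  case (Suc n)
  have nz: "a1 \<noteq> 0" "a2 \<noteq> 0" "a3 \<noteq> 0" using a s0 by auto
  have Pq: "P (q ^ n * a * x) = 0 \<Longrightarrow> P (a * x) = 0" for a x
    using P_split[of "a * x" n] by (simp add: mult_ac)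
  have "contour_integral \<gamma> (\<lambda>x. kern (\<psi> x / x^n / x) (q * (q * (q^n/a2))) (q * (q^n * a1)) a3 b1 b2 b3 x / x) *
          ((1 - q * (q^n/a2) / b1) * (1 - q * (q^n/a2) / b2) * (1 - q * (q^n/a2) / b3)) / a3 =
         moment \<gamma> \<psi> a1 a2 a3 b1 b2 b3 n *
          ((1 - b1 * (q^n * a1)) * (1 - b2 * (q^n * a1)) * (1 - b3 * (q^n * a1)))"
  proof (rule saalschuetz_step)
    show "separates {b1, b2, b3} {q ^ n * a1, a3} \<gamma>"
      by (rule separating_contour_mono[OF sep]) (auto simp: zeros_out_def dest: Pq)
    show "(\<lambda>x. \<psi> x / x ^ n) holomorphic_on - {0}"
      by (intro holomorphic_intros \<psi>) auto
    show "\<psi> (q * x) / (q * x) ^ n = \<psi> x / x ^ n / (q ^ n / a2 * s ^ 3 * x\<^sup>2)" if "x \<noteq> 0" for x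
      unfolding \<psi>q[OF that] using that nz s0 q0 by (simp add: power_mult_distrib mult_ac)
    show "q ^ n * a1 * a3 = s * (q ^ n / a2)" using a nz by (simp add: field_simps)
  qed (use b nz q0 in auto)
  moreover have "contour_integral \<gamma> (\<lambda>x. kern (\<psi> x / x^n / x) (q * (q * (q^n/a2))) (q * (q^n * a1)) a3 b1 b2 b3 x / x) = J (Suc n)"
    unfolding J_def by (simp add: mult_ac)
  ultimately have st: "J (Suc n) * ((1 - q * (q^n/a2) / b1) * (1 - q * (q^n/a2) / b2) * (1 - q * (q^n/a2) / b3)) / a3 =
      J n * ((1 - b1 * (q^n * a1)) * (1 - b2 * (q^n * a1)) * (1 - b3 * (q^n * a1)))"
    unfolding J_def by simp
  have "J 0 * (Pn (b1 * a1) (Suc n) * Pn (b2 * a1) (Suc n) * Pn (b3 * a1) (Suc n)) =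
     (J 0 * Pnm3 b1 b2 b3 a1 n) *
     ((1 - b1 * (q^n * a1)) * (1 - b2 * (q^n * a1)) * (1 - b3 * (q^n * a1)))"
    by (simp add: Pn_Suc mult_ac)
  also have "\<dots> = (J n * ((1 - b1 * (q^n * a1)) * (1 - b2 * (q^n * a1)) * (1 - b3 * (q^n * a1)))) / a3^n *
     Pnq3 a2 b1 b2 b3 n"
    unfolding Suc.IH by simp
  also have "\<dots> = J (Suc n) / a3^Suc n * (Pn (q / (a2 * b1)) (Suc n) * Pn (q / (a2 * b2)) (Suc n) * Pn (q / (a2 * b3)) (Suc n))"
    unfolding st[symmetric] by (simp add: Pn_Suc mult_ac)
  finally show ?case .
qed

section \<open>Residues and the limit of the recurrence\<close>

lemma residue_inverse_P:
  assumes S: "open S" "p \<in> S" "u holomorphic_on S" and p: "a * p * q ^ k = 1"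
  shows "residue (\<lambda>x. u x / P (a * x)) p = - (u p * p) / (Pn (1 / q ^ k) k * P q)"
proof -
  have nz: "a \<noteq> 0" "p \<noteq> 0" using p by auto
  have ap: "a * p = 1 / q ^ k" using p q0 by (simp add: field_simps)
  \<comment> \<open>Splitting the factor 1 - a x q^k = -(x - p)/p off P(a x) leaves v(x)/(x - p)
    with \<open>v\<close> regular at \<open>p\<close>. The zero of P(a x) is simple, but
    \<open>u\<close> may vanish there as well.\<close>
  define v where "v = (\<lambda>x. - (u x * p) / (Pn (a * x) k * P (q ^ Suc k * (a * x))))"
  define T where "T = S \<inter> (\<lambda>x. Pn (a * x) k * P (q ^ Suc k * (a * x))) -` (- {0})"
  have "Pn (a * p) k \<noteq> 0"
  proof -
    have "1 - a * p * q ^ i \<noteq> 0" if "i < k" for i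
    proof
      assume "1 - a * p * q ^ i = 0"
      then have "q ^ k = q ^ i" using q0 by (simp add: ap field_simps)
      then have "norm q ^ k = norm q ^ i" by (metis norm_power)
      moreover have "norm q ^ k < norm q ^ i"
        using that q0 q1 by (intro power_strict_decreasing) auto
      ultimately show False by simp
    qed
    then show ?thesis by (simp add: Pn_def)
  qed
  moreover have "q ^ Suc k * (a * p) = q" using p by (simp add: mult_ac)
  ultimately have pT: "p \<in> T" using S by (simp add: T_def del: power_Suc)
  have "open T" unfolding T_def Pn_def
    by (intro open_Int S open_vimage continuous_intros open_Compl closed_singleton)
  have "v holomorphic_on T"
    unfolding v_def T_def Pn_def by (intro holomorphic_intros holomorphic_on_subset[OF S(3)]) auto
  then have "residue (\<lambda>w. v w / (w - p)) p = v p"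
    using residue_simple[OF \<open>open T\<close> pT] by blast
  moreover have "(\<lambda>w. v w / (w - p)) = (\<lambda>x. u x / P (a * x))"
  proof
    fix x
    have "P (a * x) = Pn (a * x) k * ((1 - a * x * q ^ k) * P (q ^ Suc k * (a * x)))"
      using P_split[of "a * x" k] P_rec[of "q ^ k * (a * x)"] by (simp add: mult_ac)
    also have "1 - a * x * q ^ k = (x - p) / (- p)"
      using p nz by (simp add: field_simps)
    finally show "v x / (x - p) = u x / P (a * x)"
      using nz by (simp add: v_def)
  qed
  ultimately show ?thesis
    using \<open>q ^ Suc k * (a * p) = q\<close> by (simp add: v_def ap del: power_Suc)
qed

lemma P_near_0: "\<exists>d>0. \<forall>c. norm c < d \<longrightarrow> norm (P c) \<ge> 1 / 2"
proof -
  have "(P \<longlongrightarrow> P 0) (at 0)" using P_isCont[of 0] by (simp add: isCont_def)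
  then have "\<forall>\<^sub>F c in at 0. dist (P c) (P 0) < 1/2" by (rule tendstoD) simp
  then obtain d where d: "d > 0" "\<And>c. c \<noteq> 0 \<Longrightarrow> norm c < d \<Longrightarrow> dist (P c) 1 < 1/2"
    by (auto simp: eventually_at)
  have "norm (P c) \<ge> 1/2" if "norm c < d" for c
  proof (cases "c = 0")
    case False
    then have "norm (P c - 1) < 1/2" using d that by (simp add: dist_norm)
    then show ?thesis using norm_triangle_ineq2[of 1 "P c"] by (simp add: norm_minus_commute)
  qed simp
  with d show ?thesis by blast
qed

lemma winding_number_circlepath_outside:
  assumes "0 < r" "r < norm (z - w)"
  shows "winding_number (circlepath w r) z = 0"
proof (rule winding_number_zero_outside[of _ "cball w r"])
  show "z \<notin> cball w r" using assms by (simp add: dist_norm norm_minus_commute)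
qed (use assms in auto)

text \<open>As $n \to \infty$ the factor $x^{-n}$ singles out the residue at the pole $1/a_3$, the smallest one
  outside the contour.\<close>

lemma saalschuetz_limit:
  assumes sep: "separates {b1,b2,b3} {a1,a3} \<gamma>"
    and \<psi>: "\<psi> holomorphic_on - {0}" and nz: "a1 \<noteq> 0" "a2 \<noteq> 0" "a3 \<noteq> 0"
  defines "J \<equiv> \<lambda>n. moment \<gamma> \<psi> a1 a2 a3 b1 b2 b3 n"
  shows "(\<lambda>n. J n / a3^n) \<longlonglongrightarrow>
    2 * of_real pi * \<i> * \<psi> (1 / a3) / (P q * Pm3 b1 b2 b3 a3)"
proof -
  define f where "f = (\<lambda>n x. kern (\<psi> x / x^n) (q * (q^n / a2)) (q^n * a1) a3 b1 b2 b3 x / x)"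
  define u where "u = (\<lambda>n x. \<psi> x / x^n * P (q * (q^n / a2) / x) /
            (P (q^n * a1 * x) * Pd3 b1 b2 b3 x) / x)"
  have fu: "f n = (\<lambda>x. u n x / P (a3 * x))" for n
    by (auto simp: f_def u_def mult_ac)
  define B where "B = norm b1 + norm b2 + norm b3 + 1 / norm a3 + 1"
  have B: "B > 0" "norm b1 < B" "norm b2 < B" "norm b3 < B" "1 / norm a3 < B"
  proof -
    have "norm b1 \<ge> 0" "norm b2 \<ge> 0" "norm b3 \<ge> 0" "1 / norm a3 \<ge> 0" by auto
    then show "B > 0" "norm b1 < B" "norm b2 < B" "norm b3 < B" "1 / norm a3 < B"
      unfolding B_def by linarith+
  qed
  have ns: "norm s ^ 2 = norm q" by (simp add: s2[symmetric] norm_power)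
  have ns1: "norm s < 1"
  proof (rule ccontr)
    assume "\<not> norm s < 1"
    then have "1 \<le> norm s ^ 2" by (intro one_le_power) simp
    then show False using ns q1 by simp
  qed
  have nsq: "norm q < norm s"
    using mult_strict_left_mono[OF ns1, of "norm s"] s0 by (simp add: ns[symmetric] power2_eq_square)
  have "(\<lambda>n. norm q ^ n) \<longlonglongrightarrow> 0" using q1 by (intro LIMSEQ_power_zero) simp
  moreover have "0 < 1 / (norm a3 * norm s * B)" using B nz s0 by simp
  ultimately have "\<forall>\<^sub>F n in sequentially. norm q ^ n < 1 / (norm a3 * norm s * B)"
    by (rule order_tendstoD(2))
  then obtain K where K: "norm q ^ K < 1 / (norm a3 * norm s * B)"
    by (auto simp: eventually_sequentially)
  \<comment> \<open>Since |s| = |q|^(1/2), this is the geometric mean of the moduli of the poles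
    1/(a3 q^k) for k = K and k = K + 1, so the circle passes between them. \<open>K\<close> is large
    enough to make \<open>R\<close> exceed \<open>B\<close>, so that all inner poles and 1/a3 lie
    inside.\<close>
  define R where "R = 1 / (norm a3 * norm s * norm q ^ K)"
  have RB: "B < R"
    using K B nz s0 q0 by (simp add: R_def field_simps)
  have R0: "R > 0" using RB B by simp
  define pts where "pts = (\<lambda>k. 1 / (a3 * q ^ k)) ` {..K}"
  have inj: "inj_on (\<lambda>k. 1 / (a3 * q ^ k)) {..K}"
  proof (rule inj_onI)
    fix i j assume "1 / (a3 * q ^ i) = 1 / (a3 * q ^ j)"
    then have "q ^ i = q ^ j" using nz q0 by (simp add: field_simps)
    then have "norm q ^ i = norm q ^ j" by (metis norm_power)
    then show "i = j"
      using q0 q1 by (cases i j rule: linorder_cases) (auto dest: power_strict_decreasing[of _ _ "norm q"])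
  qed
  have norm_pt: "norm (1 / (a3 * q ^ k)) = 1 / (norm a3 * norm q ^ k)" for k
    by (simp add: norm_divide norm_mult norm_power)
  have pt_in: "norm (1 / (a3 * q ^ k)) < R" if "k \<le> K" for k
  proof -
    have "norm s * norm q ^ K < norm q ^ K" using ns1 q0 by simp
    also have "\<dots> \<le> norm q ^ k" using that q1 by (intro power_decreasing) auto
    finally show ?thesis unfolding norm_pt R_def using nz s0 q0
      by (simp add: divide_strict_left_mono mult.assoc)
  qed
  have pt_out: "norm (1 / (a3 * q ^ k)) > R" if "k > K" for k
  proof -
    have "norm q ^ k \<le> norm q ^ Suc K" using that q1 by (intro power_decreasing) auto
    also have "\<dots> < norm s * norm q ^ K" using nsq q0 by simp
    finally show ?thesis unfolding norm_pt R_def using nz s0 q0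
      by (simp add: divide_strict_left_mono mult.assoc)
  qed
  have circ_a3: "P (a3 * x) \<noteq> 0" if "norm x = R" for x
  proof
    assume "P (a3 * x) = 0"
    then obtain k where "a3 * x * q ^ k = 1" by (auto simp: P_eq_0_iff)
    then have "x = 1 / (a3 * q ^ k)" using nz q0 by (simp add: field_simps)
    then show False using pt_in[of k] pt_out[of k] that by (cases "k \<le> K") auto
  qed
  have zin_R: "norm x < R" if "x \<in> zeros_in {b1,b2,b3}" for x
  proof -
    have "x \<noteq> 0" "\<exists>b\<in>{b1,b2,b3}. P (b / x) = 0"
      using that unfolding zeros_in_def mem_Collect_eq by simp_all
    then obtain b where b: "b \<in> {b1,b2,b3}" "P (b / x) = 0" "x \<noteq> 0" by (elim bexE) simp
    then obtain k where bk: "b / x * q ^ k = 1" unfolding P_eq_0_iff by blast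
    then have "x = b * q ^ k" using b by (simp add: field_simps)
    then have "norm x = norm b * norm q ^ k"
      by (simp add: norm_mult norm_power)
    also have "\<dots> \<le> norm b" using mult_left_mono[of "norm q ^ k" 1 "norm b"] power_le_one[of "norm q" k] q1 by simp
    also have "\<dots> < R"
    proof -
      have "norm b < B" using b(1) B by auto
      then show ?thesis using RB by simp
    qed
    finally show ?thesis .
  qed
  obtain d where d: "d > 0" "\<And>c. norm c < d \<Longrightarrow> norm (P c) \<ge> 1 / 2" using P_near_0 by metis
  \<comment> \<open>Eventually every zero of P(q^n a1 x) lies outside the circle, so that expanding
    the contour to the circle crosses only poles coming from P(a3 x).\<close>
  have "(\<lambda>n. norm q ^ n * (norm a1 * R)) \<longlonglongrightarrow> 0 * (norm a1 * R)"
    using q1 by (intro tendsto_intros LIMSEQ_power_zero) simp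
  then have small: "\<forall>\<^sub>F n in sequentially. norm q ^ n * (norm a1 * R) < d"
    using d(1) by (intro order_tendstoD(2)) auto
  have Pa1: "norm (P (q^n * a1 * x)) \<ge> 1 / 2" if "norm q ^ n * (norm a1 * R) < d" "norm x \<le> R" for n x
  proof (rule d(2))
    have "norm (q^n * a1 * x) = norm q ^ n * (norm a1 * norm x)" by (simp add: norm_mult norm_power)
    also have "\<dots> \<le> norm q ^ n * (norm a1 * R)" using that by (intro mult_left_mono) auto
    finally show "norm (q^n * a1 * x) < d" using that by simp
  qed
  have res: "contour_integral \<gamma> (f n) = contour_integral (circlepath 0 R) (f n) +
       2 * of_real pi * \<i> * (\<Sum>k\<le>K. u n (1 / (a3 * q^k)) * (1 / (a3 * q^k)) / (Pn (1 / q^k) k * P q))"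
    if n: "norm q ^ n * (norm a1 * R) < d" for n
  proof -
    \<comment> \<open>With q^(K+1) a3 in place of a3, the first K + 1 zeros of P(a3 x) are not
      excluded on account of a3; they are the exceptional points \<open>pts\<close>, around which
      the two contours have winding numbers 0 and 1.\<close>
    define S where "S = regular {b1,b2,b3} {q^n * a1, q ^ Suc K * a3}"
    have opS: "open S" unfolding S_def by (simp only: open_Compl closed_zeros finite.intros)
    have Pq: "P (q ^ m * a * x) = 0 \<Longrightarrow> P (a * x) = 0" for a x m
      using P_split[of "a * x" m] by (simp add: mult_ac)
    have sub: "zeros_out {q^n * a1, q ^ Suc K * a3} \<subseteq> zeros_out {a1,a3}"
    proof
      fix x assume "x \<in> zeros_out {q^n * a1, q ^ Suc K * a3}"
      then have "P (q^n * a1 * x) = 0 \<or> P (q ^ Suc K * a3 * x) = 0"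
        by (simp add: zeros_out_def del: power_Suc)
      then have "P (a1 * x) = 0 \<or> P (a3 * x) = 0"
        using Pq[of n a1 x] Pq[of "Suc K" a3 x] by argo
      then show "x \<in> zeros_out {a1,a3}" by (simp add: zeros_out_def)
    qed
    have a1R: "norm x > R" if "P (q^n * a1 * x) = 0" for x
    proof (rule ccontr)
      assume "\<not> norm x > R"
      then have "norm (P (q^n * a1 * x)) \<ge> 1/2" using Pa1[OF n, of x] by simp
      then show False using that by simp
    qed
    have out: "norm x > R" if x: "x \<in> zeros_out {q^n * a1, q ^ Suc K * a3}" for x
    proof -
      have "P (q^n * a1 * x) = 0 \<or> P (q ^ Suc K * a3 * x) = 0"
        using x by (simp add: zeros_out_def del: power_Suc)
      then show ?thesis
      proof
        assume "P (q ^ Suc K * a3 * x) = 0"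
        then obtain j where "q ^ Suc K * a3 * x * q ^ j = 1" by (auto simp: P_eq_0_iff)
        then have "x = 1 / (a3 * q ^ (Suc K + j))"
          unfolding power_add using nz q0 by (simp add: field_simps)
        then show ?thesis using pt_out[of "Suc K + j"] by simp
      qed (rule a1R)
    qed
    have pts_zout: "p \<in> zeros_out {a1,a3}" if "p \<in> pts" for p
    proof -
      obtain k where "p = 1 / (a3 * q ^ k)" using \<open>p \<in> pts\<close> by (auto simp: pts_def)
      then have "a3 * p * q ^ k = 1" using nz q0 by simp
      then have "P (a3 * p) = 0" unfolding P_eq_0_iff by (rule exI)
      then show ?thesis by (simp add: zeros_out_def)
    qed
    have wpts: "winding_number \<gamma> p = 0" "winding_number (circlepath 0 R) p = 1" if "p \<in> pts" for p
    proof -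
      show "winding_number \<gamma> p = 0" using pts_zout[OF that] sep unfolding separating_contour_def by blast
      have "norm p < R" using that pt_in by (auto simp: pts_def)
      then show "winding_number (circlepath 0 R) p = 1"
        by (intro winding_number_circlepath) simp
    qed
    have "contour_integral \<gamma> (f n) - contour_integral (circlepath 0 R) (f n) =
      2 * of_real pi * \<i> * (\<Sum>p\<in>pts. (winding_number \<gamma> p - winding_number (circlepath 0 R) p) * residue (f n) p)"
    proof (rule contour_integral_diff_loops[OF opS])
      show "connected S" unfolding S_def
        by (intro path_connected_imp_connected path_connected_complement_countable countable_Un
            countable_insert countable_zeros_in countable_zeros_out) auto
      show "finite pts" by (simp add: pts_def)
      show "f n holomorphic_on S - pts"
      proof -
        have "P (a3 * x) \<noteq> 0" if "x \<in> S - pts" for x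
        proof
          assume "P (a3 * x) = 0"
          then obtain k where k: "a3 * x * q ^ k = 1" by (auto simp: P_eq_0_iff)
          then have x: "x = 1 / (a3 * q ^ k)" using nz q0 by (simp add: field_simps)
          show False
          proof (cases "k \<le> K")
            case True
            then show False using that x by (auto simp: pts_def)
          next
            case False
            then have "k = Suc K + (k - Suc K)" by simp
            then have "q ^ k = q ^ Suc K * q ^ (k - Suc K)" by (metis power_add)
            then have "q ^ Suc K * a3 * x * q ^ (k - Suc K) = 1" using k by (simp add: mult_ac del: power_Suc)
            then have "P (q ^ Suc K * a3 * x) = 0" unfolding P_eq_0_iff by blast
            then have "x \<in> zeros_out {q^n * a1, q ^ Suc K * a3}" by (simp add: zeros_out_def del: power_Suc)
            then show False using that unfolding S_def by blast
          qed
        qed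
        then show ?thesis unfolding f_def
          by (intro holomorphic_intros holomorphic_on_subset[OF \<psi>]) (auto simp: S_def zeros_in_def zeros_out_def)
      qed
      show "path_image \<gamma> \<subseteq> S - pts"
        using sep sub pts_zout unfolding separating_contour_def S_def by blast
      show "path_image (circlepath 0 R) \<subseteq> S - pts"
      proof
        fix x assume "x \<in> path_image (circlepath 0 R)"
        then have x: "norm x = R" using R0 by (simp add: path_image_circlepath)
        then have "x \<notin> pts" using pt_in by (auto simp: pts_def)
        then show "x \<in> S - pts" unfolding S_def using x R0 zin_R[of x] out[of x] by auto
      qed
      fix z assume "z \<notin> S"
      then consider "z = 0 \<or> z \<in> zeros_in {b1,b2,b3}" | "z \<in> zeros_out {q^n * a1, q ^ Suc K * a3}"
        by (auto simp: S_def)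
      then show "winding_number \<gamma> z = winding_number (circlepath 0 R) z"
      proof cases
        case 1
        then have "norm z < R" using zin_R R0 by auto
        then have "winding_number (circlepath 0 R) z = 1" by (intro winding_number_circlepath) simp
        then show ?thesis using 1 sep unfolding separating_contour_def by auto
      next
        case 2
        then have "winding_number (circlepath 0 R) z = 0"
          using out[OF 2] R0 by (intro winding_number_circlepath_outside) auto
        moreover have "winding_number \<gamma> z = 0"
          using 2 sub sep unfolding separating_contour_def by blast
        ultimately show ?thesis by simp
      qed
    qed (use sep in \<open>auto simp: separating_contour_def\<close>)
    also have "(\<Sum>p\<in>pts. (winding_number \<gamma> p - winding_number (circlepath 0 R) p) * residue (f n) p) =
        (\<Sum>p\<in>pts. - residue (f n) p)"
      by (intro sum.cong refl) (simp add: wpts)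
    also have "\<dots> = (\<Sum>k\<le>K. - residue (f n) (1 / (a3 * q^k)))"
      unfolding pts_def by (simp add: sum.reindex[OF inj])
    also have "\<dots> = (\<Sum>k\<le>K. u n (1 / (a3 * q^k)) * (1 / (a3 * q^k)) / (Pn (1 / q^k) k * P q))"
    proof (intro sum.cong refl)
      fix k assume k: "k \<in> {..K}"
      define p where "p = 1 / (a3 * q ^ k)"
      define T where "T = regular {b1,b2,b3} {q^n * a1}"
      have pp: "p \<in> pts" using k by (auto simp: pts_def p_def)
      have "p \<in> T"
      proof -
        have "norm p < R" using pt_in[of k] k by (simp add: p_def)
        then have "P (q^n * a1 * p) \<noteq> 0" using a1R[of p] by auto
        moreover have "p \<noteq> 0" "P (b1 / p) \<noteq> 0" "P (b2 / p) \<noteq> 0" "P (b3 / p) \<noteq> 0"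
          using zeros_disjoint[OF sep pts_zout[OF pp]] by simp_all
        ultimately show ?thesis by (simp add: T_def zeros_in_def zeros_out_def)
      qed
      moreover have "open T" unfolding T_def by (simp only: open_Compl closed_zeros finite.intros)
      moreover have "u n holomorphic_on T" unfolding u_def
        by (intro holomorphic_intros holomorphic_on_subset[OF \<psi>]) (auto simp: T_def zeros_in_def zeros_out_def)
      moreover have "a3 * p * q ^ k = 1" using nz q0 by (simp add: p_def)
      ultimately have "residue (f n) p = - (u n p * p) / (Pn (1 / q ^ k) k * P q)"
        unfolding fu by (intro residue_inverse_P)
      then show "- residue (f n) (1 / (a3 * q^k)) = u n (1 / (a3 * q^k)) * (1 / (a3 * q^k)) / (Pn (1 / q^k) k * P q)"
        by (simp add: p_def)
    qed
    finally show ?thesis by (simp add: algebra_simps)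
  qed
  \<comment> \<open>On the circle \<open>f n\<close> is O(R^(-n)), and R > 1/|a3| by the choice of
    \<open>B\<close>, so the quotient by a3^n decays geometrically.\<close>
  have circ_lim: "(\<lambda>n. contour_integral (circlepath 0 R) (f n) / a3^n) \<longlonglongrightarrow> 0"
  proof -
    define h where "h = (\<lambda>x. \<psi> x / (P (a3 * x) * Pd3 b1 b2 b3 x) / x)"
    have Pb: "P (b / x) \<noteq> 0" if "norm x = R" "b \<in> {b1,b2,b3}" for x b
      using zin_R[of x] that R0 unfolding zeros_in_def by auto
    have "h holomorphic_on sphere 0 R" unfolding h_def
      using R0 circ_a3 Pb by (intro holomorphic_intros holomorphic_on_subset[OF \<psi>]) auto
    then have "continuous_on (sphere 0 R) h" by (rule holomorphic_on_imp_continuous_on)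
    then have "compact (h ` sphere 0 R)" by (intro compact_continuous_image) auto
    then have "bounded (h ` sphere 0 R)" by (rule compact_imp_bounded)
    then obtain C where C': "\<forall>y\<in>h ` sphere 0 R. norm y \<le> C" unfolding bounded_iff by (elim exE)
    have C: "norm (h x) \<le> C" if "norm x = R" for x using C' that by simp
    have C0: "C \<ge> 0" using order_trans[OF norm_ge_zero C[of "of_real R"]] R0 by simp
    define D where "D = C * (2 * bnd (norm (q / a2) / R))"
    have bound: "norm (contour_integral (circlepath 0 R) (f n) / a3^n) \<le> D * (2 * pi * R) * (1 / (norm a3 * R)) ^ n"
      if n: "norm q ^ n * (norm a1 * R) < d" for n
    proof -
      have "norm (contour_integral (circlepath 0 R) (f n)) \<le> (D / R ^ n) * (2 * pi * R)"
      proof (rule has_contour_integral_bound_circlepath)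
        have P1: "P (q^n * a1 * x) \<noteq> 0" if "norm x = R" for x
          using Pa1[OF n, of x] that by auto
        have "f n holomorphic_on path_image (circlepath 0 R)" unfolding f_def
          using R0 circ_a3 Pb P1
          by (intro holomorphic_intros holomorphic_on_subset[OF \<psi>]) (auto simp: path_image_circlepath)
        then have "continuous_on (path_image (circlepath 0 R)) (f n)" by (rule holomorphic_on_imp_continuous_on)
        then have "f n contour_integrable_on circlepath 0 R"
          by (rule contour_integrable_continuous_circlepath)
        then show "(f n has_contour_integral contour_integral (circlepath 0 R) (f n)) (circlepath 0 R)"
          by (rule has_contour_integral_integral)
        show "0 \<le> D / R ^ n" using C0 R0 by (simp add: D_def)
        show "0 < R" by (rule R0)
        fix x :: complex assume "norm (x - 0) = R"
        then have x: "norm x = R" by simp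
        have "f n x = h x * (P (q * (q^n / a2) / x) * (1 / P (q^n * a1 * x))) / x ^ n"
          by (simp add: f_def h_def)
        then have "norm (f n x) = norm (h x) * (norm (P (q * (q^n / a2) / x)) * norm (1 / P (q^n * a1 * x))) / R ^ n"
          by (simp only: norm_mult norm_divide norm_power x)
        also have "\<dots> \<le> C * (bnd (norm (q / a2) / R) * 2) / R ^ n"
        proof (intro divide_right_mono mult_mono)
          show "norm (h x) \<le> C" by (rule C[OF x])
          have "norm (q * (q^n / a2) / x) \<le> norm (q / a2) / R"
            using q1 R0 by (simp add: norm_mult norm_divide norm_power x divide_right_mono mult_left_le power_le_one)
          then show "norm (P (q * (q^n / a2) / x)) \<le> bnd (norm (q / a2) / R)"
            using norm_P_le bnd_mono order_trans by blast
          have "norm (P (q^n * a1 * x)) \<ge> 1/2" using Pa1[OF n, of x] x by simp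
          then show "norm (1 / P (q^n * a1 * x)) \<le> 2"
            using P1[OF x] by (simp add: norm_divide field_simps)
        qed (use C0 R0 in auto)
        finally show "norm (f n x) \<le> D / R ^ n" by (simp add: D_def mult_ac)
      qed
      then show ?thesis using nz R0
        by (simp add: norm_divide norm_power power_divide power_mult_distrib field_simps)
    qed
    show ?thesis
    proof (rule Lim_null_comparison)
      show "\<forall>\<^sub>F n in sequentially. norm (contour_integral (circlepath 0 R) (f n) / a3^n) \<le>
          D * (2 * pi * R) * (1 / (norm a3 * R)) ^ n"
        using small by eventually_elim (rule bound)
      have "1 / norm a3 < R" using B(5) RB by linarith
      then have "1 / (norm a3 * R) < 1" using nz R0 by (simp add: field_simps)
      then have "(\<lambda>n. D * (2 * pi * R) * (1 / (norm a3 * R)) ^ n) \<longlonglongrightarrow> D * (2 * pi * R) * 0"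
        using R0 by (intro tendsto_intros LIMSEQ_power_zero) simp
      then show "(\<lambda>n. D * (2 * pi * R) * (1 / (norm a3 * R)) ^ n) \<longlonglongrightarrow> 0" by simp
    qed
  qed
  have qlim: "(\<lambda>n. q ^ n) \<longlonglongrightarrow> 0" using q1 by (intro LIMSEQ_power_zero) simp
  \<comment> \<open>The contribution of the pole 1/(a3 q^k) without its n-dependent factors. There
    x^(-n) equals (a3 q^k)^n, so after division by a3^n only k = 0 survives.\<close>
  define L where "L = (\<lambda>k. \<psi> (1 / (a3 * q^k)) / (P (b1 * (a3 * q^k)) * P (b2 * (a3 * q^k)) * P (b3 * (a3 * q^k))) / (Pn (1 / q^k) k * P q))"
  have res_lim: "(\<lambda>n. u n (1 / (a3 * q^k)) * (1 / (a3 * q^k)) / (Pn (1 / q^k) k * P q) / a3^n) \<longlonglongrightarrow>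
      (if k = 0 then L 0 else 0)" if "k \<le> K" for k
  proof -
    have "(\<lambda>n. (q^k)^n * (L k * P (q * (q^n / a2) * (a3 * q^k)) / P (q^n * a1 / (a3 * q^k)))) \<longlonglongrightarrow>
       (if k = 0 then 1 else 0) * (L k * P (q * (0 / a2) * (a3 * q^k)) / P (0 * a1 / (a3 * q^k)))"
    proof (intro tendsto_intros qlim)
      show "(\<lambda>n. (q^k)^n) \<longlonglongrightarrow> (if k = 0 then 1 else 0)"
        using q1 by (auto intro!: LIMSEQ_power_zero simp: norm_power power_less_one_iff)
    qed (use nz q0 q1 in auto)
    moreover have "u n (1 / (a3 * q^k)) * (1 / (a3 * q^k)) / (Pn (1 / q^k) k * P q) / a3^n =
       (q^k)^n * (L k * P (q * (q^n / a2) * (a3 * q^k)) / P (q^n * a1 / (a3 * q^k)))" for n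
      using nz q0 by (simp add: u_def L_def power_mult_distrib power_divide mult_ac)
    ultimately show ?thesis by auto
  qed
  have "(\<lambda>n. contour_integral (circlepath 0 R) (f n) / a3^n +
       2 * of_real pi * \<i> * (\<Sum>k\<le>K. u n (1 / (a3 * q^k)) * (1 / (a3 * q^k)) / (Pn (1 / q^k) k * P q) / a3^n))
     \<longlonglongrightarrow> 0 + 2 * of_real pi * \<i> * (\<Sum>k\<le>K. if k = 0 then L 0 else 0)"
    by (intro tendsto_intros circ_lim res_lim) auto
  moreover have "\<forall>\<^sub>F n in sequentially. contour_integral (circlepath 0 R) (f n) / a3^n +
       2 * of_real pi * \<i> * (\<Sum>k\<le>K. u n (1 / (a3 * q^k)) * (1 / (a3 * q^k)) / (Pn (1 / q^k) k * P q) / a3^n) =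
      J n / a3^n"
    using small
  proof eventually_elim
    case (elim n)
    have "J n = contour_integral \<gamma> (f n)" by (simp add: J_def f_def)
    then show ?case unfolding res[OF elim]
      by (simp add: add_divide_distrib sum_divide_distrib flip: times_divide_eq_right)
  qed
  ultimately have "(\<lambda>n. J n / a3^n) \<longlonglongrightarrow> 0 + 2 * of_real pi * \<i> * (\<Sum>k\<le>K. if k = 0 then L 0 else 0)"
    by (rule Lim_transform_eventually)
  then show ?thesis by (simp add: L_def mult_ac)
qed

text \<open>As n tends to infinity in the iterated recurrence, the finite products become infinite
  ones and the moment becomes the residue at 1/a3. The integral thus depends on \<psi> only through
  a point evaluation.\<close>

lemma saalschuetz_integral:
  assumes sep: "separates {b1,b2,b3} {a1,a3} \<gamma>"
    and \<psi>: "\<psi> holomorphic_on - {0}" and \<psi>q: "\<And>x. x \<noteq> 0 \<Longrightarrow> \<psi> (q * x) = a2 * \<psi> x / (s^3 * x^2)"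
    and a: "a1 * a2 * a3 = s" and b: "b1 * b2 * b3 = s"
  shows "contour_integral \<gamma> (\<lambda>x. \<psi> x * P (q / (a2 * x)) /
            (P (a1 * x) * P (a3 * x) * Pd3 b1 b2 b3 x) / x) *
      Pm3 b1 b2 b3 a1 * (P q * Pm3 b1 b2 b3 a3) =
    2 * of_real pi * \<i> * \<psi> (1 / a3) * Pq3 a2 b1 b2 b3"
proof -
  have nz: "a1 \<noteq> 0" "a2 \<noteq> 0" "a3 \<noteq> 0" using a s0 by auto
  have a3: "1 / a3 \<in> zeros_out {a1,a3}" using nz by (auto simp: zeros_out_def)
  have D: "P q * Pm3 b1 b2 b3 a3 \<noteq> 0"
    using zeros_disjoint(2)[OF sep a3] by simp
  define J where "J = (\<lambda>n. moment \<gamma> \<psi> a1 a2 a3 b1 b2 b3 n)"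
  have "(\<lambda>n. J n / a3^n * Pnq3 a2 b1 b2 b3 n) \<longlonglongrightarrow>
     2 * of_real pi * \<i> * \<psi> (1 / a3) / (P q * Pm3 b1 b2 b3 a3) *
     Pq3 a2 b1 b2 b3"
    unfolding J_def by (intro tendsto_mult saalschuetz_limit[OF sep \<psi> nz] Pn_tendsto)
  moreover have "(\<lambda>n. J 0 * Pnm3 b1 b2 b3 a1 n) \<longlonglongrightarrow>
      J 0 * Pm3 b1 b2 b3 a1"
    by (intro tendsto_mult tendsto_const Pn_tendsto)
  moreover have "J 0 * Pnm3 b1 b2 b3 a1 n =
    J n / a3^n * Pnq3 a2 b1 b2 b3 n" for n
    unfolding J_def by (rule saalschuetz_iterate[OF sep \<psi> \<psi>q a b])
  ultimately have "J 0 * Pm3 b1 b2 b3 a1 =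
     2 * of_real pi * \<i> * \<psi> (1 / a3) / (P q * Pm3 b1 b2 b3 a3) *
     Pq3 a2 b1 b2 b3"
    using LIMSEQ_unique by (metis (no_types, lifting) ext)
  then have "J 0 * Pm3 b1 b2 b3 a1 * (P q * Pm3 b1 b2 b3 a3) =
     2 * of_real pi * \<i> * \<psi> (1 / a3) / (P q * Pm3 b1 b2 b3 a3) *
     Pq3 a2 b1 b2 b3 * (P q * Pm3 b1 b2 b3 a3)"
    by (simp only:)
  also have "\<dots> = 2 * of_real pi * \<i> * \<psi> (1 / a3) * Pq3 a2 b1 b2 b3"
    using D by simp
  finally have "J 0 * Pm3 b1 b2 b3 a1 * (P q * Pm3 b1 b2 b3 a3) =
     2 * of_real pi * \<i> * \<psi> (1 / a3) * Pq3 a2 b1 b2 b3" .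
  then show ?thesis by (simp add: J_def)
qed

subsection \<open>Contiguous relation and limit for the half sums\<close>

text \<open>For m \<ge> 0 this is the m-th term of the bilateral sum
  (\<open>lat_term_nonneg\<close>), rewritten so that the Gaussian weight and the growing factors
  are absorbed into q^m and finite products; its decay is then visible.\<close>

definition half_term where
  "half_term a1 a2 a3 b1 b2 b3 x m = q ^ m *
     (P (q ^ Suc m / (a1 * x)) * P (q ^ Suc m / (a2 * x)) * P (q ^ Suc m / (a3 * x))) *
     (Pn (b1 / x) m * Pn (b2 / x) m * Pn (b3 / x) m) *
     (P (q * x / b1) * P (q * x / b2) * P (q * x / b3))"

definition theta_prod where
  "theta_prod b1 b2 b3 x = x * (theta (b1 / x) * theta (b2 / x) * theta (b3 / x))"

section \<open>Convergence of the half sums and their contiguous relation\<close>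

lemma norm_P_le': "norm c \<le> r \<Longrightarrow> norm (P c) \<le> bnd r"
  using norm_P_le bnd_mono order_trans by blast

lemma norm_Pn_le': "norm c \<le> r \<Longrightarrow> norm (Pn c n) \<le> bnd r"
  using norm_Pn_le bnd_mono order_trans by blast

lemma norm_q_pow_le: "norm c \<le> r \<Longrightarrow> norm (q ^ n * c) \<le> r"
proof -
  assume "norm c \<le> r"
  have "norm q ^ n * norm c \<le> 1 * norm c"
    using q1 by (intro mult_right_mono power_le_one) auto
  then show ?thesis using \<open>norm c \<le> r\<close> by (simp add: norm_mult norm_power)
qed

lemma norm_half_term_le:
  assumes "norm (1 / (a1 * x)) \<le> r" "norm (1 / (a2 * x)) \<le> r" "norm (1 / (a3 * x)) \<le> r"
    "norm (b1 / x) \<le> r" "norm (b2 / x) \<le> r" "norm (b3 / x) \<le> r"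
    "norm (x / b1) \<le> r" "norm (x / b2) \<le> r" "norm (x / b3) \<le> r"
  shows "norm (half_term a1 a2 a3 b1 b2 b3 x m) \<le> norm q ^ m * (bnd r * bnd r * bnd r) * (bnd r * bnd r * bnd r) * (bnd r * bnd r * bnd r)"
proof -
  have 1: "norm (P (q ^ Suc m / (a * x))) \<le> bnd r" if "norm (1 / (a * x)) \<le> r" for a
    using norm_P_le'[OF norm_q_pow_le[OF that, of "Suc m"]] by simp
  have 2: "norm (P (q * x / b)) \<le> bnd r" if "norm (x / b) \<le> r" for b
    using norm_P_le'[OF norm_q_pow_le[OF that, of 1]] by simp
  show ?thesis unfolding half_term_def norm_mult norm_power
    by (intro mult_mono order_refl 1 2 norm_Pn_le' assms mult_nonneg_nonneg norm_ge_zero zero_le_power bnd_ge0)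
qed

lemma summable_half_term: "summable (half_term a1 a2 a3 b1 b2 b3 x)"
proof -
  define r where "r = Max {norm (1 / (a1 * x)), norm (1 / (a2 * x)), norm (1 / (a3 * x)),
    norm (b1 / x), norm (b2 / x), norm (b3 / x), norm (x / b1), norm (x / b2), norm (x / b3)}"
  have 1: "norm (half_term a1 a2 a3 b1 b2 b3 x m) \<le> norm q ^ m * (bnd r * bnd r * bnd r) * (bnd r * bnd r * bnd r) * (bnd r * bnd r * bnd r)" for m
    by (rule norm_half_term_le) (unfold r_def, auto intro!: Max_ge simp del: Max_insert)
  have 2: "summable (\<lambda>m. norm q ^ m * (bnd r * bnd r * bnd r) * (bnd r * bnd r * bnd r) * (bnd r * bnd r * bnd r))"
    using q1 by (intro summable_mult2 summable_geometric) simp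
  show ?thesis by (rule summable_comparison_test'[OF 2 1])
qed

text \<open>A telescoping sum over \<open>m\<close>. The boundary term at infinity is \<open>theta_prod\<close>, the hypothesis \<open>z\<close>
  removes the one at \<open>m = 0\<close>.\<close>

lemma half_term_contiguous:
  fixes al1 al2 al3 b1 b2 b3 x :: complex
  assumes al: "al1 * al2 * al3 * s = 1" and b: "b1 * b2 * b3 = s" and x: "x \<noteq> 0" and b0: "b1 \<noteq> 0" "b2 \<noteq> 0" "b3 \<noteq> 0"
    and z: "P (1 / (al1 * x)) * P (1 / (al2 * x)) * P (1 / (al3 * x)) = 0"
  shows "al1^2 * lin3 b1 b2 b3 al2 * suminf (half_term (q*al1) al2 al3 b1 b2 b3 x) -
    al2^2 * lin3 b1 b2 b3 al1 * suminf (half_term al1 (q*al2) al3 b1 b2 b3 x) =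
    (al1 - al2) * al1 * al2 * theta_prod b1 b2 b3 x"
proof -
  have nz: "al1 \<noteq> 0" "al2 \<noteq> 0" "al3 \<noteq> 0" using al by auto
  define A where "A = (\<lambda>m. P (q ^ Suc m / (al1 * x)) * P (q ^ Suc m / (al2 * x)) * P (q ^ Suc m / (al3 * x)))"
  define B where "B = (\<lambda>m. Pn (b1 / x) m * Pn (b2 / x) m * Pn (b3 / x) m)"
  define C where "C = P (q * x / b1) * P (q * x / b2) * P (q * x / b3)"
  define g where "g = (\<lambda>m. q ^ m * A m * B m * C)"
  define v where "v = (\<lambda>m. q ^ m / x)"
  define fa where "fa = (\<lambda>v. (1 - v / al1) * (1 - v / al2) * (1 - v / al3))"
  define fb where "fb = (\<lambda>v. (1 - b1 * v) * (1 - b2 * v) * (1 - b3 * v))"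
  \<comment> \<open>The telescoping sequence: \<open>e (Suc m)\<close> differs from
    \<open>e m\<close> only in having \<open>fb (v m)\<close> in place of \<open>fa (v m)\<close>,
    with the same \<open>A m\<close> and \<open>B m\<close>.\<close>
  define e where "e = (\<lambda>m. - (A m * fa (v m) * B m * C) * x / s)"
  define X where "X = s * (al1*al2 + al1*al3 + al2*al3) - (b1 + b2 + b3)"
  define Y where "Y = (b1*b2 + b1*b3 + b2*b3) - s * (al1 + al2 + al3)"
  have Pr: "P (q ^ m / (a * x)) = (1 - v m / a) * P (q ^ Suc m / (a * x))" for a m
    using P_rec[of "q ^ m / (a * x)"] by (simp add: v_def mult_ac)
  have Asuc: "A (Suc m) * fa (v (Suc m)) = A m" for m
    by (simp add: A_def fa_def Pr[of "Suc m"] mult_ac del: power_Suc)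
  have Bsuc: "B (Suc m) = B m * fb (v m)" for m
    by (simp add: B_def fb_def v_def Pn_Suc mult_ac)
  have e0: "e 0 = 0"
  proof -
    have "A 0 * fa (v 0) = P (1 / (al1 * x)) * P (1 / (al2 * x)) * P (1 / (al3 * x))"
      using Pr[of 0 al1] Pr[of 0 al2] Pr[of 0 al3] by (simp add: A_def fa_def mult_ac)
    then show ?thesis using z by (simp add: e_def)
  qed
  have eS: "e (Suc m) = - (A m * fb (v m) * B m * C) * x / s" for m
  proof -
    have "e (Suc m) = - ((A (Suc m) * fa (v (Suc m))) * B (Suc m) * C) * x / s" by (simp add: e_def)
    then show ?thesis by (simp only: Asuc Bsuc mult_ac)
  qed
  \<comment> \<open>The constant coefficients are both 1 and the cubic ones agree by the two
    balancing conditions. What remains is w times a linear factor, and x v m = q^m then restores the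
    summand.\<close>
  have fafb: "fa w - fb w = - (w * (X + Y * w))" for w
  proof -
    have i: "1 / al1 = s * al2 * al3" "1 / al2 = s * al1 * al3" "1 / al3 = s * al1 * al2"
      using al nz by (simp_all add: field_simps)
    have "fa w = (1 - w * (1 / al1)) * (1 - w * (1 / al2)) * (1 - w * (1 / al3))" by (simp add: fa_def)
    also have "\<dots> = (1 - w * (s * al2 * al3)) * (1 - w * (s * al1 * al3)) * (1 - w * (s * al1 * al2))"
      unfolding i ..
    also have "\<dots> = 1 - w * (s * (al1*al2 + al1*al3 + al2*al3)) + w^2 * ((al1*al2*al3* s) * s * (al1 + al2 + al3)) - w^3 * (al1*al2*al3* s)^2 * s"
      by (simp add: algebra_simps power2_eq_square power3_eq_cube)
    finally have fa: "fa w = 1 - w * (s * (al1*al2 + al1*al3 + al2*al3)) + w^2 * (s * (al1 + al2 + al3)) - w^3 * s"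
      unfolding al by simp
    have "fb w = 1 - w * (b1 + b2 + b3) + w^2 * (b1*b2 + b1*b3 + b2*b3) - w^3 * (b1*b2*b3)"
      by (simp add: fb_def algebra_simps power2_eq_square power3_eq_cube)
    then show ?thesis unfolding fa X_def Y_def b by (simp add: algebra_simps power2_eq_square)
  qed
  have diff: "e (Suc m) - e m = - (1 / s) * (g m * (X + Y * v m))" for m
  proof -
    have "e (Suc m) - e m = A m * B m * C * x / s * (fa (v m) - fb (v m))"
      unfolding eS by (simp add: e_def algebra_simps diff_divide_distrib)
    also have "\<dots> = - (1 / s) * (A m * B m * C * (x * v m) * (X + Y * v m))"
      unfolding fafb by simp
    also have "x * v m = q ^ m" using x by (simp add: v_def)
    finally show ?thesis by (simp add: g_def mult_ac)
  qed
  have qlim: "(\<lambda>n. q ^ n) \<longlonglongrightarrow> 0" using q1 by (intro LIMSEQ_power_zero) simp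
  have vlim: "v \<longlonglongrightarrow> 0"
    unfolding v_def by (rule tendsto_eq_rhs[OF tendsto_divide[OF qlim tendsto_const]]) (use x in auto)
  have "(\<lambda>m. e (Suc m)) \<longlonglongrightarrow> - (1 * 1 * Pd3 b1 b2 b3 x * C) * x / s"
    unfolding eS
  proof (intro tendsto_intros s0)
    have "(\<lambda>m. q ^ Suc m / (a * x)) \<longlonglongrightarrow> 0" for a
      using tendsto_mult_right[OF LIMSEQ_Suc[OF qlim], of "1 / (a * x)"] by (simp add: mult_ac)
    then have "A \<longlonglongrightarrow> P 0 * P 0 * P 0" unfolding A_def by (intro tendsto_intros)
    then show "A \<longlonglongrightarrow> 1" by simp
    have "(\<lambda>m. fb (v m)) \<longlonglongrightarrow> (1 - b1 * 0) * (1 - b2 * 0) * (1 - b3 * 0)"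
      unfolding fb_def by (intro tendsto_intros vlim)
    then show "(\<lambda>m. fb (v m)) \<longlonglongrightarrow> 1" by simp
    show "B \<longlonglongrightarrow> P (b1 / x) * P (b2 / x) * P (b3 / x)"
      unfolding B_def by (intro tendsto_mult Pn_tendsto)
  qed
  moreover have "- (1 * 1 * Pd3 b1 b2 b3 x * C) * x / s = - (1/s) * theta_prod b1 b2 b3 x"
    by (simp add: theta_prod_def theta_def C_def mult_ac)
  ultimately have "e \<longlonglongrightarrow> - (1/s) * theta_prod b1 b2 b3 x" by (simp only: filterlim_sequentially_Suc)
  then have "(\<lambda>m. e (Suc m) - e m) sums (- (1/s) * theta_prod b1 b2 b3 x - e 0)" by (rule telescope_sums)
  then have "(\<lambda>m. - s * (e (Suc m) - e m)) sums (- s * (- (1/s) * theta_prod b1 b2 b3 x))"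
    unfolding e0 by (intro sums_mult) simp
  then have S: "(\<lambda>m. g m * (X + Y * v m)) sums theta_prod b1 b2 b3 x"
    unfolding diff using s0 by simp
  \<comment> \<open>Both are the relation between fa and fb at w = al1 and w = al2, where fa
    vanishes.\<close>
  have p1: "X + al1 * Y = lin3 b1 b2 b3 al1 / al1"
    and p2: "X + al2 * Y = lin3 b1 b2 b3 al2 / al2"
  proof -
    have "al1 * (X + al1 * Y) = al1*al2*al3* s - al1 * (b1+b2+b3) + al1^2 * (b1*b2 + b1*b3 + b2*b3) - s * al1^3"
      by (simp add: X_def Y_def algebra_simps power2_eq_square power3_eq_cube)
    also have "\<dots> = 1 - al1 * (b1+b2+b3) + al1^2 * (b1*b2 + b1*b3 + b2*b3) - (b1*b2*b3) * al1^3"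
      unfolding al b ..
    also have "\<dots> = lin3 b1 b2 b3 al1"
      by (simp add: algebra_simps power2_eq_square power3_eq_cube)
    finally show "X + al1 * Y = lin3 b1 b2 b3 al1 / al1"
      using nz by (metis nonzero_mult_div_cancel_left)
    have "al2 * (X + al2 * Y) = al1*al2*al3* s - al2 * (b1+b2+b3) + al2^2 * (b1*b2 + b1*b3 + b2*b3) - s * al2^3"
      by (simp add: X_def Y_def algebra_simps power2_eq_square power3_eq_cube)
    also have "\<dots> = 1 - al2 * (b1+b2+b3) + al2^2 * (b1*b2 + b1*b3 + b2*b3) - (b1*b2*b3) * al2^3"
      unfolding al b ..
    also have "\<dots> = lin3 b1 b2 b3 al2"
      by (simp add: algebra_simps power2_eq_square power3_eq_cube)
    finally show "X + al2 * Y = lin3 b1 b2 b3 al2 / al2"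
      using nz by (metis nonzero_mult_div_cancel_left)
  qed
  have Pq: "P (q ^ Suc m / (q * a * x)) = (1 - v m / a) * P (q ^ Suc m / (a * x))" for a m
    using Pr[of m a] q0 by simp
  have t1: "half_term (q*al1) al2 al3 b1 b2 b3 x m = (1 - v m / al1) * g m" for m
    unfolding half_term_def Pq by (simp add: g_def A_def B_def C_def mult_ac)
  have t2: "half_term al1 (q*al2) al3 b1 b2 b3 x m = (1 - v m / al2) * g m" for m
    unfolding half_term_def Pq by (simp add: g_def A_def B_def C_def mult_ac)
  \<comment> \<open>Lagrange interpolation of the linear factor X + Y v at al1 and al2. The basis
    polynomials are, up to constants, the factors 1 - v/al1 and 1 - v/al2 by which the two shifted
    half terms differ from \<open>g\<close>.\<close>
  have pt: "al1 * (X + al2 * Y) * half_term (q*al1) al2 al3 b1 b2 b3 x m -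
      al2 * (X + al1 * Y) * half_term al1 (q*al2) al3 b1 b2 b3 x m = (al1 - al2) * (g m * (X + Y * v m))" for m
  proof -
    have i: "al1 * (1 - v m / al1) = al1 - v m" "al2 * (1 - v m / al2) = al2 - v m"
      using nz by (simp_all add: field_simps)
    have "al1 * (X + al2 * Y) * half_term (q*al1) al2 al3 b1 b2 b3 x m - al2 * (X + al1 * Y) * half_term al1 (q*al2) al3 b1 b2 b3 x m
       = (X + al2 * Y) * (al1 * (1 - v m / al1)) * g m - (X + al1 * Y) * (al2 * (1 - v m / al2)) * g m"
      unfolding t1 t2 by (simp only: mult_ac)
    also have "\<dots> = (X + al2 * Y) * (al1 - v m) * g m - (X + al1 * Y) * (al2 - v m) * g m"
      unfolding i ..
    also have "\<dots> = (al1 - al2) * (g m * (X + Y * v m))" by (simp add: algebra_simps)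
    finally show ?thesis .
  qed
  have "(\<lambda>m. al1 * (X + al2 * Y) * half_term (q*al1) al2 al3 b1 b2 b3 x m - al2 * (X + al1 * Y) * half_term al1 (q*al2) al3 b1 b2 b3 x m)
     sums (al1 * (X + al2 * Y) * suminf (half_term (q*al1) al2 al3 b1 b2 b3 x) - al2 * (X + al1 * Y) * suminf (half_term al1 (q*al2) al3 b1 b2 b3 x))"
    by (intro sums_diff sums_mult summable_sums summable_half_term)
  moreover have "(\<lambda>m. (al1 - al2) * (g m * (X + Y * v m))) sums ((al1 - al2) * theta_prod b1 b2 b3 x)"
    by (intro sums_mult S)
  ultimately have "al1 * (X + al2 * Y) * suminf (half_term (q*al1) al2 al3 b1 b2 b3 x) -
      al2 * (X + al1 * Y) * suminf (half_term al1 (q*al2) al3 b1 b2 b3 x) = (al1 - al2) * theta_prod b1 b2 b3 x"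
    unfolding pt by (rule sums_unique2)
  then have E1: "al1 * al2 * (al1 * (X + al2 * Y) * suminf (half_term (q*al1) al2 al3 b1 b2 b3 x) -
      al2 * (X + al1 * Y) * suminf (half_term al1 (q*al2) al3 b1 b2 b3 x)) = al1 * al2 * ((al1 - al2) * theta_prod b1 b2 b3 x)"
    by simp
  have E2: "al1 * al2 * (al1 * (X + al2 * Y) * u - al2 * (X + al1 * Y) * w) =
     al1^2 * lin3 b1 b2 b3 al2 * u - al2^2 * lin3 b1 b2 b3 al1 * w" for u w
    unfolding p1 p2 using nz by (simp add: field_simps power2_eq_square)
  show ?thesis unfolding E2[symmetric] E1 by (simp only: mult_ac)
qed

text \<open>The alternant kills \<open>theta_prod\<close>, hence the inhomogeneous part of the contiguous relation.\<close>

definition alternant where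
  "alternant b1 b2 b3 x y (\<phi> :: complex \<Rightarrow> complex) = \<phi> x * theta_prod b1 b2 b3 y - \<phi> y * theta_prod b1 b2 b3 x"

definition half_sum where
  "half_sum a1 a2 a3 b1 b2 b3 n x = suminf (half_term (a1 / q^n) (q^n * a2) a3 b1 b2 b3 x)"

text \<open>Consecutive half sums arise from one base point by multiplying either al1 or al2 by q.
  The vanishing that the contiguous relation asks for holds at x = 1/a3, where the argument of a
  factor is 1, and at x = 1/a2, where it is q^(-n).\<close>

lemma alternant_iterate:
  assumes a: "a1 * a2 * a3 = s" and b: "b1 * b2 * b3 = s"
  defines "L \<equiv> \<lambda>n. alternant b1 b2 b3 (1/a3) (1/a2) (half_sum a1 a2 a3 b1 b2 b3 n)"
  shows "L 0 * Pnm3 b1 b2 b3 a2 n =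
    (\<Prod>i<n. - (a2 / a3) * q^i) * L n * Pnq3 a1 b1 b2 b3 n"
proof (induction n)
  case 0
  then show ?case by simp
next
  case (Suc n)
  have nz: "a1 \<noteq> 0" "a2 \<noteq> 0" "a3 \<noteq> 0" using a s0 by auto
  have b0: "b1 \<noteq> 0" "b2 \<noteq> 0" "b3 \<noteq> 0" using b s0 by auto
  define al1 where "al1 = a1 / q ^ Suc n"
  define al2 where "al2 = q ^ n * a2"
  have alnz: "al1 \<noteq> 0" "al2 \<noteq> 0" using nz q0 by (auto simp: al1_def al2_def)
  have prod: "al1 * al2 * a3 * s = 1"
  proof -
    have "al1 * al2 * a3 * s = (a1 * a2 * a3) * s / q" using q0 by (simp add: al1_def al2_def)
    then show ?thesis unfolding a s2[symmetric] using s0 by (simp add: power2_eq_square)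
  qed
  have shift: "q * al1 = a1 / q ^ n" "q * al2 = q ^ Suc n * a2"
    using q0 by (simp_all add: al1_def al2_def)
  define p1 where "p1 = al1^2 * lin3 b1 b2 b3 al2"
  define p2 where "p2 = al2^2 * lin3 b1 b2 b3 al1"
  define D where "D = (al1 - al2) * al1 * al2"
  have c: "p1 * half_sum a1 a2 a3 b1 b2 b3 n x - p2 * half_sum a1 a2 a3 b1 b2 b3 (Suc n) x = D * theta_prod b1 b2 b3 x"
    if "x \<noteq> 0" "P (1 / (al2 * x)) * P (1 / (a3 * x)) = 0" for x
    using half_term_contiguous[OF prod b \<open>x \<noteq> 0\<close> b0] that(2)
    unfolding half_sum_def p1_def p2_def D_def shift al1_def[symmetric] al2_def[symmetric] by (simp only: mult_eq_0_iff) blast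
  have "p1 * L n - p2 * L (Suc n) = 0"
  proof -
    have 3: "p1 * half_sum a1 a2 a3 b1 b2 b3 n (1/a3) - p2 * half_sum a1 a2 a3 b1 b2 b3 (Suc n) (1/a3) = D * theta_prod b1 b2 b3 (1/a3)"
      using nz by (intro c) auto
    have "P (1 / (al2 * (1/a2))) = 0" unfolding P_eq_0_iff using nz q0 by (auto simp: al2_def)
    then have 2: "p1 * half_sum a1 a2 a3 b1 b2 b3 n (1/a2) - p2 * half_sum a1 a2 a3 b1 b2 b3 (Suc n) (1/a2) = D * theta_prod b1 b2 b3 (1/a2)"
      using nz by (intro c) auto
    have "p1 * L n - p2 * L (Suc n) =
      (p1 * half_sum a1 a2 a3 b1 b2 b3 n (1/a3) - p2 * half_sum a1 a2 a3 b1 b2 b3 (Suc n) (1/a3)) * theta_prod b1 b2 b3 (1/a2) -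
      (p1 * half_sum a1 a2 a3 b1 b2 b3 n (1/a2) - p2 * half_sum a1 a2 a3 b1 b2 b3 (Suc n) (1/a2)) * theta_prod b1 b2 b3 (1/a3)"
      by (simp add: L_def alternant_def algebra_simps)
    then show ?thesis unfolding 2 3 by (simp add: mult_ac)
  qed
  \<comment> \<open>Taking - b al1 out of each 1 - b al1 produces the factors 1 - q^(n+1)/(a1 b) of
    the finite products; by both balancing conditions the leading terms collapse to al1^2 times the
    Gaussian factor.\<close>
  moreover have p2E: "p2 = al1^2 * (- (a2 / a3) * q^n * ((1 - q / (a1*b1) * q^n) * (1 - q / (a1*b2) * q^n) * (1 - q / (a1*b3) * q^n)))"
  proof -
    have f: "1 - b*al1 = - (b * al1) * (1 - q / (a1*b) * q^n)" if "b \<noteq> 0" for b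
      using that nz q0 by (simp add: al1_def field_simps)
    have "p2 = - (al1^2) * al2 * ((al1 * al2 * a3 * s) / a3) * (b1*b2*b3 / s) * ((1 - q / (a1*b1) * q^n) * (1 - q / (a1*b2) * q^n) * (1 - q / (a1*b3) * q^n))"
      unfolding p2_def f[OF b0(1)] f[OF b0(2)] f[OF b0(3)] using nz s0
      by (simp add: power2_eq_square mult_ac)
    then show ?thesis unfolding prod b using s0 by (simp add: al2_def mult_ac)
  qed
  ultimately have st: "(lin3 b1 b2 b3 al2) * L n =
     (- (a2 / a3) * q^n * ((1 - q / (a1*b1) * q^n) * (1 - q / (a1*b2) * q^n) * (1 - q / (a1*b3) * q^n))) * L (Suc n)"
    (is "?F * L n = ?E * L (Suc n)")
  proof -
    assume z: "p1 * L n - p2 * L (Suc n) = 0"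
    have "al1^2 * (?F * L n) = al1^2 * (?E * L (Suc n))"
      using z unfolding p2E p1_def by (simp only: right_minus_eq mult.assoc)
    then show ?thesis using alnz by (simp only: mult_left_cancel power_not_zero not_False_eq_True)
  qed
  have "L 0 * (Pn (b1 * a2) (Suc n) * Pn (b2 * a2) (Suc n) * Pn (b3 * a2) (Suc n)) =
      (L 0 * Pnm3 b1 b2 b3 a2 n) * lin3 b1 b2 b3 al2"
    by (simp add: Pn_Suc al2_def mult_ac)
  also have "\<dots> = (\<Prod>i<n. - (a2 / a3) * q^i) * Pnq3 a1 b1 b2 b3 n *
      ((lin3 b1 b2 b3 al2) * L n)"
    unfolding Suc.IH by (simp only: mult_ac)
  also have "\<dots> = (\<Prod>i<Suc n. - (a2 / a3) * q^i) * L (Suc n) *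
      (Pn (q / (a1 * b1)) (Suc n) * Pn (q / (a1 * b2)) (Suc n) * Pn (q / (a1 * b3)) (Suc n))"
    unfolding st by (simp add: Pn_Suc mult_ac)
  finally show ?case .
qed

section \<open>Gaussian products and the limit of the half sums\<close>

lemma norm_prod_le_bnd: "norm (\<Prod>i=k..<n. c * q^i) \<le> bnd (norm c)"
proof -
  have "norm (\<Prod>i=k..<n. c * q^i) \<le> (\<Prod>i=k..<n. exp (norm (c * q ^ i)))"
    unfolding prod_norm[symmetric]
    by (intro prod_mono) (use exp_ge_add_one_self in \<open>auto intro: order_trans[OF _ exp_ge_add_one_self]\<close>)
  also have "\<dots> = exp (\<Sum>i=k..<n. norm (c * q ^ i))" by (simp add: exp_sum)
  also have "(\<Sum>i=k..<n. norm (c * q ^ i)) \<le> norm c / (1 - norm q)"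
    by (rule sum_geo_le) simp
  finally show ?thesis by (simp add: bnd_def)
qed

lemma gauss_prod_tendsto_0: "(\<lambda>n. \<Prod>i<n. c * q^i) \<longlonglongrightarrow> 0"
proof -
  have "(\<lambda>n. norm (c * q^n)) \<longlonglongrightarrow> 0" by (rule summable_LIMSEQ_zero[OF summable_geo])
  then have "\<forall>\<^sub>F n in sequentially. norm (c * q^n) < 1/2" by (rule order_tendstoD) simp
  then obtain N where N: "\<And>n. n \<ge> N \<Longrightarrow> norm (c * q^n) < 1/2" by (auto simp: eventually_sequentially)
  have "summable (\<lambda>n. \<Prod>i<n. c * q^i)"
  proof (rule summable_ratio_test)
    fix n assume "n \<ge> N"
    have "norm (\<Prod>i<Suc n. c * q^i) = norm (c * q^n) * norm (\<Prod>i<n. c * q^i)" by (simp add: norm_mult mult_ac)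
    also have "\<dots> \<le> 1/2 * norm (\<Prod>i<n. c * q^i)"
      using N[OF \<open>n \<ge> N\<close>] by (intro mult_right_mono) auto
    finally show "norm (\<Prod>i<Suc n. c * q^i) \<le> 1/2 * norm (\<Prod>i<n. c * q^i)" .
  qed simp
  then show ?thesis by (rule summable_LIMSEQ_zero)
qed

text \<open>Each of the n extra factors 1 - c/q^i equals -c/q^i times 1 - q^i/c, so the Gaussian
  product exactly compensates the growth of P(q c/q^n).\<close>

lemma scaled_P_0: "(\<Prod>i<n. - (1 / c) * q^i) * P (q * (c / q^n)) = Pn (1 / c) n * P (q * c)" if "c \<noteq> 0"
proof (induction n)
  case (Suc n)
  have "P (q * (c / q ^ Suc n)) = (1 - c / q^n) * P (q * (c / q^n))"
    using P_rec[of "c / q^n"] q0 by simp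
  then have "(\<Prod>i<Suc n. - (1 / c) * q^i) * P (q * (c / q ^ Suc n)) =
     ((\<Prod>i<n. - (1 / c) * q^i) * P (q * (c / q^n))) * (- (1 / c) * q^n * (1 - c / q^n))"
    by (simp add: mult_ac)
  also have "- (1 / c) * q^n * (1 - c / q^n) = 1 - 1 / c * q^n"
    using that q0 by (simp add: field_simps)
  finally show ?case unfolding Suc.IH by (simp add: Pn_Suc mult_ac)
qed simp

lemma scaled_P: "m \<le> n \<Longrightarrow> c \<noteq> 0 \<Longrightarrow> (\<Prod>i<n. - (1 / c) * q^i) * P (q ^ Suc m * c / q^n) =
   (\<Prod>i=n-m..<n. - (1 / c) * q^i) * (Pn (1 / c) (n - m) * P (q * c))"
proof -
  assume m: "m \<le> n" and c: "c \<noteq> 0"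
  have "q ^ n = q ^ m * q ^ (n - m)" using m by (simp flip: power_add)
  then have e: "q ^ Suc m * c / q^n = q * (c / q ^ (n - m))" using q0 by simp
  have "(\<Prod>i<n. - (1 / c) * q^i) = (\<Prod>i<n-m. - (1 / c) * q^i) * (\<Prod>i=n-m..<n. - (1 / c) * q^i)"
    using prod.atLeastLessThan_concat[of 0 "n - m" n "\<lambda>i. - (1 / c) * q^i"] m by (simp add: atLeast0LessThan)
  then show ?thesis unfolding e scaled_P_0[OF c, symmetric] by (simp only: mult_ac)
qed

text \<open>To dominate a series in m the bound must be uniform in both m and n. For m > n the
  argument carries no negative power of q, and the Gaussian product and the factorial are bounded
  separately.\<close>

lemma norm_scaled_P_le:
  assumes c: "c \<noteq> 0"
  shows "norm ((\<Prod>i<n. - (1 / c) * q^i) * P (q ^ Suc m * c / q^n)) \<le> bnd (norm (1/c)) * (bnd (norm (1/c)) * bnd (norm c))"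
proof (cases "m \<le> n")
  case True
  have "norm (\<Prod>i=n-m..<n. - (1 / c) * q^i) \<le> bnd (norm (1/c))"
    using norm_prod_le_bnd[of "- (1/c)" "n-m" n] by simp
  moreover have "norm (P (q * c)) \<le> bnd (norm c)"
    using norm_P_le'[OF norm_q_pow_le[of c "norm c" 1]] by simp
  ultimately show ?thesis unfolding scaled_P[OF True c] norm_mult
    by (intro mult_mono norm_Pn_le mult_nonneg_nonneg) auto
next
  case False
  then have "Suc m = Suc (m - n) + n" by simp
  then have "q ^ Suc m = q ^ Suc (m - n) * q ^ n" by (metis power_add)
  then have e: "q ^ Suc m * c / q^n = q ^ Suc (m - n) * c" using q0 by simp
  have 1: "1 \<le> bnd (norm (1/c))" using q1 by (simp add: bnd_def)
  have 2: "norm (\<Prod>i<n. - (1 / c) * q^i) \<le> bnd (norm (1/c))"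
    using norm_prod_le_bnd[of "- (1/c)" 0 n] by (simp add: atLeast0LessThan)
  have 3: "norm (P (q ^ Suc (m - n) * c)) \<le> bnd (norm c)"
    by (rule norm_P_le'[OF norm_q_pow_le]) simp
  have "norm ((\<Prod>i<n. - (1 / c) * q^i) * P (q ^ Suc m * c / q^n)) \<le> bnd (norm (1/c)) * bnd (norm c)"
    unfolding e norm_mult by (intro mult_mono 2 3) auto
  also have "\<dots> \<le> bnd (norm (1/c)) * (bnd (norm (1/c)) * bnd (norm c))"
    using mult_right_mono[OF 1, of "bnd (norm c)"] by (intro mult_left_mono) auto
  finally show ?thesis .
qed

text \<open>For m > 0 the Gaussian product has m factors more than are needed to compensate P; the
  first of them, of size |q^(n-m)/c|, tends to 0, and the rest stays bounded.\<close>

lemma scaled_P_tendsto_0: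
  assumes c: "c \<noteq> 0" and m: "m > 0"
  shows "(\<lambda>n. (\<Prod>i<n. - (1 / c) * q^i) * P (q ^ Suc m * c / q^n)) \<longlonglongrightarrow> 0"
proof (rule Lim_null_comparison)
  define K where "K = bnd (norm (1/c)) * bnd (norm (1/c)) * bnd (norm c)"
  show "\<forall>\<^sub>F n in sequentially. norm ((\<Prod>i<n. - (1 / c) * q^i) * P (q ^ Suc m * c / q^n)) \<le> norm (1 / c * q ^ (n - m)) * K"
    using eventually_ge_at_top[of m]
  proof eventually_elim
    case (elim n)
    have e: "(\<Prod>i=n-m..<n. - (1 / c) * q^i) = - (1 / c) * q^(n-m) * (\<Prod>i=Suc (n-m)..<n. - (1 / c) * q^i)"
      using elim m by (subst prod.atLeast_Suc_lessThan) auto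
    have "norm (- (1 / c) * q^(n-m)) = norm (1 / c * q^(n-m))" by (simp add: norm_mult)
    then have "norm (\<Prod>i=n-m..<n. - (1 / c) * q^i) \<le> norm (1 / c * q^(n-m)) * bnd (norm (1/c))"
      unfolding e norm_mult[of "- (1 / c) * q^(n-m)"]
      using mult_left_mono[OF norm_prod_le_bnd[of "- (1/c)" "Suc (n-m)" n], of "norm (1 / c * q^(n-m))"] by simp
    moreover have "norm (P (q * c)) \<le> bnd (norm c)"
      using norm_P_le'[OF norm_q_pow_le[of c "norm c" 1]] by simp
    ultimately have "norm ((\<Prod>i<n. - (1 / c) * q^i) * P (q ^ Suc m * c / q^n)) \<le>
        (norm (1 / c * q^(n-m)) * bnd (norm (1/c))) * (bnd (norm (1/c)) * bnd (norm c))"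
      unfolding scaled_P[OF elim c] norm_mult by (intro mult_mono norm_Pn_le mult_nonneg_nonneg) auto
    then show ?case by (simp only: K_def mult_ac)
  qed
  have "(\<lambda>n. norm (1 / c * q ^ n)) \<longlonglongrightarrow> 0" by (rule summable_LIMSEQ_zero[OF summable_geo])
  then have "(\<lambda>n. norm (1 / c * q ^ (n - m))) \<longlonglongrightarrow> 0"
    by (rule filterlim_compose) (simp add: filterlim_minus_const_nat_at_top)
  then show "(\<lambda>n. norm (1 / c * q ^ (n - m)) * K) \<longlonglongrightarrow> 0"
    by (rule tendsto_mult_left_zero)
qed

text \<open>At x = 1/a3 the factor containing q^n a2 grows like the inverse of the Gaussian product.
  After normalisation the terms with m > 0 tend to 0 and the term m = 0 produces theta(a2/a3); the
  uniform bound allows the limit to be taken termwise (Tannery).\<close>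

lemma half_sum_limit_main:
  assumes nz: "a1 \<noteq> 0" "a2 \<noteq> 0" "a3 \<noteq> 0"
  shows "(\<lambda>n. (\<Prod>i<n. - (a2 / a3) * q^i) * half_sum a1 a2 a3 b1 b2 b3 n (1/a3)) \<longlonglongrightarrow>
    theta (a2 / a3) * P q * Pq3 a3 b1 b2 b3"
proof -
  define C where "C = a3 / a2"
  have C0: "C \<noteq> 0" using nz by (simp add: C_def)
  define c where "c = (\<lambda>n. \<Prod>i<n. - (1 / C) * q^i)"
  define G where "G = (\<lambda>m. Pnm3 b1 b2 b3 a3 m * Pq3 a3 b1 b2 b3)"
  define t where "t = (\<lambda>m n. q ^ m * (P (q ^ n * (q ^ Suc m * (a3 / a1))) * (c n * P (q ^ Suc m * C / q^n)) * P (q ^ Suc m)) * G m)"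
  have half_term: "c n * half_term (a1 / q^n) (q^n * a2) a3 b1 b2 b3 (1/a3) m = t m n" for m n
    using nz q0 by (simp add: t_def half_term_def G_def C_def mult_ac)
  have half_sum: "c n * half_sum a1 a2 a3 b1 b2 b3 n (1/a3) = (\<Sum>m. t m n)" for n
    unfolding half_sum_def half_term[symmetric] by (rule suminf_mult[symmetric, OF summable_half_term])
  define l where "l = (\<lambda>m::nat. if m = 0 then theta (a2 / a3) * P q * Pq3 a3 b1 b2 b3 else 0)"
  have qlim: "(\<lambda>n. q ^ n) \<longlonglongrightarrow> 0" using q1 by (intro LIMSEQ_power_zero) simp
  have lim: "(\<lambda>n. t m n) \<longlonglongrightarrow> l m" for m
  proof -
    have "(\<lambda>n. c n * P (q ^ Suc m * C / q^n)) \<longlonglongrightarrow> (if m = 0 then theta (a2 / a3) else 0)"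
    proof (cases "m = 0")
      case True
      have "(\<lambda>n. c n * P (q * (C / q^n))) \<longlonglongrightarrow> P (1 / C) * P (q * C)"
        unfolding c_def scaled_P_0[OF C0] by (intro tendsto_intros Pn_tendsto)
      moreover have "P (1 / C) * P (q * C) = theta (a2 / a3)" by (simp add: theta_def C_def)
      ultimately show ?thesis using True by simp
    next
      case False
      then show ?thesis using scaled_P_tendsto_0[OF C0, of m] by (simp add: c_def)
    qed
    then have "(\<lambda>n. t m n) \<longlonglongrightarrow> q ^ m * (P (0 * (q ^ Suc m * (a3 / a1))) * (if m = 0 then theta (a2 / a3) else 0) * P (q ^ Suc m)) * G m"
      unfolding t_def by (intro tendsto_mult tendsto_const P_tendsto qlim)
    then show ?thesis by (auto simp: l_def G_def)
  qed
  define K where "K = (bnd (norm (a3 / a1)) * (bnd (norm (1/C)) * (bnd (norm (1/C)) * bnd (norm C))) * bnd 1) *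
     ((bnd (norm (b1 * a3)) * bnd (norm (b2 * a3)) * bnd (norm (b3 * a3))) * norm (Pq3 a3 b1 b2 b3))"
  have bound: "norm (t m n) \<le> norm q ^ m * K" for m n
  proof -
    have 1: "norm (P (q ^ n * (q ^ Suc m * (a3 / a1)))) \<le> bnd (norm (a3 / a1))"
      by (intro norm_P_le' norm_q_pow_le) simp
    have 2: "norm (c n * P (q ^ Suc m * C / q^n)) \<le> bnd (norm (1/C)) * (bnd (norm (1/C)) * bnd (norm C))"
      unfolding c_def by (rule norm_scaled_P_le[OF C0])
    have 3: "norm (P (q ^ Suc m)) \<le> bnd 1"
      using norm_P_le'[OF norm_q_pow_le[of 1 1 "Suc m"]] by simp
    show ?thesis unfolding t_def K_def G_def norm_mult[of "q^m * _"] norm_mult[of "q^m"] norm_power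
      mult.assoc[of "norm q ^ m"]
      unfolding norm_mult[of "_ * _ * _" "_ * _ * _"] norm_mult[of "_ * _" "P (q ^ Suc m)"] norm_mult[of "P (q ^ n * _)"]
        norm_mult[of "_ * _" "Pn _ _"] norm_mult[of "Pn _ _" "Pn _ _"]
      by (intro mult_mono order_refl 1 2 3 norm_Pn_le mult_nonneg_nonneg norm_ge_zero zero_le_power bnd_ge0)
  qed
  have "(\<lambda>n. \<Sum>m. t m n) \<longlonglongrightarrow> suminf l"
  proof -
    have "summable (\<lambda>m. norm q ^ m * K)" using q1 by (intro summable_mult2 summable_geometric) simp
    moreover have "eventually (\<lambda>(m,n). norm (t m n) \<le> norm q ^ m * K) (at_top \<times>\<^sub>F sequentially)"
      by (intro always_eventually) (auto simp: bound)
    ultimately show ?thesis using tannerys_theorem[OF lim] by simp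
  qed
  moreover have "suminf l = l 0" by (subst suminf_finite[of "{0}"]) (auto simp: l_def)
  moreover have "(\<Prod>i<n. - (a2 / a3) * q^i) = c n" for n by (simp add: c_def C_def)
  ultimately show ?thesis by (simp add: half_sum l_def)
qed

text \<open>At x = 1/a2 the critical factor is P(q^(m+1)/q^n), which is 0 for m < n and bounded
  otherwise. The half sum stays bounded while the Gaussian product tends to 0.\<close>

lemma half_sum_limit_other:
  assumes nz: "a1 \<noteq> 0" "a2 \<noteq> 0" "a3 \<noteq> 0"
  shows "(\<lambda>n. (\<Prod>i<n. - (a2 / a3) * q^i) * half_sum a1 a2 a3 b1 b2 b3 n (1/a2)) \<longlonglongrightarrow> 0"
proof -
  define K where "K = (bnd (norm (a2 / a1)) * bnd 1 * bnd (norm (a2 / a3))) *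
     ((bnd (norm (b1 * a2)) * bnd (norm (b2 * a2)) * bnd (norm (b3 * a2))) * norm (Pq3 a2 b1 b2 b3))"
  have bound: "norm (half_term (a1 / q^n) (q^n * a2) a3 b1 b2 b3 (1/a2) m) \<le> norm q ^ m * K" for m n
  proof -
    have 1: "norm (P (q ^ n * (q ^ Suc m * (a2 / a1)))) \<le> bnd (norm (a2 / a1))"
      by (intro norm_P_le' norm_q_pow_le) simp
    have 2: "norm (P (q ^ Suc m / q ^ n)) \<le> bnd 1"
    proof (cases "m < n")
      case True
      then have "q ^ n = q ^ Suc m * q ^ (n - Suc m)" by (simp flip: power_add del: power_Suc)
      then have "P (q ^ Suc m / q ^ n) = 0" unfolding P_eq_0_iff using q0 by (intro exI[of _ "n - Suc m"]) simp
      then show ?thesis by simp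
    next
      case False
      then have "q ^ Suc m = q ^ (Suc m - n) * q ^ n" by (simp flip: power_add del: power_Suc)
      then have "q ^ Suc m / q ^ n = q ^ (Suc m - n) * 1" using q0 by simp
      then show ?thesis using norm_P_le'[OF norm_q_pow_le[of 1 1 "Suc m - n"]] by simp
    qed
    have 3: "norm (P (q ^ Suc m * (a2 / a3))) \<le> bnd (norm (a2 / a3))"
      by (intro norm_P_le' norm_q_pow_le) simp
    have "half_term (a1 / q^n) (q^n * a2) a3 b1 b2 b3 (1/a2) m = q ^ m * (P (q ^ n * (q ^ Suc m * (a2 / a1))) * P (q ^ Suc m / q ^ n) * P (q ^ Suc m * (a2 / a3))) *
       (Pnm3 b1 b2 b3 a2 m * Pq3 a2 b1 b2 b3)"
      using nz q0 by (simp add: half_term_def mult_ac)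
    then show ?thesis unfolding K_def
      apply (simp only: norm_mult[of "q^m * _"] norm_mult[of "q^m"] norm_power mult.assoc[of "norm q ^ m"])
      unfolding norm_mult[of "_ * _ * _" "_ * _ * _"] norm_mult[of "_ * _" "P (q ^ Suc m * _)"] norm_mult[of "P (q ^ n * _)"]
        norm_mult[of "_ * _" "Pn _ _"] norm_mult[of "Pn _ _" "Pn _ _"]
      by (intro mult_mono order_refl 1 2 3 norm_Pn_le mult_nonneg_nonneg norm_ge_zero zero_le_power bnd_ge0)
  qed
  have hb: "norm (half_sum a1 a2 a3 b1 b2 b3 n (1/a2)) \<le> K / (1 - norm q)" for n
  proof -
    have sm: "summable (\<lambda>m. norm q ^ m * K)" using q1 by (intro summable_mult2 summable_geometric) simp
    have "norm (half_sum a1 a2 a3 b1 b2 b3 n (1/a2)) \<le> (\<Sum>m. norm q ^ m * K)"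
      unfolding half_sum_def by (rule norm_suminf_le[OF bound sm])
    also have "\<dots> = K / (1 - norm q)"
      using q1 by (simp add: suminf_mult2[symmetric] suminf_geometric summable_geometric)
    finally show ?thesis .
  qed
  show ?thesis
  proof (rule Lim_null_comparison)
    show "\<forall>\<^sub>F n in sequentially. norm ((\<Prod>i<n. - (a2 / a3) * q^i) * half_sum a1 a2 a3 b1 b2 b3 n (1/a2)) \<le>
        norm (\<Prod>i<n. - (a2 / a3) * q^i) * (K / (1 - norm q))"
      unfolding norm_mult by (intro always_eventually allI mult_left_mono hb) auto
    show "(\<lambda>n. norm (\<Prod>i<n. - (a2 / a3) * q^i) * (K / (1 - norm q))) \<longlonglongrightarrow> 0"
      by (intro tendsto_mult_left_zero tendsto_norm_zero gauss_prod_tendsto_0)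
  qed
qed

text \<open>The Gaussian product in \<open>alternant_iterate\<close> is the normalisation used in
  the two limits. In the limit the value at 1/a2 drops out, and only the term m = 0 at 1/a3 is
  left.\<close>

lemma alternant_value:
  assumes a: "a1 * a2 * a3 = s" and b: "b1 * b2 * b3 = s"
  shows "alternant b1 b2 b3 (1/a3) (1/a2) (\<lambda>x. suminf (half_term a1 a2 a3 b1 b2 b3 x)) * Pm3 b1 b2 b3 a2 =
    theta (a2 / a3) * P q * Pq3 a3 b1 b2 b3 *
    Pq3 a1 b1 b2 b3 * theta_prod b1 b2 b3 (1/a2)"
proof -
  have nz: "a1 \<noteq> 0" "a2 \<noteq> 0" "a3 \<noteq> 0" using a s0 by auto
  define L where "L = (\<lambda>n. alternant b1 b2 b3 (1/a3) (1/a2) (half_sum a1 a2 a3 b1 b2 b3 n))"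
  define c where "c = (\<lambda>n. \<Prod>i<n. - (a2 / a3) * q^i)"
  have "(\<lambda>n. c n * half_sum a1 a2 a3 b1 b2 b3 n (1/a3) * theta_prod b1 b2 b3 (1/a2) - c n * half_sum a1 a2 a3 b1 b2 b3 n (1/a2) * theta_prod b1 b2 b3 (1/a3)) \<longlonglongrightarrow>
    theta (a2 / a3) * P q * Pq3 a3 b1 b2 b3 * theta_prod b1 b2 b3 (1/a2) - 0 * theta_prod b1 b2 b3 (1/a3)"
    unfolding c_def by (intro tendsto_diff tendsto_mult tendsto_const half_sum_limit_main[OF nz] half_sum_limit_other[OF nz])
  moreover have "c n * half_sum a1 a2 a3 b1 b2 b3 n (1/a3) * theta_prod b1 b2 b3 (1/a2) - c n * half_sum a1 a2 a3 b1 b2 b3 n (1/a2) * theta_prod b1 b2 b3 (1/a3) = c n * L n" for n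
    by (simp add: L_def alternant_def algebra_simps)
  ultimately have cL: "(\<lambda>n. c n * L n) \<longlonglongrightarrow> theta (a2 / a3) * P q * Pq3 a3 b1 b2 b3 * theta_prod b1 b2 b3 (1/a2)"
    by simp
  have "(\<lambda>n. c n * L n * Pnq3 a1 b1 b2 b3 n) \<longlonglongrightarrow>
     theta (a2 / a3) * P q * Pq3 a3 b1 b2 b3 * theta_prod b1 b2 b3 (1/a2) *
     Pq3 a1 b1 b2 b3"
    by (intro tendsto_mult cL Pn_tendsto)
  moreover have "c n * L n * Pnq3 a1 b1 b2 b3 n =
    L 0 * Pnm3 b1 b2 b3 a2 n" for n
    unfolding c_def L_def by (rule alternant_iterate[OF a b, symmetric])
  moreover have "(\<lambda>n. L 0 * Pnm3 b1 b2 b3 a2 n) \<longlonglongrightarrow> L 0 * Pm3 b1 b2 b3 a2"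
    by (intro tendsto_mult tendsto_const Pn_tendsto)
  ultimately have "L 0 * Pm3 b1 b2 b3 a2 = theta (a2 / a3) * P q * Pq3 a3 b1 b2 b3 * theta_prod b1 b2 b3 (1/a2) *
     Pq3 a1 b1 b2 b3"
    using LIMSEQ_unique by simp
  moreover have "half_sum a1 a2 a3 b1 b2 b3 0 = (\<lambda>x. suminf (half_term a1 a2 a3 b1 b2 b3 x))" by (simp add: half_sum_def fun_eq_iff)
  ultimately show ?thesis by (simp add: L_def mult_ac)
qed

subsection \<open>The sum over the lattice as a theta function of degree three\<close>

text \<open>The m-th integrand without its denominators, in the variable x = s^m z; the quotient
  s^(3 m^2) / x^(3 m) is 1/z^(3 m).\<close>

definition lat_term where
  "lat_term a1 a2 a3 b1 b2 b3 x m =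
     (P (q powi (1 + m) / (a1 * x)) * P (q powi (1 + m) / (a2 * x)) * P (q powi (1 + m) / (a3 * x))) *
     (P (q powi (1 - m) * x / b1) * P (q powi (1 - m) * x / b2) * P (q powi (1 - m) * x / b3)) *
     ((-1) powi m * s powi (3 * m^2) / x powi (3 * m))"

definition lat_sum where
  "lat_sum a1 a2 a3 b1 b2 b3 x = (\<Sum>\<^sub>\<infinity>m. lat_term a1 a2 a3 b1 b2 b3 x m)"

lemma q_powi: "q powi m = s powi (2 * m)"
  unfolding s2[symmetric] by (simp add: power_int_mult)

text \<open>Exchanging the a_j with the b_j and inverting x reverses m, so estimates for m \<ge> 0
  also cover m < 0.\<close>

lemma lat_term_neg:
  assumes "x \<noteq> 0" "a1 \<noteq> 0" "a2 \<noteq> 0" "a3 \<noteq> 0" "b1 \<noteq> 0" "b2 \<noteq> 0" "b3 \<noteq> 0"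
  shows "lat_term a1 a2 a3 b1 b2 b3 x (- m) = lat_term b1 b2 b3 a1 a2 a3 (1 / x) m"
proof -
  have "(-1 :: complex) powi (- m) = (-1) powi m"
    by (simp add: power_int_minus flip: power_int_inverse)
  moreover have "x powi (3 * - m) = (1 / x) powi (3 * m)"
    by (simp add: power_int_minus power_int_inverse divide_inverse)
  ultimately show ?thesis
    using assms by (simp add: lat_term_def mult_ac)
qed

text \<open>By b1 b2 b3 = s the step from m to m + 1 leaves exactly a factor q: the three factors
  -x/(q^m b_j) are matched by the quotient -s^(6m+3)/x^3 of the weights. This is the source of
  convergence for m \<ge> 0.\<close>

lemma lat_term_weight:
  assumes b: "b1 * b2 * b3 = s" and x: "x \<noteq> 0"
  shows "(P (q powi (1 - int m) * x / b1) * P (q powi (1 - int m) * x / b2) * P (q powi (1 - int m) * x / b3)) *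
     ((-1) powi int m * s powi (3 * (int m)^2) / x powi (3 * int m)) =
     q ^ m * (Pn (b1 / x) m * Pn (b2 / x) m * Pn (b3 / x) m) * (P (q * x / b1) * P (q * x / b2) * P (q * x / b3))"
proof (induction m)
  case 0
  show ?case by simp
next
  case (Suc m)
  have b0: "b1 \<noteq> 0" "b2 \<noteq> 0" "b3 \<noteq> 0" using b s0 by auto
  have qm: "q powi (- int m) = 1 / q ^ m" by (simp add: power_int_minus divide_inverse)
  have Pb: "P (q powi (1 - int (Suc m)) * x / b) = (- x / (q ^ m * b)) * (1 - b / x * q ^ m) * P (q powi (1 - int m) * x / b)" if "b \<noteq> 0" for b
  proof -
    have "q * (q powi (- int m) * x / b) = q powi (1 - int m) * x / b"
      using q0 by (simp add: power_int_diff power_int_minus divide_inverse)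
    then have "P (q powi (- int m) * x / b) = (1 - q powi (- int m) * x / b) * P (q powi (1 - int m) * x / b)"
      using P_rec[of "q powi (- int m) * x / b"] by (simp only:)
    moreover have "1 - q powi (- int m) * x / b = (- x / (q ^ m * b)) * (1 - b / x * q ^ m)"
      unfolding qm using that x q0 by (simp add: field_simps)
    ultimately show ?thesis by simp
  qed
  have w: "(-1) powi int (Suc m) * s powi (3 * (int (Suc m))^2) / x powi (3 * int (Suc m)) =
     (- (s ^ (6 * m + 3)) / x^3) * ((-1) powi int m * s powi (3 * (int m)^2) / x powi (3 * int m))"
  proof -
    have "3 * (int (Suc m))^2 = 3 * (int m)^2 + int (6 * m + 3)" by (simp add: power2_eq_square algebra_simps)
    moreover have "3 * int (Suc m) = 3 * int m + 3" by simp
    ultimately show ?thesis using s0 x by (simp add: power_int_add power_int_of_nat mult.commute mult.left_commute del: of_nat_Suc of_nat_add of_nat_mult)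
  qed
  have c: "(- x / (q ^ m * b1)) * (- x / (q ^ m * b2)) * (- x / (q ^ m * b3)) * (- (s ^ (6 * m + 3)) / x^3) = q"
  proof -
    have "(- x / (q ^ m * b1)) * (- x / (q ^ m * b2)) * (- x / (q ^ m * b3)) * (- (s ^ (6 * m + 3)) / x^3) =
       s ^ (6 * m + 3) / (q ^ (3 * m) * (b1 * b2 * b3))"
      using x b0 q0 by (simp add: power3_eq_cube power_mult[of q 3 m] mult.commute[of 3 m] power_mult)
    also have "q ^ (3 * m) = s ^ (6 * m)" unfolding s2[symmetric] by (simp flip: power_mult)
    also have "s ^ (6 * m + 3) / (s ^ (6 * m) * (b1 * b2 * b3)) = q" unfolding b s2[symmetric] using s0
      by (simp add: power_add power2_eq_square power3_eq_cube)
    finally show ?thesis .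
  qed
  have "(P (q powi (1 - int (Suc m)) * x / b1) * P (q powi (1 - int (Suc m)) * x / b2) * P (q powi (1 - int (Suc m)) * x / b3)) *
     ((-1) powi int (Suc m) * s powi (3 * (int (Suc m))^2) / x powi (3 * int (Suc m))) =
     ((- x / (q ^ m * b1)) * (- x / (q ^ m * b2)) * (- x / (q ^ m * b3)) * (- (s ^ (6 * m + 3)) / x^3)) *
     ((1 - b1 / x * q ^ m) * (1 - b2 / x * q ^ m) * (1 - b3 / x * q ^ m)) *
     ((P (q powi (1 - int m) * x / b1) * P (q powi (1 - int m) * x / b2) * P (q powi (1 - int m) * x / b3)) *
     ((-1) powi int m * s powi (3 * (int m)^2) / x powi (3 * int m)))"
    unfolding Pb[OF b0(1)] Pb[OF b0(2)] Pb[OF b0(3)] w by (simp only: mult_ac)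
  also have "\<dots> = q ^ Suc m * (Pn (b1 / x) (Suc m) * Pn (b2 / x) (Suc m) * Pn (b3 / x) (Suc m)) * (P (q * x / b1) * P (q * x / b2) * P (q * x / b3))"
    unfolding c Suc.IH Pn_Suc power_Suc by (simp only: mult_ac)
  finally show ?case .
qed

lemma lat_term_nonneg:
  assumes "b1 * b2 * b3 = s" "x \<noteq> 0"
  shows "lat_term a1 a2 a3 b1 b2 b3 x (int m) = half_term a1 a2 a3 b1 b2 b3 x m"
proof -
  have "q powi (1 + int m) = q ^ Suc m"
    using q0 by (simp add: power_int_add)
  then show ?thesis
    unfolding lat_term_def half_term_def mult.assoc[of "_ * _ * _" "_ * _ * _" "_ / _"] lat_term_weight[OF assms]
    by (simp only: mult_ac)
qed

lemma lat_term_bound: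
  assumes a: "a1 * a2 * a3 = s" and b: "b1 * b2 * b3 = s" and x: "x \<noteq> 0"
    and r: "norm (1 / (a1 * x)) \<le> r" "norm (1 / (a2 * x)) \<le> r" "norm (1 / (a3 * x)) \<le> r"
    "norm (b1 / x) \<le> r" "norm (b2 / x) \<le> r" "norm (b3 / x) \<le> r"
    "norm (x / b1) \<le> r" "norm (x / b2) \<le> r" "norm (x / b3) \<le> r"
    "norm (a1 * x) \<le> r" "norm (a2 * x) \<le> r" "norm (a3 * x) \<le> r"
  shows "norm (lat_term a1 a2 a3 b1 b2 b3 x m) \<le> bnd r ^ 9 * norm q ^ nat \<bar>m\<bar>"
proof -
  have nz: "a1 \<noteq> 0" "a2 \<noteq> 0" "a3 \<noteq> 0" "b1 \<noteq> 0" "b2 \<noteq> 0" "b3 \<noteq> 0" using a b s0 by auto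
  have E: "norm q ^ n * (bnd r * bnd r * bnd r) * (bnd r * bnd r * bnd r) * (bnd r * bnd r * bnd r) = bnd r ^ 9 * norm q ^ n" for n
    by (simp add: numeral_eq_Suc mult_ac)
  show ?thesis
  proof (cases "m \<ge> 0")
    case True
    then obtain n where n: "m = int n" using nonneg_int_cases by blast
    show ?thesis unfolding n lat_term_nonneg[OF b x] using norm_half_term_le[OF r(1-9), of n] by (simp only: E nat_int abs_of_nat)
  next
    case False
    then obtain n where n: "m = - int n" by (metis le_cases neg_int_cases nonneg_int_cases minus_zero of_nat_0 not_le)
    have "norm (half_term b1 b2 b3 a1 a2 a3 (1 / x) n) \<le> norm q ^ n * (bnd r * bnd r * bnd r) * (bnd r * bnd r * bnd r) * (bnd r * bnd r * bnd r)"
      by (rule norm_half_term_le) (use r in \<open>simp_all add: divide_divide_eq_left mult.commute\<close>)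
    then show ?thesis
      unfolding n lat_term_neg[OF x nz] lat_term_nonneg[OF a, of "1/x", simplified, OF x]
      by (simp only: E abs_minus_cancel nat_int abs_of_nat)
  qed
qed

lemma summable_int_geometric: "(\<lambda>m::int. C * norm q ^ nat \<bar>m\<bar>) summable_on UNIV"
proof -
  have g: "(\<lambda>n. C * norm q ^ n) summable_on UNIV"
    by (intro summable_on_cmult_right norm_summable_imp_summable_on) (use q1 in \<open>simp add: summable_geometric norm_power\<close>)
  have "(\<lambda>m::int. C * norm q ^ nat \<bar>m\<bar>) summable_on range int"
    using g by (subst summable_on_reindex) (auto simp: o_def)
  moreover have "(\<lambda>m::int. C * norm q ^ nat \<bar>m\<bar>) summable_on range (\<lambda>n. - int n)"
    using g by (subst summable_on_reindex) (auto simp: o_def inj_on_def)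
  ultimately have "(\<lambda>m::int. C * norm q ^ nat \<bar>m\<bar>) summable_on (range int \<union> range (\<lambda>n. - int n))"
    by (rule summable_on_union)
  moreover have "range int \<union> range (\<lambda>n. - int n) = UNIV"
  proof -
    have "m \<in> range int \<union> range (\<lambda>n. - int n)" for m :: int
      by (cases m rule: int_cases2) auto
    then show ?thesis by blast
  qed
  ultimately show ?thesis by simp
qed

text \<open>The parameters range over an abstract compact space because two cases occur: x varying
  with fixed parameters, and x varying jointly with a deformation of a2 and a3.\<close>

lemma lat_term_compact_bound:
  fixes Y :: "'p :: topological_space set" and A2 A3 X :: "'p \<Rightarrow> complex"
  assumes Y: "compact Y" and c: "continuous_on Y A2" "continuous_on Y A3" "continuous_on Y X"
    and X0: "\<And>y. y \<in> Y \<Longrightarrow> X y \<noteq> 0"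
    and a: "\<And>y. y \<in> Y \<Longrightarrow> a1 * A2 y * A3 y = s" and b: "b1 * b2 * b3 = s"
  shows "\<exists>C. \<forall>y\<in>Y. \<forall>m. norm (lat_term a1 (A2 y) (A3 y) b1 b2 b3 (X y) m) \<le> C * norm q ^ nat \<bar>m\<bar>"
proof (cases "Y = {}")
  case False
  have A0: "a1 \<noteq> 0" "\<And>y. y \<in> Y \<Longrightarrow> A2 y \<noteq> 0" "\<And>y. y \<in> Y \<Longrightarrow> A3 y \<noteq> 0"
    using a s0 False by fastforce+
  have b0: "b1 \<noteq> 0" "b2 \<noteq> 0" "b3 \<noteq> 0" using b s0 by auto
  have bd: "\<exists>K. \<forall>y\<in>Y. norm (g y) \<le> K" if "continuous_on Y g" for g :: "'p \<Rightarrow> complex"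
    using compact_imp_bounded[OF compact_continuous_image[OF that Y]] by (auto simp: bounded_iff)
  have "\<exists>K. \<forall>y\<in>Y. norm (1 / (a1 * X y)) \<le> K" "\<exists>K. \<forall>y\<in>Y. norm (1 / (A2 y * X y)) \<le> K" "\<exists>K. \<forall>y\<in>Y. norm (1 / (A3 y * X y)) \<le> K"
    "\<exists>K. \<forall>y\<in>Y. norm (b1 / X y) \<le> K" "\<exists>K. \<forall>y\<in>Y. norm (b2 / X y) \<le> K" "\<exists>K. \<forall>y\<in>Y. norm (b3 / X y) \<le> K"
    "\<exists>K. \<forall>y\<in>Y. norm (X y / b1) \<le> K" "\<exists>K. \<forall>y\<in>Y. norm (X y / b2) \<le> K" "\<exists>K. \<forall>y\<in>Y. norm (X y / b3) \<le> K"
    "\<exists>K. \<forall>y\<in>Y. norm (a1 * X y) \<le> K" "\<exists>K. \<forall>y\<in>Y. norm (A2 y * X y) \<le> K" "\<exists>K. \<forall>y\<in>Y. norm (A3 y * X y) \<le> K"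
    by (intro bd continuous_on_divide continuous_on_mult continuous_on_const c; use A0 b0 X0 in auto)+
  then obtain K1 K2 K3 K4 K5 K6 K7 K8 K9 K10 K11 K12 where K:
    "\<forall>y\<in>Y. norm (1 / (a1 * X y)) \<le> K1" "\<forall>y\<in>Y. norm (1 / (A2 y * X y)) \<le> K2" "\<forall>y\<in>Y. norm (1 / (A3 y * X y)) \<le> K3"
    "\<forall>y\<in>Y. norm (b1 / X y) \<le> K4" "\<forall>y\<in>Y. norm (b2 / X y) \<le> K5" "\<forall>y\<in>Y. norm (b3 / X y) \<le> K6"
    "\<forall>y\<in>Y. norm (X y / b1) \<le> K7" "\<forall>y\<in>Y. norm (X y / b2) \<le> K8" "\<forall>y\<in>Y. norm (X y / b3) \<le> K9"
    "\<forall>y\<in>Y. norm (a1 * X y) \<le> K10" "\<forall>y\<in>Y. norm (A2 y * X y) \<le> K11" "\<forall>y\<in>Y. norm (A3 y * X y) \<le> K12"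
    by (elim exE)
  define r where "r = Max {K1,K2,K3,K4,K5,K6,K7,K8,K9,K10,K11,K12}"
  have r: "K1 \<le> r" "K2 \<le> r" "K3 \<le> r" "K4 \<le> r" "K5 \<le> r" "K6 \<le> r" "K7 \<le> r" "K8 \<le> r" "K9 \<le> r" "K10 \<le> r" "K11 \<le> r" "K12 \<le> r"
    unfolding r_def by (rule Max_ge; simp)+
  have "norm (lat_term a1 (A2 y) (A3 y) b1 b2 b3 (X y) m) \<le> bnd r ^ 9 * norm q ^ nat \<bar>m\<bar>" if y: "y \<in> Y" for y m
    by (rule lat_term_bound[OF a[OF y] b X0[OF y]]) (use K y r in \<open>blast intro: order_trans\<close>)+
  then show ?thesis by blast
qed simp

lemma lat_term_summable:
  assumes "a1 * a2 * a3 = s" "b1 * b2 * b3 = s" "x \<noteq> 0"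
  shows "lat_term a1 a2 a3 b1 b2 b3 x summable_on UNIV"
proof -
  obtain C where "\<And>m. norm (lat_term a1 a2 a3 b1 b2 b3 x m) \<le> C * norm q ^ nat \<bar>m\<bar>"
    using lat_term_compact_bound[of "{x}" "\<lambda>_. a2" "\<lambda>_. a3" "\<lambda>x. x" a1 b1 b2 b3] assms by auto
  then have "(\<lambda>m. norm (lat_term a1 a2 a3 b1 b2 b3 x m)) summable_on UNIV"
    by (intro Infinite_Sum.abs_summable_on_comparison_test'[OF summable_int_geometric]) auto
  then show ?thesis by (rule abs_summable_summable)
qed

lemma lat_sum_has_sum:
  assumes "a1 * a2 * a3 = s" "b1 * b2 * b3 = s" "x \<noteq> 0"
  shows "(lat_term a1 a2 a3 b1 b2 b3 x has_sum lat_sum a1 a2 a3 b1 b2 b3 x) UNIV"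
  unfolding lat_sum_def by (intro has_sum_infsum lat_term_summable assms)

text \<open>Apart from the weight, the term depends only on q^m/x and x/q^m and hence is unchanged
  under (x, m) -> (q x, m + 1); the weight supplies the multiplier.\<close>

lemma lat_sum_mult_q:
  assumes x: "x \<noteq> 0"
  shows "lat_sum a1 a2 a3 b1 b2 b3 (q * x) = - lat_sum a1 a2 a3 b1 b2 b3 x / (s^3 * x^3)"
proof -
  have "lat_term a1 a2 a3 b1 b2 b3 (q * x) (m + 1) = (- 1 / (s^3 * x^3)) * lat_term a1 a2 a3 b1 b2 b3 x m" for m
  proof -
    have e1: "q powi (1 + (m + 1)) / (a * (q * x)) = q powi (1 + m) / (a * x)"
         "q powi (1 - (m + 1)) * (q * x) / b = q powi (1 - m) * x / b" for a b
    proof -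
      have "q powi ((1 + m) + 1) = q powi (1 + m) * q" "q powi ((1 - (m + 1)) + 1) = q powi (1 - (m + 1)) * q"
        using q0 by (simp_all only: power_int_add_1 simp_thms)
      then have "q powi (1 + (m + 1)) = q powi (1 + m) * q" "q powi (1 - m) = q powi (1 - (m + 1)) * q"
        by (simp_all add: add.assoc)
      then show "q powi (1 + (m + 1)) / (a * (q * x)) = q powi (1 + m) / (a * x)"
         "q powi (1 - (m + 1)) * (q * x) / b = q powi (1 - m) * x / b"
        using q0 by simp_all
    qed
    moreover have e2: "(-1) powi (m + 1) * s powi (3 * (m + 1)^2) / (q * x) powi (3 * (m + 1)) =
       (- 1 / (s^3 * x^3)) * ((-1) powi m * s powi (3 * m^2) / x powi (3 * m))"
    proof -
      have 1: "3 * (m + 1)^2 + 3 = 3 * m^2 + (6 * m + 6)" by (simp add: power2_eq_square algebra_simps)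
      have "(q * x) powi (3 * (m + 1)) = s powi (6 * m + 6) * (x powi (3 * m) * x^3)"
        using x by (simp add: power_int_mult_distrib q_powi power_int_add algebra_simps)
      moreover have "s powi (3 * (m + 1)^2) = s powi (3 * m^2) * s powi (6 * m + 6) / s^3"
      proof -
        have "s powi (3 * (m + 1)^2) * s powi 3 = s powi (3 * m^2) * s powi (6 * m + 6)"
          using arg_cong[OF 1, of "\<lambda>k. s powi k"] s0 by (simp only: power_int_add simp_thms)
        then show ?thesis using s0 by (simp add: eq_divide_eq)
      qed
      moreover have "(-1 :: complex) powi (m + 1) = - ((-1) powi m)" by (simp add: power_int_add)
      moreover have "s powi (6 * m + 6) \<noteq> 0" using s0 by simp
      moreover have "- e * (A * W / s^3) / (W * (x3 * x^3)) = (- 1 / (s^3 * x^3)) * (e * A / x3)"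
        if "W \<noteq> 0" for e A W x3 :: complex using that by (simp add: mult_ac)
      ultimately show ?thesis by metis
    qed
    ultimately show ?thesis unfolding lat_term_def e1 e2 by (simp only: mult_ac)
  qed
  then have "(\<Sum>\<^sub>\<infinity>m. lat_term a1 a2 a3 b1 b2 b3 (q * x) (m + 1)) = (- 1 / (s^3 * x^3)) * lat_sum a1 a2 a3 b1 b2 b3 x"
    unfolding lat_sum_def by (simp only: infsum_cmult_right')
  moreover have "(\<Sum>\<^sub>\<infinity>m. lat_term a1 a2 a3 b1 b2 b3 (q * x) (m + 1)) = lat_sum a1 a2 a3 b1 b2 b3 (q * x)"
    unfolding lat_sum_def by (rule infsum_reindex_bij_betw) (rule bij_betw_byWitness[where f' = "\<lambda>m. m - 1"], auto)
  ultimately show ?thesis by simp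
qed

lemma lat_term_holomorphic:
  assumes "a1 \<noteq> 0" "a2 \<noteq> 0" "a3 \<noteq> 0" "b1 \<noteq> 0" "b2 \<noteq> 0" "b3 \<noteq> 0"
  shows "(\<lambda>x. lat_term a1 a2 a3 b1 b2 b3 x m) holomorphic_on - {0}"
  unfolding lat_term_def using assms by (intro holomorphic_intros) auto

lemma lat_sum_uniform_limit:
  assumes a: "a1 * a2 * a3 = s" and b: "b1 * b2 * b3 = s" and K: "compact K" "0 \<notin> K"
  shows "uniform_limit K (\<lambda>X x. \<Sum>m\<in>X. lat_term a1 a2 a3 b1 b2 b3 x m) (lat_sum a1 a2 a3 b1 b2 b3) (finite_subsets_at_top UNIV)"
proof -
  obtain C where "\<forall>x\<in>K. \<forall>m. norm (lat_term a1 a2 a3 b1 b2 b3 x m) \<le> C * norm q ^ nat \<bar>m\<bar>"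
    using lat_term_compact_bound[OF K(1), of "\<lambda>_. a2" "\<lambda>_. a3" "\<lambda>x. x" a1 b1 b2 b3] a b K by fastforce
  then show ?thesis unfolding lat_sum_def
    by (intro Weierstrass_m_test_general[OF _ summable_int_geometric[of C]]) auto
qed

lemma lat_sum_holomorphic:
  assumes a: "a1 * a2 * a3 = s" and b: "b1 * b2 * b3 = s"
  shows "lat_sum a1 a2 a3 b1 b2 b3 holomorphic_on - {0}"
proof -
  have nz: "a1 \<noteq> 0" "a2 \<noteq> 0" "a3 \<noteq> 0" "b1 \<noteq> 0" "b2 \<noteq> 0" "b3 \<noteq> 0" using a b s0 by auto
  have "lat_sum a1 a2 a3 b1 b2 b3 field_differentiable (at z)" if "z \<noteq> 0" for z
  proof -
    define r where "r = norm z / 2"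
    have r: "r > 0" "cball z r \<subseteq> - {0}" using that by (auto simp: r_def)
    define F where "F = (\<lambda>X x. \<Sum>m\<in>X. lat_term a1 a2 a3 b1 b2 b3 x m)"
    have hol: "F X holomorphic_on - {0}" for X
      unfolding F_def by (intro holomorphic_intros lat_term_holomorphic nz)
    obtain "lat_sum a1 a2 a3 b1 b2 b3 holomorphic_on ball z r"
    proof (rule holomorphic_uniform_limit[of z r F "finite_subsets_at_top UNIV" "lat_sum a1 a2 a3 b1 b2 b3"])
      have "continuous_on (cball z r) (F X) \<and> F X holomorphic_on ball z r" for X
        using hol[of X] r ball_subset_cball[of z r] by (meson holomorphic_on_imp_continuous_on holomorphic_on_subset subset_trans)
      then show "\<forall>\<^sub>F X in finite_subsets_at_top UNIV. continuous_on (cball z r) (F X) \<and> F X holomorphic_on ball z r"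
        by simp
      show "uniform_limit (cball z r) F (lat_sum a1 a2 a3 b1 b2 b3) (finite_subsets_at_top UNIV)"
        unfolding F_def by (rule lat_sum_uniform_limit[OF a b]) (use r in auto)
    qed auto
    then show ?thesis using r(1) by (meson centre_in_ball holomorphic_on_imp_differentiable_at open_ball)
  qed
  then show ?thesis by (auto simp: holomorphic_on_def intro: field_differentiable_at_within)
qed

text \<open>At x = 1/a_j one factor is P(q^(1+m)), which vanishes for every m < 0.\<close>

lemma lat_sum_eq_suminf:
  assumes a: "a1 * a2 * a3 = s" and b: "b1 * b2 * b3 = s" and x: "x \<noteq> 0"
    and z: "x = 1 / a1 \<or> x = 1 / a2 \<or> x = 1 / a3"
  shows "lat_sum a1 a2 a3 b1 b2 b3 x = suminf (half_term a1 a2 a3 b1 b2 b3 x)"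
proof -
  have "lat_term a1 a2 a3 b1 b2 b3 x m = 0" if "m \<notin> range int" for m
  proof -
    have "m < 0" using that by (metis nonneg_int_cases not_le rangeI)
    then have "P (q powi (1 + m)) = 0" unfolding P_eq_0_iff
      using q0 by (intro exI[of _ "nat (- 1 - m)"]) (simp flip: power_int_add power_int_of_nat)
    moreover have "a1 * x = 1 \<or> a2 * x = 1 \<or> a3 * x = 1" using z x by auto
    ultimately show ?thesis by (auto simp: lat_term_def)
  qed
  then have "lat_sum a1 a2 a3 b1 b2 b3 x = (\<Sum>\<^sub>\<infinity>m\<in>range int. lat_term a1 a2 a3 b1 b2 b3 x m)"
    unfolding lat_sum_def by (intro infsum_cong_neutral) auto
  also have "\<dots> = (\<Sum>\<^sub>\<infinity>n. lat_term a1 a2 a3 b1 b2 b3 x (int n))"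
    by (subst infsum_reindex) (auto simp: o_def)
  also have "\<dots> = (\<Sum>\<^sub>\<infinity>n. half_term a1 a2 a3 b1 b2 b3 x n)"
    by (simp add: lat_term_nonneg[OF b x])
  also have "\<dots> = suminf (half_term a1 a2 a3 b1 b2 b3 x)"
  proof (rule sums_unique[OF has_sum_imp_sums[OF has_sum_infsum]])
    have "(\<lambda>m. lat_term a1 a2 a3 b1 b2 b3 x m) summable_on range int"
      by (rule summable_on_subset_banach[OF lat_term_summable[OF a b x]]) auto
    then show "half_term a1 a2 a3 b1 b2 b3 x summable_on UNIV"
      by (subst (asm) summable_on_reindex) (auto simp: o_def lat_term_nonneg[OF b x])
  qed
  finally show ?thesis .
qed

end

subsection \<open>Evaluation of the integral\<close>

lemma remove_sings_analytic_if_eventually: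
  assumes h: "h analytic_on {z}" and ev: "\<forall>\<^sub>F x in at z. f x = h x"
  shows "remove_sings f analytic_on {z}" "f \<midarrow>z\<rightarrow> remove_sings f z"
proof -
  obtain A where A: "open A" "z \<in> A" "h holomorphic_on A"
    using h analytic_at by auto
  obtain B where B: "open B" "z \<in> B" "\<And>x. x \<in> B \<Longrightarrow> x \<noteq> z \<Longrightarrow> f x = h x"
    using ev unfolding eventually_at_topological by blast
  have "f holomorphic_on (A \<inter> B) - {z}"
    using holomorphic_on_subset[OF A(3), of "A \<inter> B - {z}"] B(3)
    by (subst holomorphic_cong[OF refl, of _ f h]) auto
  then have iso: "isolated_singularity_at f z"
    using A B unfolding isolated_singularity_at_iff_analytic_nhd
    by (intro exI[of _ "A \<inter> B"]) (auto simp: analytic_on_open open_Int open_Diff)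
  have "h \<midarrow>z\<rightarrow> h z" using analytic_at_imp_isCont[OF h] by (simp add: isCont_def)
  then have lim: "f \<midarrow>z\<rightarrow> h z"
    using ev by (metis (mono_tags, lifting) Lim_transform_eventually eventually_mono)
  show "remove_sings f analytic_on {z}" by (rule remove_sings_analytic_at[OF iso lim])
  show "f \<midarrow>z\<rightarrow> remove_sings f z" using lim by (simp add: remove_sings_eqI)
qed

lemma eventually_at_scale:
  fixes c z :: complex
  assumes "c \<noteq> 0" "\<forall>\<^sub>F x in at z. Q x"
  shows "\<forall>\<^sub>F x in at (c * z). Q (x / c)"
proof -
  have "filterlim (\<lambda>x. x / c) (at (c * z / c)) (at (c * z))"
  proof (rule filterlim_at[THEN iffD2], intro conjI)
    show "\<forall>\<^sub>F x in at (c * z). x / c \<in> UNIV \<and> x / c \<noteq> c * z / c"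
      unfolding eventually_at_filter
      by (rule always_eventually) (use assms(1) in \<open>auto simp: field_simps\<close>)
    show "((\<lambda>x. x / c) \<longlongrightarrow> c * z / c) (at (c * z))"
      by (intro tendsto_intros assms)
  qed
  then show ?thesis using assms by (simp add: filterlim_iff)
qed

context qpoch_sqrt
begin

section \<open>Division by a theta function\<close>

lemma theta_scale_holomorphic: "c \<noteq> 0 \<Longrightarrow> (\<lambda>x. theta (c * x)) holomorphic_on - {0}"
  unfolding theta_def by (intro holomorphic_intros) auto

text \<open>The zeros of \<open>theta (a * x)\<close> form one orbit under $x \mapsto qx$, so regularity of the quotient at
  $1/a$ propagates to all of them.\<close>

lemma divide_by_theta:
  assumes \<phi>: "\<phi> holomorphic_on - {0}" and \<phi>q: "\<And>x. x \<noteq> 0 \<Longrightarrow> \<phi> (q * x) = - \<phi> x / (s^3 * x^3)"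
    and a: "a \<noteq> 0" and z: "\<phi> (1 / a) = 0"
  obtains \<psi> where "\<psi> holomorphic_on - {0}" "\<And>x. x \<noteq> 0 \<Longrightarrow> \<phi> x = \<psi> x * theta (a * x)"
    "\<And>x. x \<noteq> 0 \<Longrightarrow> \<psi> (q * x) = a * \<psi> x / (s^3 * x^2)"
proof -
  define f where "f = (\<lambda>x. \<phi> x / theta (a * x))"
  define u where "u = (\<lambda>x. a / (s^3 * x^2))"
  have u0: "x \<noteq> 0 \<Longrightarrow> u x \<noteq> 0" for x using a s0 by (simp add: u_def)
  have fq: "f (q * x) = u x * f x" if "x \<noteq> 0" for x
  proof -
    have "theta (a * (q * x)) = - theta (a * x) / (a * x)"
      using theta_mult_q[of "a * x"] a that by (simp add: mult.left_commute)
    then show ?thesis unfolding f_def u_def \<phi>q[OF that]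
      using a that s0 by (simp add: power2_eq_square power3_eq_cube mult_ac)
  qed
  have u_an: "u analytic_on {x}" if "x \<noteq> 0" for x
    unfolding u_def using that s0 by (auto intro!: analytic_intros)
  \<comment> \<open>Regularity at a point is expressed through a local analytic representative
    \<open>h\<close>, because such an \<open>h\<close> can be transported along x -> q x by the
    functional equation of \<open>f\<close>.\<close>
  define R where "R = (\<lambda>z. \<exists>h. h analytic_on {z} \<and> (\<forall>\<^sub>F x in at z. f x = h x))"
  have f_an: "f analytic_on {z}" if "z \<noteq> 0" "theta (a * z) \<noteq> 0" for z
  proof -
    have "\<phi> analytic_on {z}" "(\<lambda>x. theta (a * x)) analytic_on {z}"
      using \<phi> theta_scale_holomorphic[OF a] that(1)
      by (auto simp: analytic_at intro!: exI[of _ "- {0}"])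
    then show ?thesis unfolding f_def using that by (intro analytic_on_divide) auto
  qed
  have R_reg: "R z" if "z \<noteq> 0" "theta (a * z) \<noteq> 0" for z
    unfolding R_def using f_an[OF that] by (intro exI[of _ f]) auto
  have R_q: "R (q * z)" if "R z" "z \<noteq> 0" for z
  proof -
    obtain h where h: "h analytic_on {z}" "\<forall>\<^sub>F x in at z. f x = h x" using \<open>R z\<close> by (auto simp: R_def)
    define h' where "h' = (\<lambda>x. u (x / q) * h (x / q))"
    have "(\<lambda>x. x / q) analytic_on {q * z}" using q0 by (auto intro!: analytic_intros)
    then have "(\<lambda>x. h (x / q)) analytic_on {q * z}" "(\<lambda>x. u (x / q)) analytic_on {q * z}"
      using analytic_on_compose_gen[of "\<lambda>x. x / q" "{q * z}" h "{z}"]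
        analytic_on_compose_gen[of "\<lambda>x. x / q" "{q * z}" u "{z}"] h(1) u_an[OF that(2)] q0
      by (auto simp: o_def)
    then have "h' analytic_on {q * z}" unfolding h'_def by (intro analytic_on_mult)
    moreover have "\<forall>\<^sub>F x in at (q * z). f x = h' x"
    proof -
      have "\<forall>\<^sub>F x in at (q * z). x \<in> - {0} - {q * z}"
        using that q0 by (intro eventually_at_in_open) auto
      with eventually_at_scale[OF q0 h(2)] show ?thesis
      proof eventually_elim
        case (elim x)
        then show ?case using fq[of "x / q"] q0 by (simp add: h'_def)
      qed
    qed
    ultimately show ?thesis unfolding R_def by blast
  qed
  have R_q': "R (z / q)" if "R z" "z \<noteq> 0" for z
  proof -
    obtain h where h: "h analytic_on {z}" "\<forall>\<^sub>F x in at z. f x = h x" using \<open>R z\<close> by (auto simp: R_def)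
    define h' where "h' = (\<lambda>x. h (q * x) / u x)"
    have zq: "z / q \<noteq> 0" using that q0 by simp
    have "(\<lambda>x. q * x) analytic_on {z / q}" by (auto intro!: analytic_intros)
    then have "(\<lambda>x. h (q * x)) analytic_on {z / q}"
      using analytic_on_compose_gen[of "\<lambda>x. q * x" "{z / q}" h "{z}"] h(1) q0
      by (auto simp: o_def)
    then have "h' analytic_on {z / q}" unfolding h'_def
      by (intro analytic_on_divide u_an[OF zq]) (use u0[OF zq] in auto)
    moreover have "\<forall>\<^sub>F x in at (z / q). f x = h' x"
    proof -
      have "\<forall>\<^sub>F x in at (z / q). x \<in> - {0} - {z / q}"
        using that q0 by (intro eventually_at_in_open) auto
      moreover have "\<forall>\<^sub>F x in at (z / q). f (q * x) = h (q * x)"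
        using eventually_at_scale[of "1/q", OF _ h(2)] q0 by (simp add: mult.commute)
      ultimately show ?thesis
      proof eventually_elim
        case (elim x)
        then show ?case using fq[of x] u0[of x] by (simp add: h'_def eq_divide_eq mult.commute)
      qed
    qed
    ultimately show ?thesis unfolding R_def by blast
  qed
  have R1: "R (1 / a)"
  proof -
    \<comment> \<open>The zero of \<phi> at 1/a cancels the simple zero of theta(a x):
      \<open>g\<close> is the difference quotient of \<phi>, and \<open>v\<close> is theta(a x)
      without the factor 1 - a x.\<close>
    define g where "g = (\<lambda>x. if x = 1 / a then deriv \<phi> (1 / a) else (\<phi> x - \<phi> (1 / a)) / (x - 1 / a))"
    define v where "v = (\<lambda>x. P (q * (a * x)) * P (q / (a * x)))"
    have "g holomorphic_on - {0}" unfolding g_def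
      by (rule pole_lemma[OF \<phi>]) (use a in \<open>simp add: interior_open open_Compl\<close>)
    moreover have "v holomorphic_on - {0}" unfolding v_def using a by (intro holomorphic_intros) auto
    ultimately have "g analytic_on {1 / a}" "v analytic_on {1 / a}"
      using a by (auto simp: analytic_at intro!: exI[of _ "- {0}"])
    moreover have "v (1 / a) \<noteq> 0" using a by (simp add: v_def)
    ultimately have "(\<lambda>x. g x * (- 1 / a) / v x) analytic_on {1 / a}"
      by (intro analytic_on_divide analytic_on_mult analytic_on_const) auto
    moreover have "\<forall>\<^sub>F x in at (1 / a). f x = g x * (- 1 / a) / v x"
    proof -
      have "f x = g x * (- 1 / a) / v x" if "x \<noteq> 1 / a" for x
      proof -
        have "theta (a * x) = (1 - a * x) * v x" using P_rec[of "a * x"] by (simp add: theta_def v_def)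
        also have "1 - a * x = - a * (x - 1 / a)" using a by (simp add: field_simps)
        finally show ?thesis using that z a by (simp add: f_def g_def)
      qed
      then show ?thesis by (auto simp: eventually_at_filter)
    qed
    ultimately show ?thesis unfolding R_def by blast
  qed
  have \<phi>0: "\<phi> (z / q) = 0" if "z \<noteq> 0" "\<phi> z = 0" for z
    using \<phi>q[of "z / q"] that q0 s0 by simp
  \<comment> \<open>The vanishing of \<phi> is carried along, since the factorisation of \<phi> is
    also claimed at the zeros of theta.\<close>
  have R_k: "R (q powi k / a) \<and> \<phi> (q powi k / a) = 0" for k :: int
  proof (induction k rule: int_induct[where k = 0])
    case base
    then show ?case using R1 z by simp
  next
    case (step1 i)
    have "q powi (i + 1) / a = q * (q powi i / a)" using q0 by (simp add: power_int_add)
    then show ?case using step1 R_q[of "q powi i / a"] \<phi>q[of "q powi i / a"] a q0 by simp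
  next
    case (step2 i)
    have "q powi (i - 1) / a = (q powi i / a) / q" using q0 by (simp add: power_int_diff)
    then show ?case using step2 R_q'[of "q powi i / a"] \<phi>0[of "q powi i / a"] a q0 by simp
  qed
  have R: "R z \<and> (theta (a * z) = 0 \<longrightarrow> \<phi> z = 0)" if "z \<noteq> 0" for z
  proof (cases "theta (a * z) = 0")
    case True
    then obtain k where "a * z = q powi k" using theta_eq_0_iff[of "a * z"] a \<open>z \<noteq> 0\<close> by auto
    then have "z = q powi k / a" using a by (simp add: field_simps)
    then show ?thesis using R_k by simp
  qed (use R_reg that in auto)
  define \<psi> where "\<psi> = remove_sings f"
  have an: "\<psi> analytic_on {z}" and lim: "f \<midarrow>z\<rightarrow> \<psi> z" if "z \<noteq> 0" for z
    using R[OF that] remove_sings_analytic_if_eventually[of _ z f] unfolding R_def \<psi>_def by blast+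
  show thesis
  proof
    show "\<psi> holomorphic_on - {0}"
      by (rule analytic_imp_holomorphic) (use an analytic_on_analytic_at in blast)
    show "\<phi> x = \<psi> x * theta (a * x)" if "x \<noteq> 0" for x
    proof (cases "theta (a * x) = 0")
      case True
      then show ?thesis using R[OF that] by simp
    next
      case False
      have "\<psi> x = f x" unfolding \<psi>_def by (rule remove_sings_at_analytic[OF f_an[OF that False]])
      then show ?thesis using False by (simp add: f_def)
    qed
    show "\<psi> (q * x) = a * \<psi> x / (s^3 * x^2)" if x: "x \<noteq> 0" for x
    proof -
      \<comment> \<open>At zeros of theta the value of \<psi> is only a limit of \<open>f\<close>,
        so its functional equation is obtained by passing to the limit.\<close>
      have fl: "filterlim (\<lambda>y. q * y) (at (q * x)) (at x)"
        using q0 by (auto simp: filterlim_at eventually_at_filter intro!: tendsto_intros)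
      have "q * x \<noteq> 0" using x q0 by simp
      then have A: "(\<lambda>y. f (q * y)) \<midarrow>x\<rightarrow> \<psi> (q * x)"
        by (rule filterlim_compose[OF lim fl])
      have B: "(\<lambda>y. u y * f y) \<midarrow>x\<rightarrow> u x * \<psi> x"
        unfolding u_def using x s0 by (intro tendsto_intros lim) auto
      have C: "\<forall>\<^sub>F y in at x. f (q * y) = u y * f y"
      proof -
        have "\<forall>\<^sub>F y in at x. y \<in> - {0} - {x}"
          using x by (intro eventually_at_in_open) auto
        then show ?thesis by eventually_elim (simp add: fq)
      qed
      have "\<psi> (q * x) = u x * \<psi> x"
        by (rule LIM_unique[OF Lim_transform_eventually[OF A C] B])
      then show ?thesis by (simp add: u_def)
    qed
  qed
qed

section \<open>The integral as a functional on theta functions\<close>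

lemma theta_prod_holomorphic: "b1 \<noteq> 0 \<Longrightarrow> b2 \<noteq> 0 \<Longrightarrow> b3 \<noteq> 0 \<Longrightarrow> theta_prod b1 b2 b3 holomorphic_on - {0}"
  unfolding theta_prod_def theta_def by (intro holomorphic_intros) auto

lemma theta_prod_mult_q:
  assumes b: "b1 * b2 * b3 = s" and x: "x \<noteq> 0"
  shows "theta_prod b1 b2 b3 (q * x) = - theta_prod b1 b2 b3 x / (s^3 * x^3)"
proof -
  have b0: "b1 \<noteq> 0" "b2 \<noteq> 0" "b3 \<noteq> 0" using b s0 by auto
  have e: "theta (b / (q * x)) = - (b / (q * x)) * theta (b / x)" if "b \<noteq> 0" for b
    using theta_mult_q[of "b / (q * x)"] that x q0 by (simp add: field_simps)
  have "theta_prod b1 b2 b3 (q * x) = - (b1 * b2 * b3 / (q^2 * x^3)) * theta_prod b1 b2 b3 x"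
    unfolding theta_prod_def e[OF b0(1)] e[OF b0(2)] e[OF b0(3)]
    using x q0 by (simp add: power2_eq_square power3_eq_cube mult_ac)
  also have "b1 * b2 * b3 / (q^2 * x^3) = 1 / (s^3 * x^3)"
    unfolding b s2[symmetric] using s0 x by (simp add: power2_eq_square power3_eq_cube mult_ac)
  finally show ?thesis by simp
qed

definition kernel where
  "kernel a1 a2 a3 b1 b2 b3 x = 1 / (Pm3 a1 a2 a3 x * Pd3 b1 b2 b3 x * x)"

abbreviation "pairing \<gamma> \<phi> a1 a2 a3 b1 b2 b3 \<equiv>
  contour_integral \<gamma> (\<lambda>x. \<phi> x * kernel a1 a2 a3 b1 b2 b3 x)"

lemma kernel_holomorphic: "kernel a1 a2 a3 b1 b2 b3 holomorphic_on regular {b1,b2,b3} {a1,a2,a3}"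
  unfolding kernel_def by (intro holomorphic_intros) (auto simp: zeros_in_def zeros_out_def)

text \<open>The factors P(b_j/x) of the theta functions cancel the inner poles and the factor x
  cancels the pole at 0; around the remaining poles the winding number is 0.\<close>

lemma kernel_theta_prod_integral:
  assumes sep: "separates {b1,b2,b3} {a1,a2,a3} \<gamma>" and b0: "b1 \<noteq> 0" "b2 \<noteq> 0" "b3 \<noteq> 0"
  shows "pairing \<gamma> (theta_prod b1 b2 b3) a1 a2 a3 b1 b2 b3 = 0"
proof -
  define g where "g = (\<lambda>x. P (q * x / b1) * P (q * x / b2) * P (q * x / b3) / Pm3 a1 a2 a3 x)"
  have "pairing \<gamma> (theta_prod b1 b2 b3) a1 a2 a3 b1 b2 b3 = contour_integral \<gamma> g"
  proof (rule contour_integral_eq)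
    fix x assume x: "x \<in> path_image \<gamma>"
    note nzx = path_zeros[OF sep x, simplified]
    show "theta_prod b1 b2 b3 x * kernel a1 a2 a3 b1 b2 b3 x = g x"
      using nzx by (simp add: theta_prod_def theta_def kernel_def g_def mult_ac)
  qed
  also have "\<dots> = 0"
  proof (rule contour_integral_unique, rule Cauchy_theorem_global)
    have "open ((\<lambda>x. P (a1 * x) * P (a2 * x) * P (a3 * x)) -` (- {0}))"
      by (intro open_vimage continuous_intros open_Compl closed_singleton)
    moreover have "(\<lambda>x. P (a1 * x) * P (a2 * x) * P (a3 * x)) -` (- {0}) = - zeros_out {a1,a2,a3}"
      by (auto simp: zeros_out_def)
    ultimately show "open (- zeros_out {a1,a2,a3})" by simp
    show "g holomorphic_on - zeros_out {a1,a2,a3}"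
      unfolding g_def using b0 by (intro holomorphic_intros) (auto simp: zeros_out_def)
  qed (use sep in \<open>auto simp: separating_contour_def\<close>)
  finally show ?thesis .
qed

text \<open>Here a_j and b_j are the parameters of the kernel, while \<phi> is any theta function
  with the right multiplier; later it is a sum built from other parameters. Subtracting a multiple
  of \<open>theta_prod\<close> makes \<phi> vanish at 1/a2 without changing the integral. The
  quotient by theta(a2 x), evaluated at 1/a3, is then the alternant divided by theta(a2/a3) and
  \<open>theta_prod\<close> at 1/a2.\<close>

lemma kernel_integral:
  assumes sep: "separates {b1,b2,b3} {a1,a2,a3} \<gamma>"
    and a: "a1 * a2 * a3 = s" and b: "b1 * b2 * b3 = s"
    and \<phi>: "\<phi> holomorphic_on - {0}" and \<phi>q: "\<And>x. x \<noteq> 0 \<Longrightarrow> \<phi> (q * x) = - \<phi> x / (s^3 * x^3)"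
    and B0: "theta_prod b1 b2 b3 (1 / a2) \<noteq> 0"
  shows "pairing \<gamma> \<phi> a1 a2 a3 b1 b2 b3 *
      (Pm3 b1 b2 b3 a1 * Pm3 b1 b2 b3 a3) *
      (P q * theta (a2 / a3) * theta_prod b1 b2 b3 (1 / a2)) =
    2 * of_real pi * \<i> * alternant b1 b2 b3 (1/a3) (1/a2) \<phi> * Pq3 a2 b1 b2 b3"
proof -
  have nz: "a1 \<noteq> 0" "a2 \<noteq> 0" "a3 \<noteq> 0" using a s0 by auto
  have b0: "b1 \<noteq> 0" "b2 \<noteq> 0" "b3 \<noteq> 0" using b s0 by auto
  define k where "k = \<phi> (1 / a2) / theta_prod b1 b2 b3 (1 / a2)"
  define \<phi>' where "\<phi>' = (\<lambda>x. \<phi> x - k * theta_prod b1 b2 b3 x)"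
  have \<phi>'h: "\<phi>' holomorphic_on - {0}" unfolding \<phi>'_def by (intro holomorphic_intros \<phi> theta_prod_holomorphic b0)
  have \<phi>'q: "\<phi>' (q * x) = - \<phi>' x / (s^3 * x^3)" if "x \<noteq> 0" for x
    unfolding \<phi>'_def \<phi>q[OF that] theta_prod_mult_q[OF b that] by (simp add: diff_divide_distrib)
  have "\<phi>' (1 / a2) = 0" using B0 by (simp add: \<phi>'_def k_def)
  then obtain \<psi> where \<psi>: "\<psi> holomorphic_on - {0}" "\<And>x. x \<noteq> 0 \<Longrightarrow> \<phi>' x = \<psi> x * theta (a2 * x)"
    "\<And>x. x \<noteq> 0 \<Longrightarrow> \<psi> (q * x) = a2 * \<psi> x / (s^3 * x^2)"
    using divide_by_theta[OF \<phi>'h \<phi>'q nz(2)] by blast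
  have sep': "separates {b1,b2,b3} {a1,a3} \<gamma>"
    by (rule separating_contour_mono[OF sep]) (auto simp: zeros_out_def)
  define D where "D = regular {b1,b2,b3} {a1,a2,a3}"
  have D: "open D" "path_image \<gamma> \<subseteq> D" "D \<subseteq> - {0}" "valid_path \<gamma>"
    using sep unfolding D_def separating_contour_def
    by (simp_all only: open_Compl closed_zeros finite.intros) auto
  have Fh: "kernel a1 a2 a3 b1 b2 b3 holomorphic_on D" unfolding D_def by (rule kernel_holomorphic)
  have int: "(\<lambda>x. f x * kernel a1 a2 a3 b1 b2 b3 x) contour_integrable_on \<gamma>" if "f holomorphic_on - {0}" for f
    by (rule contour_integrable_holomorphic_simple[OF _ D(1) D(4) D(2)])
       (intro holomorphic_intros Fh holomorphic_on_subset[OF that D(3)])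
  have "pairing \<gamma> \<phi> a1 a2 a3 b1 b2 b3 = pairing \<gamma> \<phi>' a1 a2 a3 b1 b2 b3"
  proof -
    have "pairing \<gamma> \<phi>' a1 a2 a3 b1 b2 b3 =
      contour_integral \<gamma> (\<lambda>x. \<phi> x * kernel a1 a2 a3 b1 b2 b3 x - k * (theta_prod b1 b2 b3 x * kernel a1 a2 a3 b1 b2 b3 x))"
      by (simp add: \<phi>'_def algebra_simps)
    also have "\<dots> = pairing \<gamma> \<phi> a1 a2 a3 b1 b2 b3 -
       contour_integral \<gamma> (\<lambda>x. k * (theta_prod b1 b2 b3 x * kernel a1 a2 a3 b1 b2 b3 x))"
      by (intro contour_integral_diff contour_integrable_lmul int \<phi> theta_prod_holomorphic b0)
    also have "contour_integral \<gamma> (\<lambda>x. k * (theta_prod b1 b2 b3 x * kernel a1 a2 a3 b1 b2 b3 x)) = 0"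
      by (simp add: contour_integral_lmul[OF int[OF theta_prod_holomorphic[OF b0]]] kernel_theta_prod_integral[OF sep b0])
    finally show ?thesis by simp
  qed
  also have "\<dots> = contour_integral \<gamma> (\<lambda>x. \<psi> x * P (q / (a2 * x)) /
            (P (a1 * x) * P (a3 * x) * Pd3 b1 b2 b3 x) / x)"
  proof (rule contour_integral_eq)
    fix x assume x: "x \<in> path_image \<gamma>"
    note nzx = path_zeros[OF sep x, simplified]
    show "\<phi>' x * kernel a1 a2 a3 b1 b2 b3 x = \<psi> x * P (q / (a2 * x)) /
            (P (a1 * x) * P (a3 * x) * Pd3 b1 b2 b3 x) / x"
      using nzx by (simp add: \<psi>(2) theta_def kernel_def mult_ac)
  qed
  finally have eq: "pairing \<gamma> \<phi> a1 a2 a3 b1 b2 b3 = \<dots>" .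
  have v: "pairing \<gamma> \<phi> a1 a2 a3 b1 b2 b3 *
      Pm3 b1 b2 b3 a1 * (P q * Pm3 b1 b2 b3 a3) =
    2 * of_real pi * \<i> * \<psi> (1 / a3) * Pq3 a2 b1 b2 b3"
    unfolding eq by (rule saalschuetz_integral[OF sep' \<psi>(1) \<psi>(3) a b])
  have lam: "\<psi> (1 / a3) * theta (a2 / a3) * theta_prod b1 b2 b3 (1 / a2) = alternant b1 b2 b3 (1/a3) (1/a2) \<phi>"
    using \<psi>(2)[of "1 / a3"] nz B0 by (simp add: \<phi>'_def k_def alternant_def field_simps)
  show ?thesis unfolding lam[symmetric]
    using arg_cong[OF v, of "\<lambda>w. w * (theta (a2 / a3) * theta_prod b1 b2 b3 (1 / a2))"]
    by (simp only: mult_ac)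
qed

section \<open>Integer shifts of the parameters\<close>

lemma quasi_powi:
  fixes \<phi> :: "complex \<Rightarrow> complex" and k :: int and d e :: nat
  assumes \<phi>q: "\<And>x. x \<noteq> 0 \<Longrightarrow> \<phi> (q * x) = - \<phi> x / (s ^ e * x ^ d)" and x: "x \<noteq> 0"
  shows "\<phi> (q powi k * x) =
    (-1) powi k * s powi (- (int e * k + int d * (k * (k - 1)))) * x powi (- (int d * k)) * \<phi> x"
proof -
  \<comment> \<open>The sum of e + 2 j d over 0 \<le> j < k, as (q^j x)^d contributes s^(2 j d); the
    closed form also covers negative k.\<close>
  define E where "E = (\<lambda>k::int. int e * k + int d * (k * (k - 1)))"
  have E1: "E (k + 1) = E k + (int e + 2 * k * int d)" for k by (simp add: E_def algebra_simps)
  have pw: "(q powi k * x) ^ d = s powi (2 * k * int d) * x ^ d" for k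
    by (simp add: power_mult_distrib q_powi power_int_mult)
  have den: "s ^ e * (q powi k * x) ^ d = s powi (int e + 2 * k * int d) * x ^ d" for k
    unfolding pw using s0 by (simp add: power_int_add)
  have step: "\<phi> (q powi (k + 1) * x) = - \<phi> (q powi k * x) / (s powi (int e + 2 * k * int d) * x ^ d)" for k
  proof -
    have "q powi (k + 1) * x = q * (q powi k * x)" using q0 by (simp add: power_int_add)
    then show ?thesis using \<phi>q[of "q powi k * x"] x q0 by (simp only: den) simp
  qed
  define c where "c = (\<lambda>k. (-1) powi k * s powi (- E k) * x powi (- (int d * k)))"
  have c1: "c (k + 1) = - c k / (s powi (int e + 2 * k * int d) * x ^ d)" for k
  proof -
    have "s powi (- E (k + 1)) = s powi (- E k) / s powi (int e + 2 * k * int d)"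
    proof -
      have "s powi (- (u + v)) = s powi (- u) / s powi v" for u v
        using power_int_add[of s "- u" "- v"] s0 by (simp add: power_int_minus divide_inverse)
      then show ?thesis unfolding E1 .
    qed
    moreover have "x powi (- (int d * (k + 1))) = x powi (- (int d * k)) / x ^ d"
      using power_int_add[of x "- (int d * k)" "- int d"] x
      by (simp add: distrib_left power_int_minus divide_inverse)
    moreover have "(-1 :: complex) powi (k + 1) = - ((-1) powi k)" by (simp add: power_int_add)
    ultimately show ?thesis by (simp add: c_def)
  qed
  have "\<phi> (q powi k * x) = c k * \<phi> x"
  proof (induction k rule: int_induct[where k = 0])
    case base
    then show ?case by (simp add: c_def E_def)
  next
    case (step1 i)
    then show ?case unfolding step c1 by simp
  next
    case (step2 i)
    have "\<phi> (q powi i * x) = - \<phi> (q powi (i - 1) * x) / (s powi (int e + 2 * (i - 1) * int d) * x ^ d)"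
      using step[of "i - 1"] by simp
    moreover have "c i = - c (i - 1) / (s powi (int e + 2 * (i - 1) * int d) * x ^ d)"
      using c1[of "i - 1"] by simp
    ultimately show ?case using step2 s0 x by auto
  qed
  then show ?thesis by (simp add: c_def E_def)
qed

lemma theta_powi:
  "x \<noteq> 0 \<Longrightarrow> theta (q powi k * x) = (-1) powi k * s powi (- (k * (k - 1))) * x powi (- k) * theta x"
  using quasi_powi[of theta 0 1 x k] theta_mult_q by simp

text \<open>The signs and powers of x produced by the three shifts cancel because N1 + N2 + N3 = 0.
  The value of the constant is left open, as it enters both sides of the final identity and
  cancels.\<close>

lemma theta_prod_powi:
  assumes b: "b1 \<noteq> 0" "b2 \<noteq> 0" "b3 \<noteq> 0" and N: "N1 + N2 + N3 = 0"
  obtains \<nu> where "\<nu> \<noteq> 0"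
    "\<And>x. x \<noteq> 0 \<Longrightarrow> theta_prod (q powi N1 * b1) (q powi N2 * b2) (q powi N3 * b3) x = \<nu> * theta_prod b1 b2 b3 x"
proof
  define \<tau> where "\<tau> = (\<lambda>k b. s powi (- (k * (k - 1))) * b powi (- k))"
  show "\<tau> N1 b1 * \<tau> N2 b2 * \<tau> N3 b3 \<noteq> 0" using b s0 by (simp add: \<tau>_def)
  fix x :: complex assume x: "x \<noteq> 0"
  have t: "theta (q powi k * b / x) = (-1) powi k * \<tau> k b * x powi k * theta (b / x)" if "b \<noteq> 0" for k b
  proof -
    have "(b / x) powi (- k) = b powi (- k) * x powi k"
      by (simp add: power_int_divide_distrib power_int_minus field_simps)
    then show ?thesis using theta_powi[of "b / x" k] that x by (simp add: \<tau>_def)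
  qed
  have "x powi N1 * x powi N2 * x powi N3 = x powi (N1 + N2 + N3)" using x by (simp add: power_int_add)
  moreover have "(-1 :: complex) powi N1 * (-1) powi N2 * (-1) powi N3 = (-1) powi (N1 + N2 + N3)" by (simp add: power_int_add)
  ultimately have 1: "(x powi N1 * x powi N2 * x powi N3) * ((-1) powi N1 * (-1) powi N2 * (-1) powi N3) = 1" by (simp add: N)
  have "theta_prod (q powi N1 * b1) (q powi N2 * b2) (q powi N3 * b3) x =
     ((x powi N1 * x powi N2 * x powi N3) * ((-1) powi N1 * (-1) powi N2 * (-1) powi N3)) *
     (\<tau> N1 b1 * \<tau> N2 b2 * \<tau> N3 b3) * theta_prod b1 b2 b3 x"
    unfolding theta_prod_def t[OF b(1)] t[OF b(2)] t[OF b(3)] by (simp only: mult_ac)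
  then show "theta_prod (q powi N1 * b1) (q powi N2 * b2) (q powi N3 * b3) x = \<tau> N1 b1 * \<tau> N2 b2 * \<tau> N3 b3 * theta_prod b1 b2 b3 x"
    unfolding 1 by simp
qed

text \<open>The part of the denominator on the right-hand side that belongs to one of the two
  parameter triples; s^(M (M - 1)) is q^(binom(M,2)).\<close>

definition prefactor where
  "prefactor a1 a2 a3 M1 M2 M3 = s powi (M1 * (M1 - 1) + M2 * (M2 - 1) + M3 * (M3 - 1)) * (a1 powi M1 * a2 powi M2 * a3 powi M3)"

text \<open>Writing all bases except $-1$ as exponentials turns this into an identity of exponents.\<close>

lemma prefactor_identity:
  assumes a: "a1 * a2 * a3 = s" and b: "b1 * b2 * b3 = s"
    and M: "M1 + M2 + M3 = 0" and N: "N1 + N2 + N3 = 0"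
  defines "\<tau> \<equiv> \<lambda>k x. (-1) powi k * s powi (- (k * (k - 1))) * x powi (- k)"
  shows "prefactor a1 a2 a3 M1 M2 M3 * prefactor b1 b2 b3 N1 N2 N3 *
     ((-1) powi (- M3) * s powi (- (3 * (M3 * M3))) * (1 / a3) powi (3 * M3)) *
     (\<tau> (M2 + N1) (b1 * a2) * \<tau> (M2 + N2) (b2 * a2) * \<tau> (M2 + N3) (b3 * a2)) = \<tau> (M2 - M3) (a2 / a3)"
proof -
  have nz: "a1 \<noteq> 0" "a2 \<noteq> 0" "a3 \<noteq> 0" "b1 \<noteq> 0" "b2 \<noteq> 0" "b3 \<noteq> 0" using a b s0 by auto
  obtain S where S: "s = exp S" using s0 by (metis exp_Ln)
  obtain l2 where l2: "a2 = exp l2" using nz by (metis exp_Ln)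
  obtain l3 where l3: "a3 = exp l3" using nz by (metis exp_Ln)
  obtain k1 where k1: "b1 = exp k1" using nz by (metis exp_Ln)
  obtain k2 where k2: "b2 = exp k2" using nz by (metis exp_Ln)
  \<comment> \<open>The exponents of a1 and b3 are those forced by the balancing conditions, so the
    logarithms add up exactly and no multiple of 2 pi i appears.\<close>
  have a1: "a1 = exp (S - l2 - l3)" using a nz unfolding S l2 l3 by (simp add: exp_diff exp_add field_simps)
  have b3: "b3 = exp (S - k1 - k2)" using b nz unfolding S k1 k2 by (simp add: exp_diff exp_add field_simps)
  have M1: "M1 = - M2 - M3" using M by simp
  have N3: "N3 = - N1 - N2" using N by simp
  define \<epsilon> where "\<epsilon> = (\<lambda>k::int. (-1 :: complex) powi k)"
  have \<epsilon>: "\<epsilon> (- M3) * (\<epsilon> (M2 + N1) * \<epsilon> (M2 + N2) * \<epsilon> (M2 + N3)) = \<epsilon> (M2 - M3)"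
  proof -
    have "\<epsilon> (- M3) * (\<epsilon> (M2 + N1) * \<epsilon> (M2 + N2) * \<epsilon> (M2 + N3)) = \<epsilon> (2 * M2 + (M2 - M3))"
      unfolding \<epsilon>_def N3 by (simp flip: power_int_add)
    also have "\<dots> = \<epsilon> (2 * M2) * \<epsilon> (M2 - M3)" unfolding \<epsilon>_def by (rule power_int_add) simp
    also have "\<epsilon> (2 * M2) = 1" unfolding \<epsilon>_def by (simp add: power_int_mult)
    finally show ?thesis by simp
  qed
  define \<rho> where "\<rho> = (\<lambda>(k::int) x. s powi (- (k * (k - 1))) * x powi (- k))"
  have \<tau>: "\<tau> k x = \<epsilon> k * \<rho> k x" for k x by (simp add: \<tau>_def \<epsilon>_def \<rho>_def)
  have "prefactor a1 a2 a3 M1 M2 M3 * prefactor b1 b2 b3 N1 N2 N3 * (s powi (- (3 * (M3 * M3))) * (1 / a3) powi (3 * M3)) *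
     (\<rho> (M2 + N1) (b1 * a2) * \<rho> (M2 + N2) (b2 * a2) * \<rho> (M2 + N3) (b3 * a2)) = \<rho> (M2 - M3) (a2 / a3)"
    unfolding \<rho>_def prefactor_def a1 b3 M1 N3 unfolding S l2 l3 k1 k2
    by (simp add: exp_power_int exp_minus[symmetric] inverse_eq_divide[symmetric] flip: exp_add exp_diff)
       (simp add: algebra_simps)
  then show ?thesis unfolding \<tau> \<epsilon>[symmetric] by (simp only: \<epsilon>_def[symmetric] mult_ac)
qed

text \<open>\<open>lat_sum\<close> has the unshifted parameters, the kernel the shifted ones. As the
  shifts add up to 0, the shifted triples are still balanced and \<open>kernel_integral\<close>
  applies to them; the resulting alternant is carried back to the unshifted parameters, where
  \<open>alternant_value\<close> applies. The hypotheses \<open>th0\<close> allow division by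
  theta(a2/a3) and by \<open>theta_prod\<close> at 1/a2.\<close>

lemma generic_value:
  assumes a: "a1 * a2 * a3 = s" and b: "b1 * b2 * b3 = s"
    and M: "M1 + M2 + M3 = 0" and N: "N1 + N2 + N3 = 0"
  defines "A1 \<equiv> q powi M1 * a1" and "A2 \<equiv> q powi M2 * a2" and "A3 \<equiv> q powi M3 * a3"
    and "B1 \<equiv> q powi N1 * b1" and "B2 \<equiv> q powi N2 * b2" and "B3 \<equiv> q powi N3 * b3"
  assumes sep: "separates {B1,B2,B3} {A1,A2,A3} \<gamma>"
    and th0: "theta (a2 / a3) \<noteq> 0" "theta (b1 * a2) \<noteq> 0" "theta (b2 * a2) \<noteq> 0" "theta (b3 * a2) \<noteq> 0"
  shows "pairing \<gamma> (lat_sum a1 a2 a3 b1 b2 b3) A1 A2 A3 B1 B2 B3 *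
      (prefactor a1 a2 a3 M1 M2 M3 * prefactor b1 b2 b3 N1 N2 N3) *
      Pm9 A1 A2 A3 B1 B2 B3 =
    2 * of_real pi * \<i> *
      Pq9 a1 a2 a3 b1 b2 b3"
proof -
  have nz: "a1 \<noteq> 0" "a2 \<noteq> 0" "a3 \<noteq> 0" "b1 \<noteq> 0" "b2 \<noteq> 0" "b3 \<noteq> 0" using a b s0 by auto
  have Anz: "A1 \<noteq> 0" "A2 \<noteq> 0" "A3 \<noteq> 0" "B1 \<noteq> 0" "B2 \<noteq> 0" "B3 \<noteq> 0"
    using nz q0 by (auto simp: A1_def A2_def A3_def B1_def B2_def B3_def)
  have "A1 * A2 * A3 = q powi (M1 + M2 + M3) * (a1 * a2 * a3)"
    using q0 by (simp add: A1_def A2_def A3_def power_int_add)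
  then have A: "A1 * A2 * A3 = s" by (simp add: M a)
  have "B1 * B2 * B3 = q powi (N1 + N2 + N3) * (b1 * b2 * b3)"
    using q0 by (simp add: B1_def B2_def B3_def power_int_add)
  then have B: "B1 * B2 * B3 = s" by (simp add: N b)
  define I where "I = pairing \<gamma> (lat_sum a1 a2 a3 b1 b2 b3) A1 A2 A3 B1 B2 B3"
  define h where "h = lat_sum a1 a2 a3 b1 b2 b3"
  obtain \<nu> where \<nu>: "\<nu> \<noteq> 0" "\<And>x. x \<noteq> 0 \<Longrightarrow> theta_prod B1 B2 B3 x = \<nu> * theta_prod b1 b2 b3 x"
    using theta_prod_powi[OF nz(4-6) N] unfolding B1_def B2_def B3_def by blast
  define \<sigma> where "\<sigma> = (\<lambda>k x. (-1) powi k * s powi (- (3 * (k * k))) * x powi (- (3 * k)))"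
  have \<sigma>0: "x \<noteq> 0 \<Longrightarrow> \<sigma> k x \<noteq> 0" for k x using s0 by (simp add: \<sigma>_def)
  have V: "\<phi> (q powi k * x) = \<sigma> k x * \<phi> x"
    if "\<And>x. x \<noteq> 0 \<Longrightarrow> \<phi> (q * x) = - \<phi> x / (s ^ 3 * x ^ 3)" "x \<noteq> 0" for \<phi> k x
  proof -
    have "- (3 * k) - 3 * (k * (k - 1)) = - (3 * (k * k))" by (simp add: algebra_simps)
    then show ?thesis using quasi_powi[of \<phi> 3 3, OF that] by (simp add: \<sigma>_def)
  qed
  have inv: "1 / A2 = q powi (- M2) * (1 / a2)" "1 / A3 = q powi (- M3) * (1 / a3)"
    by (simp_all add: A2_def A3_def power_int_minus divide_inverse)
  have hV: "h (q powi k * x) = \<sigma> k x * h x" if "x \<noteq> 0" for k x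
    unfolding h_def by (rule V[OF lat_sum_mult_q that])
  have BV: "theta_prod b1 b2 b3 (q powi k * x) = \<sigma> k x * theta_prod b1 b2 b3 x" if "x \<noteq> 0" for k x
    by (rule V[OF theta_prod_mult_q[OF b] that])
  define s2' s3' where "s2' = \<sigma> (- M2) (1 / a2)" and "s3' = \<sigma> (- M3) (1 / a3)"
  have s0': "s2' \<noteq> 0" "s3' \<noteq> 0" unfolding s2'_def s3'_def using nz by (auto intro!: \<sigma>0)
  have Bf2: "theta_prod B1 B2 B3 (1 / A2) = \<nu> * s2' * theta_prod b1 b2 b3 (1 / a2)"
    and Bf3: "theta_prod B1 B2 B3 (1 / A3) = \<nu> * s3' * theta_prod b1 b2 b3 (1 / a3)"
    using \<nu>(2)[of "1 / A2"] \<nu>(2)[of "1 / A3"] Anz BV[of "1 / a2" "- M2"] BV[of "1 / a3" "- M3"] nz q0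
    by (simp_all add: inv s2'_def s3'_def)
  have h2: "h (1 / A2) = s2' * h (1 / a2)" and h3: "h (1 / A3) = s3' * h (1 / a3)"
    using hV[of "1 / a2" "- M2"] hV[of "1 / a3" "- M3"] nz by (simp_all add: inv s2'_def s3'_def)
  define L where "L = alternant b1 b2 b3 (1 / a3) (1 / a2) h"
  have alternant: "alternant B1 B2 B3 (1 / A3) (1 / A2) h = \<nu> * s2' * s3' * L"
    unfolding alternant_def L_def Bf2 Bf3 h2 h3 by (simp add: algebra_simps)
  have bf0: "theta_prod b1 b2 b3 (1 / a2) \<noteq> 0" using th0 nz by (simp add: theta_prod_def)
  then have "theta_prod B1 B2 B3 (1 / A2) \<noteq> 0" using \<nu> s0' by (simp add: Bf2)
  note E1 = kernel_integral[OF sep A B lat_sum_holomorphic[OF a b] lat_sum_mult_q this,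
      folded I_def h_def, unfolded alternant Bf2]
  define \<tau> where "\<tau> = (\<lambda>k x. (-1) powi k * s powi (- (k * (k - 1))) * x powi (- k))"
  have \<tau>0: "x \<noteq> 0 \<Longrightarrow> \<tau> k x \<noteq> 0" for k x using s0 by (simp add: \<tau>_def)
  have theta\<tau>: "theta (q powi k * x) = \<tau> k x * theta x" if "x \<noteq> 0" for k x
    using theta_powi[OF that] by (simp add: \<tau>_def)
  have thA: "theta (A2 / A3) = \<tau> (M2 - M3) (a2 / a3) * theta (a2 / a3)"
    using theta\<tau>[of "a2 / a3" "M2 - M3"] nz q0 by (simp add: A2_def A3_def power_int_diff)
  have thAB: "P (q powi n * bb * A2) * P (q / (A2 * (q powi n * bb))) = \<tau> (M2 + n) (bb * a2) * (P (bb * a2) * P (q / (a2 * bb)))"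
    if "bb \<noteq> 0" for n bb
  proof -
    have "P (q powi n * bb * A2) * P (q / (A2 * (q powi n * bb))) = theta (q powi (M2 + n) * (bb * a2))"
      using q0 by (simp add: theta_def A2_def power_int_add mult_ac)
    also have "\<dots> = \<tau> (M2 + n) (bb * a2) * theta (bb * a2)" using that nz by (simp add: theta\<tau>)
    finally show ?thesis by (simp add: theta_def mult.commute)
  qed
  define t1 where "t1 = \<tau> (M2 + N1) (b1 * a2)"
  define t2 where "t2 = \<tau> (M2 + N2) (b2 * a2)"
  define t3 where "t3 = \<tau> (M2 + N3) (b3 * a2)"
  define t0 where "t0 = \<tau> (M2 - M3) (a2 / a3)"
  have t00: "t0 \<noteq> 0" unfolding t0_def using nz by (intro \<tau>0) simp
  have K: "prefactor a1 a2 a3 M1 M2 M3 * prefactor b1 b2 b3 N1 N2 N3 * s3' * (t1 * t2 * t3) = t0"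
    using prefactor_identity[OF a b M N] unfolding s3'_def \<sigma>_def t1_def t2_def t3_def t0_def \<tau>_def by simp
  define p2 where "p2 = P (b1 * a2) * P (b2 * a2) * P (b3 * a2)"
  define Q1 where "Q1 = P (q / (a1 * b1)) * P (q / (a1 * b2)) * P (q / (a1 * b3))"
  define Q2 where "Q2 = P (q / (a2 * b1)) * P (q / (a2 * b2)) * P (q / (a2 * b3))"
  define Q3 where "Q3 = P (q / (a3 * b1)) * P (q / (a3 * b2)) * P (q / (a3 * b3))"
  define R2 where "R2 = P (q / (A2 * B1)) * P (q / (A2 * B2)) * P (q / (A2 * B3))"
  define G1 where "G1 = P (B1 * A1) * P (B2 * A1) * P (B3 * A1)"
  define G2 where "G2 = P (B1 * A2) * P (B2 * A2) * P (B3 * A2)"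
  define G3 where "G3 = P (B1 * A3) * P (B2 * A3) * P (B3 * A3)"
  \<comment> \<open>The Saalschuetz value contributes \<open>R2\<close> with shifted parameters, the
    alternant a denominator \<open>p2\<close> with unshifted ones. Each pair P(B A) P(q/(A B)) is a
    theta value, so multiplying by \<open>G2\<close> trades \<open>R2\<close> for
    \<open>p2 * Q2\<close> up to elementary factors.\<close>
  have GR: "G2 * R2 = (t1 * t2 * t3) * (p2 * Q2)"
  proof -
    have "G2 * R2 = (P (B1 * A2) * P (q / (A2 * B1))) * (P (B2 * A2) * P (q / (A2 * B2))) * (P (B3 * A2) * P (q / (A2 * B3)))"
      by (simp add: G2_def R2_def mult_ac)
    also have "\<dots> = (t1 * (P (b1 * a2) * P (q / (a2 * b1)))) * (t2 * (P (b2 * a2) * P (q / (a2 * b2)))) * (t3 * (P (b3 * a2) * P (q / (a2 * b3))))"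
      unfolding B1_def B2_def B3_def thAB[OF nz(4)] thAB[OF nz(5)] thAB[OF nz(6)] t1_def t2_def t3_def ..
    finally show ?thesis by (simp add: p2_def Q2_def mult_ac)
  qed
  have Lv: "L * p2 = theta (a2 / a3) * P q * Q3 * Q1 * theta_prod b1 b2 b3 (1 / a2)"
  proof -
    have "h (1 / a3) = suminf (half_term a1 a2 a3 b1 b2 b3 (1 / a3))" "h (1 / a2) = suminf (half_term a1 a2 a3 b1 b2 b3 (1 / a2))"
      unfolding h_def using nz by (intro lat_sum_eq_suminf a b; simp)+
    then have "L = alternant b1 b2 b3 (1/a3) (1/a2) (\<lambda>x. suminf (half_term a1 a2 a3 b1 b2 b3 x))"
      by (simp add: L_def alternant_def)
    then show ?thesis using alternant_value[OF a b] by (simp add: p2_def Q1_def Q3_def)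
  qed
  define bf where "bf = theta_prod b1 b2 b3 (1 / a2)"
  define w where "w = P q * theta (a2 / a3) * (\<nu> * s2' * bf)"
  have w0: "w \<noteq> 0" using th0 \<nu> s0' bf0 by (simp add: w_def bf_def)
  have E1': "I * (G1 * G3) * (P q * (t0 * theta (a2 / a3)) * (\<nu> * s2' * bf)) = 2 * of_real pi * \<i> * (\<nu> * s2' * s3' * L) * R2"
    using E1 unfolding thA G1_def G3_def R2_def bf_def t0_def .
  have "w * (I * (G1 * G2 * G3) * t0) = G2 * (I * (G1 * G3) * (P q * (t0 * theta (a2 / a3)) * (\<nu> * s2' * bf)))"
    by (simp add: w_def mult_ac)
  also have "\<dots> = 2 * of_real pi * \<i> * (\<nu> * s2' * s3' * L) * (G2 * R2)"
    unfolding E1' by (simp add: mult_ac)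
  also have "\<dots> = 2 * of_real pi * \<i> * (\<nu> * s2' * s3' * (t1 * t2 * t3)) * Q2 * (L * p2)"
    unfolding GR by (simp add: mult_ac)
  also have "\<dots> = w * (2 * of_real pi * \<i> * (s3' * (t1 * t2 * t3)) * (Q1 * Q2 * Q3))"
    unfolding Lv by (simp add: w_def bf_def mult_ac)
  finally have E2: "I * (G1 * G2 * G3) * t0 = 2 * of_real pi * \<i> * (s3' * (t1 * t2 * t3)) * (Q1 * Q2 * Q3)"
    using w0 by simp
  have "t0 * (I * (prefactor a1 a2 a3 M1 M2 M3 * prefactor b1 b2 b3 N1 N2 N3) * (G1 * G2 * G3)) =
     prefactor a1 a2 a3 M1 M2 M3 * prefactor b1 b2 b3 N1 N2 N3 * (I * (G1 * G2 * G3) * t0)"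
    by (simp add: mult_ac)
  also have "\<dots> = (prefactor a1 a2 a3 M1 M2 M3 * prefactor b1 b2 b3 N1 N2 N3 * s3' * (t1 * t2 * t3)) * (2 * of_real pi * \<i> * (Q1 * Q2 * Q3))"
    unfolding E2 by (simp add: mult_ac)
  finally have "I * (prefactor a1 a2 a3 M1 M2 M3 * prefactor b1 b2 b3 N1 N2 N3) * (G1 * G2 * G3) = 2 * of_real pi * \<i> * (Q1 * Q2 * Q3)"
    unfolding K using t00 by simp
  then show ?thesis unfolding I_def G1_def G2_def G3_def Q1_def Q2_def Q3_def .
qed

end

subsection \<open>Removing the genericity assumptions\<close>

text \<open>Continuity on a compact product is uniform (Heine-Cantor), which gives convergence
  uniformly in x as w -> 0.\<close>

lemma uniform_limit_at_0_if_continuous: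
  fixes g :: "complex \<Rightarrow> complex \<Rightarrow> complex"
  assumes K: "compact K" and c: "continuous_on (cball 0 1 \<times> K) (\<lambda>y. g (fst y) (snd y))"
  shows "uniform_limit K g (g 0) (at 0)"
proof (rule uniform_limitI)
  fix e :: real assume e: "e > 0"
  have "uniformly_continuous_on (cball 0 1 \<times> K) (\<lambda>y. g (fst y) (snd y))"
    by (intro compact_uniformly_continuous c compact_Times K compact_cball)
  then obtain d where d: "d > 0"
    "\<And>y y'. y \<in> cball 0 1 \<times> K \<Longrightarrow> y' \<in> cball 0 1 \<times> K \<Longrightarrow> dist y' y < d \<Longrightarrow>
      dist (g (fst y') (snd y')) (g (fst y) (snd y)) < e"
    using e unfolding uniformly_continuous_on_def by meson
  show "\<forall>\<^sub>F w in at 0. \<forall>x\<in>K. dist (g w x) (g 0 x) < e"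
    unfolding eventually_at
  proof (intro exI[of _ "min d 1"] conjI ballI impI)
    fix w :: complex and x assume w: "w \<noteq> 0 \<and> dist w 0 < min d 1" and x: "x \<in> K"
    show "dist (g w x) (g 0 x) < e"
      using d(2)[of "(0, x)" "(w, x)"] w x by (auto simp: dist_Pair_Pair)
  qed (use d in auto)
qed

context qpoch_sqrt
begin

section \<open>Nearby generic parameters with the same contour\<close>

lemma P_s_ne_0: "P s \<noteq> 0"
proof
  assume "P s = 0"
  then obtain k where "s * q ^ k = 1" by (auto simp: P_eq_0_iff)
  then have "norm s * norm q ^ k = 1" by (metis norm_mult norm_one norm_power)
  moreover have "norm s ^ 2 < 1" using q1 by (simp add: norm_power[symmetric] s2)
  then have "norm s < 1" by (simp add: abs_square_less_1)
  moreover have "norm s * norm q ^ k \<le> norm s * 1"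
    using q1 by (intro mult_left_mono power_le_one) auto
  ultimately show False by simp
qed

text \<open>An entire function of w that takes the value theta(s) = P(s)^2 somewhere is not
  identically zero, so its zeros are isolated. The point s is convenient because q/s = s.\<close>

lemma eventually_theta_ne_0:
  assumes c: "c \<noteq> 0" and k: "k \<noteq> 0"
  shows "\<forall>\<^sub>F w in at 0. theta (c * exp (k * w)) \<noteq> 0"
proof -
  define \<beta> where "\<beta> = Ln (s / c) / k"
  have "(\<lambda>w. theta (c * exp (k * w))) holomorphic_on UNIV"
    unfolding theta_def by (intro holomorphic_intros) (use c in auto)
  moreover have "c * exp (k * \<beta>) = s" using c k s0 by (simp add: \<beta>_def)
  moreover have "theta s \<noteq> 0"
  proof -
    have "q / s = s" using s0 by (simp add: s2[symmetric] power2_eq_square)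
    then show ?thesis using P_s_ne_0 by (simp add: theta_def)
  qed
  ultimately show ?thesis
    using non_zero_neighbour_alt[of "\<lambda>w. theta (c * exp (k * w))" UNIV 0 \<beta>] by (simp add: connected_UNIV)
qed

text \<open>Infinitely many poles move with w. All but finitely many stay beyond a radius outside
  which the winding number is 0, uniformly in w since |g w| < 2; the others are controlled one by
  one, as the points off the path with winding number 0 form an open set.\<close>

lemma eventually_zeros_outside:
  fixes A :: complex
  assumes sep: "separates B S \<gamma>" and A: "A \<in> S" "A \<noteq> 0" and g: "(g \<longlongrightarrow> 1) F"
  shows "\<forall>\<^sub>F w in F. \<forall>x. P (A * g w * x) = 0 \<longrightarrow> x \<notin> path_image \<gamma> \<and> winding_number \<gamma> x = 0"
proof -
  have \<gamma>: "path \<gamma>" "pathfinish \<gamma> = pathstart \<gamma>"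
    using sep by (simp_all add: separating_contour_def valid_path_imp_path)
  define U where "U = {x. x \<notin> path_image \<gamma> \<and> winding_number \<gamma> x = 0}"
  have opU: "open U" unfolding U_def by (rule open_winding_number_levelsets[OF \<gamma>])
  obtain R1 where R1: "\<And>z. R1 \<le> norm z \<Longrightarrow> winding_number \<gamma> z = 0"
    using winding_number_zero_at_infinity[OF \<gamma>] by blast
  obtain R2 where R2: "\<And>z. z \<in> path_image \<gamma> \<Longrightarrow> norm z \<le> R2"
    using bounded_path_image[OF \<gamma>(1)] by (auto simp: bounded_iff)
  define R where "R = max 1 (max R1 (R2 + 1))"
  have R: "R > 0" "\<And>z. R \<le> norm z \<Longrightarrow> z \<in> U" using R1 R2 by (force simp: R_def U_def)+
  have "(\<lambda>k. norm q ^ k) \<longlonglongrightarrow> 0" using q1 by (intro LIMSEQ_power_zero) simp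
  then have "\<forall>\<^sub>F k in sequentially. norm q ^ k < 1 / (2 * norm A * R)"
    using A R by (intro order_tendstoD(2)) auto
  then obtain k0 where k0: "\<And>k. k \<ge> k0 \<Longrightarrow> norm q ^ k < 1 / (2 * norm A * R)"
    by (auto simp: eventually_sequentially)
  have "\<forall>\<^sub>F w in F. norm (g w) < 2" using tendsto_norm[OF g] by (intro order_tendstoD(2)) auto
  moreover have "\<forall>\<^sub>F w in F. g w \<noteq> 0" using g by (rule tendsto_imp_eventually_ne) simp
  moreover have "\<forall>\<^sub>F w in F. \<forall>k\<in>{..<k0}. 1 / (A * q ^ k * g w) \<in> U"
  proof (intro eventually_ball_finite ballI)
    fix k assume "k \<in> {..<k0}"
    have "P (A * (1 / (A * q ^ k))) = 0" unfolding P_eq_0_iff using A q0 by (intro exI[of _ k]) simp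
    then have "1 / (A * q ^ k) \<in> zeros_out S" using A(1) unfolding zeros_out_def by blast
    then have "1 / (A * q ^ k * 1) \<in> U" using sep by (auto simp: U_def separating_contour_def)
    moreover have "((\<lambda>w. 1 / (A * q ^ k * g w)) \<longlongrightarrow> 1 / (A * q ^ k * 1)) F"
      by (intro tendsto_intros g) (use A q0 in auto)
    ultimately show "\<forall>\<^sub>F w in F. 1 / (A * q ^ k * g w) \<in> U"
      using opU by (intro topological_tendstoD)
  qed simp
  ultimately show ?thesis
  proof eventually_elim
    case (elim w)
    have "x \<in> U" if hx: "P (A * g w * x) = 0" for x
    proof -
      obtain k where k: "A * g w * x * q ^ k = 1" using hx unfolding P_eq_0_iff by blast
      then have x: "x = 1 / (A * q ^ k * g w)" using A elim q0 by (simp add: field_simps)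
      show ?thesis
      proof (cases "k < k0")
        case True
        then show ?thesis using elim x by simp
      next
        case False
        then have qk: "norm q ^ k < 1 / (2 * norm A * R)" using k0 by simp
        have "norm A * norm q ^ k * norm (g w) \<le> norm A * norm q ^ k * 2"
          using elim by (intro mult_left_mono) auto
        also have "\<dots> \<le> 1 / R" using qk A R by (simp add: field_simps)
        finally have "norm A * norm q ^ k * norm (g w) \<le> 1 / R" .
        moreover have "norm A * norm q ^ k * norm (g w) > 0" using A q0 elim by simp
        ultimately have "R \<le> 1 / (norm A * norm q ^ k * norm (g w))"
          using R by (simp add: field_simps)
        then have "R \<le> norm x" unfolding x by (simp add: norm_divide norm_mult norm_power)
        then show ?thesis by (rule R(2))
      qed
    qed
    then show ?case by (auto simp: U_def)
  qed
qed

section \<open>Continuity in the deformation\<close>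

lemma lat_term_continuous:
  fixes Y :: "'p :: topological_space set"
  assumes c: "continuous_on Y A2" "continuous_on Y A3" "continuous_on Y X"
    and nz: "\<And>y. y \<in> Y \<Longrightarrow> X y \<noteq> 0" "a1 \<noteq> 0" "\<And>y. y \<in> Y \<Longrightarrow> A2 y \<noteq> 0" "\<And>y. y \<in> Y \<Longrightarrow> A3 y \<noteq> 0"
      "b1 \<noteq> 0" "b2 \<noteq> 0" "b3 \<noteq> 0"
  shows "continuous_on Y (\<lambda>y. lat_term a1 (A2 y) (A3 y) b1 b2 b3 (X y) m)"
proof -
  have 1: "continuous_on Y (\<lambda>y. P (q powi (1 + m) / (A y * X y)))"
    if "continuous_on Y A" "\<And>y. y \<in> Y \<Longrightarrow> A y \<noteq> 0" for A
    by (intro P_continuous continuous_on_divide continuous_on_mult continuous_on_const c that) (use nz that in auto)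
  have 2: "continuous_on Y (\<lambda>y. P (q powi (1 - m) * X y / b))" if "b \<noteq> 0" for b
    by (intro P_continuous continuous_on_divide continuous_on_mult continuous_on_const c) (use that in auto)
  show ?thesis unfolding lat_term_def
    by (intro continuous_on_mult 1 2 c continuous_on_const continuous_on_divide continuous_on_power_int)
       (use nz in auto)
qed

lemma lat_sum_continuous:
  fixes Y :: "'p :: topological_space set"
  assumes Y: "compact Y" and c: "continuous_on Y A2" "continuous_on Y A3" "continuous_on Y X"
    and X0: "\<And>y. y \<in> Y \<Longrightarrow> X y \<noteq> 0"
    and a: "\<And>y. y \<in> Y \<Longrightarrow> a1 * A2 y * A3 y = s" and b: "b1 * b2 * b3 = s"
  shows "continuous_on Y (\<lambda>y. lat_sum a1 (A2 y) (A3 y) b1 b2 b3 (X y))"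
proof (cases "Y = {}")
  case False
  have nz: "a1 \<noteq> 0" "\<And>y. y \<in> Y \<Longrightarrow> A2 y \<noteq> 0" "\<And>y. y \<in> Y \<Longrightarrow> A3 y \<noteq> 0"
    using a s0 False by fastforce+
  have b0: "b1 \<noteq> 0" "b2 \<noteq> 0" "b3 \<noteq> 0" using b s0 by auto
  obtain C where C: "\<forall>y\<in>Y. \<forall>m. norm (lat_term a1 (A2 y) (A3 y) b1 b2 b3 (X y) m) \<le> C * norm q ^ nat \<bar>m\<bar>"
    using lat_term_compact_bound[OF Y c X0 a b] by blast
  have ul: "uniform_limit Y (\<lambda>S y. \<Sum>m\<in>S. lat_term a1 (A2 y) (A3 y) b1 b2 b3 (X y) m)
      (\<lambda>y. lat_sum a1 (A2 y) (A3 y) b1 b2 b3 (X y)) (finite_subsets_at_top UNIV)"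
    unfolding lat_sum_def using C by (intro Weierstrass_m_test_general[OF _ summable_int_geometric[of C]]) auto
  have "continuous_on Y (\<lambda>y. \<Sum>m\<in>S. lat_term a1 (A2 y) (A3 y) b1 b2 b3 (X y) m)" for S
    by (intro continuous_on_sum lat_term_continuous c X0 nz b0)
  then show ?thesis
    by (intro uniform_limit_theorem[OF _ ul] always_eventually) auto
qed simp

text \<open>The excluded parameters are reached by continuity from $(a_2 e^w, a_3 e^{-w})$, $w \to 0$, with the
  contour held fixed.\<close>

lemma integral_value:
  assumes a: "a1 * a2 * a3 = s" and b: "b1 * b2 * b3 = s"
    and M: "M1 + M2 + M3 = 0" and N: "N1 + N2 + N3 = 0"
  defines "A1 \<equiv> q powi M1 * a1" and "A2 \<equiv> q powi M2 * a2" and "A3 \<equiv> q powi M3 * a3"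
    and "B1 \<equiv> q powi N1 * b1" and "B2 \<equiv> q powi N2 * b2" and "B3 \<equiv> q powi N3 * b3"
  assumes sep: "separates {B1,B2,B3} {A1,A2,A3} \<gamma>"
  shows "pairing \<gamma> (lat_sum a1 a2 a3 b1 b2 b3) A1 A2 A3 B1 B2 B3 *
      (prefactor a1 a2 a3 M1 M2 M3 * prefactor b1 b2 b3 N1 N2 N3) *
      Pm9 A1 A2 A3 B1 B2 B3 =
    2 * of_real pi * \<i> *
      Pq9 a1 a2 a3 b1 b2 b3"
proof -
  have nz: "a1 \<noteq> 0" "a2 \<noteq> 0" "a3 \<noteq> 0" "b1 \<noteq> 0" "b2 \<noteq> 0" "b3 \<noteq> 0" using a b s0 by auto
  have Anz: "A1 \<noteq> 0" "A2 \<noteq> 0" "A3 \<noteq> 0" "B1 \<noteq> 0" "B2 \<noteq> 0" "B3 \<noteq> 0"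
    using nz q0 by (auto simp: A1_def A2_def A3_def B1_def B2_def B3_def)
  \<comment> \<open>Opposite exponents keep the product a2 a3 and with it the balancing condition,
    while the quotient u/v and the products b_j u move off the zeros of theta.\<close>
  define u where "u = (\<lambda>w. a2 * exp w)"
  define v where "v = (\<lambda>w. a3 * exp (- w))"
  define U where "U = (\<lambda>w. q powi M2 * u w)"
  define V where "V = (\<lambda>w. q powi M3 * v w)"
  have U: "U w = A2 * exp w" and V: "V w = A3 * exp (- w)" for w
    by (simp_all add: U_def V_def u_def v_def A2_def A3_def)
  have uv: "a1 * u w * v w = s" for w
    using a by (simp add: u_def v_def exp_minus field_simps)
  have z: "u 0 = a2" "v 0 = a3" "U 0 = A2" "V 0 = A3"
    by (simp_all add: u_def v_def U V)
  have lim: "(u \<longlongrightarrow> a2) (at 0)" "(v \<longlongrightarrow> a3) (at 0)" "(U \<longlongrightarrow> A2) (at 0)" "(V \<longlongrightarrow> A3) (at 0)"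
  proof -
    have e: "((\<lambda>w::complex. exp w) \<longlongrightarrow> exp 0) (at 0)" "((\<lambda>w::complex. exp (- w)) \<longlongrightarrow> exp (- 0)) (at 0)"
      by (intro tendsto_intros)+
    show "(u \<longlongrightarrow> a2) (at 0)" "(v \<longlongrightarrow> a3) (at 0)" "(U \<longlongrightarrow> A2) (at 0)" "(V \<longlongrightarrow> A3) (at 0)"
      unfolding u_def v_def U V using tendsto_mult_left[OF e(1)] tendsto_mult_left[OF e(2)] by simp_all
  qed
  define I where "I = (\<lambda>w. contour_integral \<gamma> (\<lambda>x. lat_sum a1 (u w) (v w) b1 b2 b3 x * kernel A1 (U w) (V w) B1 B2 B3 x))"
  have ev_sep: "\<forall>\<^sub>F w in at 0. separates {B1,B2,B3} {A1, U w, V w} \<gamma>"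
  proof -
    have e: "((\<lambda>w::complex. exp w) \<longlongrightarrow> 1) (at 0)" "((\<lambda>w::complex. exp (- w)) \<longlongrightarrow> 1) (at 0)"
      using tendsto_exp[OF tendsto_ident_at, of "0::complex" UNIV] tendsto_exp[OF tendsto_minus[OF tendsto_ident_at], of "0::complex" UNIV] by simp_all
    have "\<forall>\<^sub>F w in at 0. \<forall>x. P (A2 * exp w * x) = 0 \<longrightarrow> x \<notin> path_image \<gamma> \<and> winding_number \<gamma> x = 0"
      by (rule eventually_zeros_outside[OF sep _ _ e(1)]) (use Anz in auto)
    moreover have "\<forall>\<^sub>F w in at 0. \<forall>x. P (A3 * exp (- w) * x) = 0 \<longrightarrow> x \<notin> path_image \<gamma> \<and> winding_number \<gamma> x = 0"
      by (rule eventually_zeros_outside[OF sep _ _ e(2)]) (use Anz in auto)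
    ultimately show ?thesis
    proof eventually_elim
      case (elim w)
      have "x \<notin> path_image \<gamma> \<and> winding_number \<gamma> x = 0" if "x \<in> zeros_out {A1, U w, V w}" for x
      proof -
        have "P (A1 * x) = 0 \<or> P (A2 * exp w * x) = 0 \<or> P (A3 * exp (- w) * x) = 0"
          using that by (simp add: zeros_out_def U V)
        moreover have "x \<notin> path_image \<gamma> \<and> winding_number \<gamma> x = 0" if "P (A1 * x) = 0"
          using sep that by (auto simp: separating_contour_def zeros_out_def)
        ultimately show ?thesis using elim by blast
      qed
      then show ?case using sep unfolding separating_contour_def by blast
    qed
  qed
  have "u w / v w = a2 / a3 * exp (2 * w)" for w
    by (simp add: u_def v_def exp_minus exp_double power2_eq_square divide_inverse)
  then have ev0: "\<forall>\<^sub>F w in at 0. theta (u w / v w) \<noteq> 0"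
    using eventually_theta_ne_0[of "a2 / a3" 2] nz by simp
  have evb: "\<forall>\<^sub>F w in at 0. theta (bb * u w) \<noteq> 0" if "bb \<noteq> 0" for bb
    using eventually_theta_ne_0[of "bb * a2" 1] nz that by (simp add: u_def mult.assoc)
  have ev: "\<forall>\<^sub>F w in at 0. I w * (prefactor a1 (u w) (v w) M1 M2 M3 * prefactor b1 b2 b3 N1 N2 N3) *
      Pm9 A1 (U w) (V w) B1 B2 B3 =
    2 * of_real pi * \<i> *
      Pq9 a1 (u w) (v w) b1 b2 b3"
    using ev_sep ev0 evb[OF nz(4)] evb[OF nz(5)] evb[OF nz(6)]
  proof eventually_elim
    case (elim w)
    show ?case
      unfolding I_def A1_def B1_def B2_def B3_def U_def V_def
      by (rule generic_value[OF uv b M N]) (use elim in \<open>simp_all only: A1_def B1_def B2_def B3_def U_def V_def not_False_eq_True\<close>)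
  qed
  have I_lim: "(I \<longlongrightarrow> I 0) (at 0)"
  proof -
    have vp: "valid_path \<gamma>" using sep by (simp add: separating_contour_def)
    obtain W where W: "open W" "path_image \<gamma> \<subseteq> W" "compact (closure W)" "closure W \<subseteq> regular {B1,B2,B3} {A1,A2,A3}"
      by (rule regular_neighbourhood[OF sep]) auto
    define K where "K = closure W"
    have K: "compact K" "W \<subseteq> K" "K \<subseteq> regular {B1,B2,B3} {A1,A2,A3}" using W closure_subset by (auto simp: K_def)
    have K0: "x \<noteq> 0" if "x \<in> K" for x using K that by auto
    define h where "h = (\<lambda>w x. lat_sum a1 (u w) (v w) b1 b2 b3 x)"
    define g where "g = (\<lambda>w x. (P (A1 * x) * P (U w * x) * P (V w * x)) * Pd3 B1 B2 B3 x * x)"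
    have Y: "compact (cball (0::complex) 1 \<times> K)" by (intro compact_Times K compact_cball)
    have fs: "continuous_on (cball (0::complex) 1 \<times> K) (\<lambda>y. exp (fst y))" "continuous_on (cball (0::complex) 1 \<times> K) (\<lambda>y. exp (- fst y))"
      "continuous_on (cball (0::complex) 1 \<times> K) snd"
      by (intro continuous_on_exp continuous_on_minus continuous_on_fst continuous_on_snd continuous_on_id)+
    have hu: "uniform_limit K h (h 0) (at 0)"
    proof (rule uniform_limit_at_0_if_continuous[OF K(1)])
      show "continuous_on (cball 0 1 \<times> K) (\<lambda>y. h (fst y) (snd y))"
        unfolding h_def by (rule lat_sum_continuous[OF Y])
          (use uv b K0 in \<open>auto simp: u_def v_def intro!: continuous_on_mult continuous_on_const fs\<close>)
    qed
    have gu: "uniform_limit K g (g 0) (at 0)"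
    proof (rule uniform_limit_at_0_if_continuous[OF K(1)])
      show "continuous_on (cball 0 1 \<times> K) (\<lambda>y. g (fst y) (snd y))"
        unfolding g_def U V
        by (intro continuous_on_mult P_continuous continuous_on_divide continuous_on_const fs) (use K0 in auto)
    qed
    have h_hol: "h w holomorphic_on - {0}" for w unfolding h_def by (rule lat_sum_holomorphic[OF uv b])
    have g_hol: "g w holomorphic_on - {0}" for w unfolding g_def by (intro holomorphic_intros) auto
    have KK: "K \<subseteq> - {0}" using K0 by auto
    have hb: "bounded (h 0 ` K)"
      by (intro compact_imp_bounded compact_continuous_image K holomorphic_on_imp_continuous_on holomorphic_on_subset[OF h_hol KK])
    have g0: "g 0 x \<noteq> 0" if "x \<in> K" for x
    proof -
      have "x \<in> regular {B1,B2,B3} {A1,A2,A3}" using K that by blast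
      then show ?thesis by (auto simp: g_def z zeros_in_def zeros_out_def)
    qed
    \<comment> \<open>The lower bound on the compact set \<open>K\<close> makes the quotients
      converge uniformly and keeps the denominators free of zeros for small w.\<close>
    obtain \<beta> where \<beta>: "\<beta> > 0" "\<And>x. x \<in> K \<Longrightarrow> \<beta> \<le> norm (g 0 x)"
    proof -
      have "compact (g 0 ` K)"
        by (intro compact_continuous_image K holomorphic_on_imp_continuous_on holomorphic_on_subset[OF g_hol KK])
      moreover have "0 \<notin> g 0 ` K" using g0 by fastforce
      ultimately obtain d where "d > 0" "\<forall>x\<in>g 0 ` K. d \<le> dist 0 x"
        using separate_point_closed[of "g 0 ` K" 0] compact_imp_closed by blast
      then show ?thesis using that by simp
    qed
    have "uniform_limit K (\<lambda>w x. h w x / g w x) (\<lambda>x. h 0 x / g 0 x) (at 0)"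
      by (rule uniform_lim_divide[OF hu gu hb \<beta>(2,1)])
    then have ul: "uniform_limit W (\<lambda>w x. h w x / g w x) (\<lambda>x. h 0 x / g 0 x) (at 0)"
      by (rule uniform_limit_on_subset[OF _ K(2)])
    have hol: "\<forall>\<^sub>F w in at 0. (\<lambda>x. h w x / g w x) holomorphic_on W"
      using uniform_limitD[OF gu \<beta>(1)]
    proof eventually_elim
      case (elim w)
      have "g w x \<noteq> 0" if "x \<in> K" for x
      proof
        assume "g w x = 0"
        then have "norm (g 0 x) < \<beta>" using elim that by (auto simp: dist_norm)
        then show False using \<beta>(2)[OF that] by simp
      qed
      then show ?case using K(2) KK
        by (intro holomorphic_on_divide holomorphic_on_subset[OF h_hol] holomorphic_on_subset[OF g_hol]) auto
    qed
    have hol0: "(\<lambda>x. h 0 x / g 0 x) holomorphic_on W"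
      using K(2) KK g0
      by (intro holomorphic_on_divide holomorphic_on_subset[OF h_hol] holomorphic_on_subset[OF g_hol]) auto
    have "((\<lambda>w. contour_integral \<gamma> (\<lambda>x. h w x / g w x)) \<longlongrightarrow> contour_integral \<gamma> (\<lambda>x. h 0 x / g 0 x)) (at 0)"
      by (rule contour_integral_tendsto[OF W(1) vp W(2) hol hol0 ul])
    then show ?thesis by (simp add: I_def h_def g_def kernel_def)
  qed
  have l1: "((\<lambda>w. I w * (prefactor a1 (u w) (v w) M1 M2 M3 * prefactor b1 b2 b3 N1 N2 N3) *
      Pm9 A1 (U w) (V w) B1 B2 B3)
     \<longlongrightarrow> I 0 * (prefactor a1 a2 a3 M1 M2 M3 * prefactor b1 b2 b3 N1 N2 N3) *
      Pm9 A1 A2 A3 B1 B2 B3) (at 0)"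
    unfolding prefactor_def using nz by (intro tendsto_mult tendsto_const I_lim P_tendsto tendsto_power_int lim) auto
  have l2: "((\<lambda>w. 2 * of_real pi * \<i> *
      Pq9 a1 (u w) (v w) b1 b2 b3) \<longlongrightarrow>
     2 * of_real pi * \<i> *
      Pq9 a1 a2 a3 b1 b2 b3) (at 0)"
    using nz by (intro tendsto_mult tendsto_const P_tendsto tendsto_divide lim) auto
  have "I 0 * (prefactor a1 a2 a3 M1 M2 M3 * prefactor b1 b2 b3 N1 N2 N3) *
      Pm9 A1 A2 A3 B1 B2 B3 =
     2 * of_real pi * \<i> *
      Pq9 a1 a2 a3 b1 b2 b3"
    by (rule tendsto_unique[OF at_neq_bot Lim_transform_eventually[OF l1 ev] l2])
  then show ?thesis by (simp add: I_def z)
qed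

section \<open>Interchange of sum and integral\<close>

lemma integrals_has_sum:
  assumes sep: "separates {B1,B2,B3} {A1,A2,A3} \<gamma>"
    and a: "a1 * a2 * a3 = s" and b: "b1 * b2 * b3 = s"
  shows "((\<lambda>m. contour_integral \<gamma> (\<lambda>x. lat_term a1 a2 a3 b1 b2 b3 x m * kernel A1 A2 A3 B1 B2 B3 x)) has_sum
    pairing \<gamma> (lat_sum a1 a2 a3 b1 b2 b3) A1 A2 A3 B1 B2 B3) UNIV"
proof -
  have nz: "a1 \<noteq> 0" "a2 \<noteq> 0" "a3 \<noteq> 0" "b1 \<noteq> 0" "b2 \<noteq> 0" "b3 \<noteq> 0" using a b s0 by auto
  have vp: "valid_path \<gamma>" using sep by (simp add: separating_contour_def)
  obtain W where W: "open W" "path_image \<gamma> \<subseteq> W" "compact (closure W)" "closure W \<subseteq> regular {B1,B2,B3} {A1,A2,A3}"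
    by (rule regular_neighbourhood[OF sep]) auto
  define K where "K = closure W"
  have K: "compact K" "W \<subseteq> K" "K \<subseteq> regular {B1,B2,B3} {A1,A2,A3}" using W closure_subset by (auto simp: K_def)
  have K0: "x \<noteq> 0" if "x \<in> K" for x using K that by auto
  have Fh: "kernel A1 A2 A3 B1 B2 B3 holomorphic_on W"
    using holomorphic_on_subset[OF kernel_holomorphic] K by blast
  have "compact (kernel A1 A2 A3 B1 B2 B3 ` K)"
    using holomorphic_on_subset[OF kernel_holomorphic K(3)] K(1)
    by (intro compact_continuous_image holomorphic_on_imp_continuous_on)
  then have "bounded (kernel A1 A2 A3 B1 B2 B3 ` K)" by (rule compact_imp_bounded)
  then obtain C1 where C1: "\<forall>y\<in>kernel A1 A2 A3 B1 B2 B3 ` K. norm y \<le> C1"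
    unfolding bounded_iff by (elim exE)
  obtain C where C: "\<forall>x\<in>K. \<forall>m. norm (lat_term a1 a2 a3 b1 b2 b3 x m) \<le> C * norm q ^ nat \<bar>m\<bar>"
    using lat_term_compact_bound[OF K(1), of "\<lambda>_. a2" "\<lambda>_. a3" "\<lambda>x. x" a1 b1 b2 b3] a b K0 by fastforce
  define f where "f = (\<lambda>m x. lat_term a1 a2 a3 b1 b2 b3 x m * kernel A1 A2 A3 B1 B2 B3 x)"
  have fh: "f m holomorphic_on W" for m
    unfolding f_def using K0 K(2)
    by (intro holomorphic_on_mult Fh holomorphic_on_subset[OF lat_term_holomorphic[OF nz]]) auto
  \<comment> \<open>Uniform convergence holds on a whole neighbourhood of the contour: the kernel is
    bounded there and the terms are dominated by a geometric series in |m|.\<close>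
  have ul: "uniform_limit W (\<lambda>S x. \<Sum>m\<in>S. f m x) (\<lambda>x. lat_sum a1 a2 a3 b1 b2 b3 x * kernel A1 A2 A3 B1 B2 B3 x)
      (finite_subsets_at_top UNIV)"
  proof (rule Weierstrass_m_test_general'[OF _ _ summable_int_geometric[of "C * C1"]])
    fix m :: int and x assume "x \<in> W"
    then have x: "x \<in> K" using K by blast
    have 1: "norm (lat_term a1 a2 a3 b1 b2 b3 x m) \<le> C * norm q ^ nat \<bar>m\<bar>" using C x by blast
    have "norm (f m x) \<le> (C * norm q ^ nat \<bar>m\<bar>) * C1"
      unfolding f_def norm_mult
      by (rule mult_mono[OF 1 _ order_trans[OF norm_ge_zero 1] norm_ge_zero]) (use C1 x in blast)
    then show "norm (f m x) \<le> C * C1 * norm q ^ nat \<bar>m\<bar>" by (simp add: mult_ac)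
    show "((\<lambda>m. f m x) has_sum lat_sum a1 a2 a3 b1 b2 b3 x * kernel A1 A2 A3 B1 B2 B3 x) UNIV"
      unfolding f_def by (intro has_sum_cmult_left lat_sum_has_sum a b K0 x)
  qed
  have "((\<lambda>S. contour_integral \<gamma> (\<lambda>x. \<Sum>m\<in>S. f m x)) \<longlongrightarrow>
      pairing \<gamma> (lat_sum a1 a2 a3 b1 b2 b3) A1 A2 A3 B1 B2 B3) (finite_subsets_at_top UNIV)"
  proof (rule contour_integral_tendsto[OF W(1) vp W(2) _ _ ul])
    show "\<forall>\<^sub>F S in finite_subsets_at_top UNIV. (\<lambda>x. \<Sum>m\<in>S. f m x) holomorphic_on W"
      by (intro always_eventually allI holomorphic_on_sum fh)
    show "(\<lambda>x. lat_sum a1 a2 a3 b1 b2 b3 x * kernel A1 A2 A3 B1 B2 B3 x) holomorphic_on W"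
      using K0 K(2) by (intro holomorphic_on_mult Fh holomorphic_on_subset[OF lat_sum_holomorphic[OF a b]]) auto
  qed
  moreover have "\<forall>\<^sub>F S in finite_subsets_at_top UNIV. contour_integral \<gamma> (\<lambda>x. \<Sum>m\<in>S. f m x) =
      (\<Sum>m\<in>S. contour_integral \<gamma> (f m))"
    by (rule eventually_finite_subsets_at_top_weakI)
      (intro contour_integral_sum contour_integrable_holomorphic_simple[OF fh W(1) vp W(2)])
  ultimately have "((\<lambda>S. \<Sum>m\<in>S. contour_integral \<gamma> (f m)) \<longlongrightarrow>
      pairing \<gamma> (lat_sum a1 a2 a3 b1 b2 b3) A1 A2 A3 B1 B2 B3) (finite_subsets_at_top UNIV)"
    by (rule Lim_transform_eventually)
  then show ?thesis unfolding has_sum_def f_def .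
qed

section \<open>Return to the original integrals\<close>

lemma prod_1_3: "(\<Prod>j=1..3. f j) = f 1 * f 2 * f (3::nat)"
  by (simp add: numeral_eq_Suc prod.atLeast_Suc_atMost_Suc_shift mult_ac)

text \<open>The substitution x = s^m z removes m from the poles. The leading \<open>s powi m\<close>
  is the derivative dx/dz, to be absorbed when the contour is dilated.\<close>

lemma integrand_eq:
  assumes z: "z \<noteq> 0"
  shows "integrand q s a b M N m z =
    s powi m * (lat_term (a 1) (a 2) (a 3) (b 1) (b 2) (b 3) (s powi m * z) m *
      kernel (q powi M 1 * a 1) (q powi M 2 * a 2) (q powi M 3 * a 3)
         (q powi N 1 * b 1) (q powi N 2 * b 2) (q powi N 3 * b 3) (s powi m * z)) / (2 * of_real pi * \<i>)"
proof -
  define x where "x = s powi m * z"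
  have qp: "q powi m = s powi m * s powi m"
    unfolding q_powi mult_2 using s0 by (intro power_int_add) simp
  have qm: "q powi (1 + m) = q * (s powi m * s powi m)" "q powi (1 - m) = q / (s powi m * s powi m)"
    using q0 by (simp_all add: power_int_add power_int_diff flip: qp)
  have e1: "q * s powi m / (c * z) = q powi (1 + m) / (c * x)" for c
    unfolding qm x_def using s0 by simp
  have e2: "q * s powi (- m) * z / c = q powi (1 - m) * x / c" for c
    unfolding qm x_def using s0 by (simp add: power_int_minus divide_inverse)
  have e3: "q powi k * s powi m * c * z = q powi k * c * x" for k c
    by (simp add: x_def mult_ac)
  have e4: "q powi k * s powi (- m) * c / z = q powi k * c / x" for k c
    unfolding x_def using s0 by (simp add: power_int_minus divide_inverse mult_ac)
  have zz: "z = x / s powi m" using s0 by (simp add: x_def)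
  have w: "(-1) powi m / z powi (3 * m) = (-1) powi m * s powi (3 * m^2) / x powi (3 * m)"
  proof -
    have "x powi (3 * m) = s powi (3 * m^2) * z powi (3 * m)"
      using s0 by (simp add: x_def power_int_mult_distrib power2_eq_square mult_ac flip: power_int_mult)
    then show ?thesis using s0 by simp
  qed
  have v: "1 / (2 * of_real pi * \<i> * z) = s powi m / x / (2 * of_real pi * \<i>)"
    unfolding zz by simp
  have rearr: "(n1 * m1) / (d1 * f1) * ((n2 * m2) / (d2 * f2)) * ((n3 * m3) / (d3 * f3)) * w * (S / x / p) =
     S * ((n1 * n2 * n3) * (m1 * m2 * m3) * w * (1 / ((d1 * d2 * d3) * (f1 * f2 * f3) * x))) / p"
    for n1 n2 n3 m1 m2 m3 d1 d2 d3 f1 f2 f3 w S x p :: complex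
    by (simp add: divide_inverse mult_ac)
  show ?thesis
    unfolding integrand_def prod_1_3 e1 e2 e3 e4 w v lat_term_def kernel_def x_def[symmetric] rearr ..
qed

end

theorem theorem4p3:
  fixes q s :: complex
    and a b :: "nat \<Rightarrow> complex"
    and M N :: "nat \<Rightarrow> int"
    and \<gamma> :: "int \<Rightarrow> real \<Rightarrow> complex"
  assumes q: "0 < norm q" "norm q < 1"
    and s: "s ^ 2 = q"
    and nonzero: "\<And>j. j \<in> {1..3} \<Longrightarrow> a j \<noteq> 0" "\<And>j. j \<in> {1..3} \<Longrightarrow> b j \<noteq> 0"
    and generic: "generic q a b M N"
    and balance_ab: "a 1 * a 2 * a 3 = s" "b 1 * b 2 * b 3 = s"
    and balance_MN: "M 1 + M 2 + M 3 = 0" "N 1 + N 2 + N 3 = 0"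
    and contour: "\<And>m. separating_contour (poles_to_zero q s b N m) (poles_to_infinity q s a M m) (\<gamma> m)"
  shows "((\<lambda>m::int. contour_integral (\<gamma> m) (integrand q s a b M N m)) has_sum
           (1 / (\<Prod>j=1..3. q powi (binom2 (M j) + binom2 (N j)) * a j powi M j * b j powi N j) *
            (\<Prod>j=1..3. \<Prod>k=1..3.
               qfac (q / (a j * b k)) q / qfac (a j * b k * q powi (M j + N k)) q))) UNIV"
proof -
  interpret qpoch_sqrt q s using q s by unfold_locales auto
  define A where "A = (\<lambda>j. q powi M j * a j)"
  define B where "B = (\<lambda>j. q powi N j * b j)"
  define C where "C = (\<lambda>m t. s powi m * \<gamma> m t)"
  define f where "f = (\<lambda>m x. lat_term (a 1) (a 2) (a 3) (b 1) (b 2) (b 3) x m * kernel (A 1) (A 2) (A 3) (B 1) (B 2) (B 3) x)"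
  have three: "j \<in> {1..3} \<longleftrightarrow> j = 1 \<or> j = 2 \<or> j = (3::nat)" for j by auto
  \<comment> \<open>Dilated by s^m, the pole sets no longer depend on m, so that the single contour
    \<open>C 0\<close> can serve for all m.\<close>
  have sep: "separates {B 1, B 2, B 3} {A 1, A 2, A 3} (C m)" for m
  proof -
    have sm: "s powi m \<noteq> 0" using s0 by simp
    show ?thesis unfolding C_def
    proof (rule separating_contour_mono[OF separating_contour_scale[OF contour sm]]; rule subsetI)
      fix x assume "x \<in> zeros_in {B 1, B 2, B 3}"
      then obtain j where j: "j \<in> {1..3}" "P (B j / x) = 0" "x \<noteq> 0" unfolding three by (auto simp: zeros_in_def)
      then obtain k where "B j / x * q ^ k = 1" unfolding P_eq_0_iff by blast
      then have "x = s powi m * (q powi (N j + int k) * s powi (- m) * b j)"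
        using j sm q0 by (simp add: B_def power_int_add power_int_minus field_simps)
      then show "x \<in> insert 0 ((\<lambda>z. s powi m * z) ` poles_to_zero q s b N m)"
        using j(1) unfolding poles_to_zero_def by blast
    next
      fix x assume "x \<in> zeros_out {A 1, A 2, A 3}"
      then obtain j where j: "j \<in> {1..3}" "P (A j * x) = 0" unfolding three by (auto simp: zeros_out_def)
      then obtain k where "A j * x * q ^ k = 1" unfolding P_eq_0_iff by blast
      then have "x = s powi m * (q powi (- M j - int k) * s powi (- m) / a j)"
        using nonzero(1)[OF j(1)] s0 q0
        by (simp add: A_def power_int_diff power_int_minus field_simps)
      then show "x \<in> (\<lambda>z. s powi m * z) ` poles_to_infinity q s a M m"
        using j(1) unfolding poles_to_infinity_def by blast
    qed
  qed
  have b0: "b 1 \<noteq> 0" "b 2 \<noteq> 0" "b 3 \<noteq> 0" and a0: "a 1 \<noteq> 0" "a 2 \<noteq> 0" "a 3 \<noteq> 0"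
    using nonzero by auto
  have integral: "contour_integral (\<gamma> m) (integrand q s a b M N m) = contour_integral (C 0) (f m) / (2 * of_real pi * \<i>)" for m
  proof -
    have vp: "valid_path (\<gamma> m)" and n0: "0 \<notin> path_image (\<gamma> m)"
      using contour[of m] by (auto simp: separating_contour_def)
    have fh: "f m holomorphic_on regular {B 1, B 2, B 3} {A 1, A 2, A 3}"
      unfolding f_def
      by (intro holomorphic_on_mult kernel_holomorphic holomorphic_on_subset[OF lat_term_holomorphic[OF a0 b0]]) auto
    have "contour_integral (\<gamma> m) (integrand q s a b M N m) =
        contour_integral (\<gamma> m) (\<lambda>z. s powi m * f m (s powi m * z) / (2 * of_real pi * \<i>))"
      unfolding f_def A_def B_def
      by (rule contour_integral_eq, rule integrand_eq) (use n0 in blast)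
    also have "\<dots> = contour_integral (C m) (\<lambda>x. f m x / (2 * of_real pi * \<i>))"
      unfolding C_def contour_integral_scale[OF vp] by simp
    also have "\<dots> = contour_integral (C 0) (\<lambda>x. f m x / (2 * of_real pi * \<i>))"
    proof (rule separating_contour_independent[OF sep sep])
      show "(\<lambda>x. f m x / (2 * of_real pi * \<i>)) holomorphic_on regular {B 1, B 2, B 3} {A 1, A 2, A 3}"
        by (intro holomorphic_on_divide fh holomorphic_on_const) auto
    qed (simp_all only: closed_zeros countable_zeros_in countable_zeros_out countable_empty countable_insert finite.intros)
    also have "\<dots> = contour_integral (C 0) (f m) / (2 * of_real pi * \<i>)"
    proof (rule contour_integral_div, rule contour_integrable_holomorphic_simple[OF fh])
      show "open (regular {B 1, B 2, B 3} {A 1, A 2, A 3})"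
        by (simp only: open_Compl closed_zeros finite.intros)
    qed (use sep[of 0] in \<open>unfold separating_contour_def, blast+\<close>)
    finally show ?thesis .
  qed
  define I where "I = contour_integral (C 0) (\<lambda>x. lat_sum (a 1) (a 2) (a 3) (b 1) (b 2) (b 3) x * kernel (A 1) (A 2) (A 3) (B 1) (B 2) (B 3) x)"
  have "((\<lambda>m. contour_integral (C 0) (f m)) has_sum I) UNIV"
    unfolding f_def I_def by (rule integrals_has_sum[OF sep balance_ab])
  then have "((\<lambda>m. contour_integral (C 0) (f m) * (1 / (2 * of_real pi * \<i>))) has_sum I * (1 / (2 * of_real pi * \<i>))) UNIV"
    by (rule has_sum_cmult_left)
  then have sum: "((\<lambda>m. contour_integral (\<gamma> m) (integrand q s a b M N m)) has_sum I / (2 * of_real pi * \<i>)) UNIV"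
    unfolding integral by simp
  define G where "G = (\<Prod>j=1..3. \<Prod>k=1..3. P (a j * b k * q powi (M j + N k)))"
  define Q where "Q = (\<Prod>j=1..3. \<Prod>k=1..3. P (q / (a j * b k)))"
  define Kp where "Kp = (\<Prod>j=1..3. q powi (binom2 (M j) + binom2 (N j)) * a j powi M j * b j powi N j)"
  have BA: "B k * A j = a j * b k * q powi (M j + N k)" for j k
    using q0 by (simp add: A_def B_def power_int_add mult_ac)
  have Ae: "q powi M j * a j = A j" and Be: "q powi N j * b j = B j" for j
    by (simp_all add: A_def B_def)
  have val: "I * (prefactor (a 1) (a 2) (a 3) (M 1) (M 2) (M 3) * prefactor (b 1) (b 2) (b 3) (N 1) (N 2) (N 3)) * G = 2 * of_real pi * \<i> * Q"
    using integral_value[OF balance_ab balance_MN, unfolded Ae Be, OF sep[of 0]]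
    unfolding BA I_def[symmetric] G_def Q_def prod_1_3 .
  have KK: "prefactor (a 1) (a 2) (a 3) (M 1) (M 2) (M 3) * prefactor (b 1) (b 2) (b 3) (N 1) (N 2) (N 3) = Kp"
  proof -
    have "2 * binom2 n = n * (n - 1)" for n unfolding binom2_def by (intro dvd_mult_div_cancel) simp
    then have qb: "q powi binom2 n = s powi (n * (n - 1))" for n by (simp add: q_powi)
    show ?thesis unfolding prefactor_def Kp_def prod_1_3 using q0 s0
      by (simp add: power_int_add qb mult_ac)
  qed
  have K0: "Kp \<noteq> 0" unfolding KK[symmetric] using a0 b0 s0 by (simp add: prefactor_def)
  have G0: "G \<noteq> 0"
  proof -
    \<comment> \<open>1/A_j is an outer pole, so it has winding number 0 and cannot be a zero of
      P(B_k/x).\<close>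
    have "P (B k * A j) \<noteq> 0" if j: "j \<in> {1..3}" and k: "k \<in> {1..3}" for j k
    proof -
      have Aj: "A j \<noteq> 0" using nonzero(1)[OF j] q0 by (simp add: A_def)
      then have "1 / A j \<in> zeros_out {A 1, A 2, A 3}" using j unfolding three by (auto simp: zeros_out_def)
      then have "P (B k / (1 / A j)) \<noteq> 0"
        using zeros_disjoint(2)[OF sep[of 0], of "1 / A j" "B k"] k unfolding three by auto
      then show ?thesis by simp
    qed
    then show ?thesis unfolding G_def BA[symmetric] by (simp add: prod_zero_iff)
  qed
  have "I / (2 * of_real pi * \<i>) = 1 / Kp * (Q / G)"
    using val K0 G0 unfolding KK by (simp add: field_simps)
  also have "Q / G = (\<Prod>j=1..3. \<Prod>k=1..3. P (q / (a j * b k)) / P (a j * b k * q powi (M j + N k)))"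
    by (simp add: Q_def G_def prod_dividef)
  finally show ?thesis using sum by (simp only: Kp_def)
qed

end
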